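(* Let $\mathcal{L}\in\overline{\mathbb{L}^q_d}$, let $G$ be a gap of $\mathcal{L}$, let $H=\sigma_d^k(G)$ be a gap, and let $\hat\ell$ be an edge of $H$ such that, for any geolaminations $\mathcal{L}_i\to\mathcal{L}$, $\mathcal{L}_i\in\mathbb{L}^q_d$, and their gaps $H_i\to H$, the leaf $\hat\ell$ is an edge of $H_i$ for large $i$ (e.g., this holds if $\hat\ell$ is a periodic edge of a periodic gap $H$). If $\ell$ is an edge of $G$ with $\sigma_d^k(\ell)=\hat\ell$, then for any geolaminations $\mathcal{L}_i\to\mathcal{L}$, $\mathcal{L}_i\in\mathbb{L}^q_d$, and any sequence of their gaps $G_i\to G$, the leaf $\ell$ is an edge of $G_i$ for large $i$. Thus, (1) a (pre)periodic leaf (edge) of a gap of $\mathcal{L}$ that eventually maps to a periodic gap is rigid, and (2) a finite gap of $\mathcal{L}$ that eventually maps onto a periodic gap is rigid.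
   Context: Fix $d\ge2$. $\mathbb{S}=\mathbb{R}/\mathbb{Z}$ is identified with the unit circle, the boundary of the open unit disk $\mathbb{D}$; $\sigma_d:\mathbb{S}\to\mathbb{S}$ is $z\mapsto z^d$; $\mathrm{CH}(A)$ is the convex hull of $A$; $\overline{ab}$ is the chord with endpoints $a,b\in\mathbb{S}$ (degenerate if $a=b$), and $\sigma_d(\overline{ab})=\overline{\sigma_d(a)\sigma_d(b)}$. A lamination is an equivalence relation $\sim$ on $\mathbb{S}$ with closed graph and finite classes such that convex hulls of distinct classes are disjoint. It is $\sigma_d$-invariant if (D1) $\sigma_d(\mathbf{g})$ is a class for each class $\mathbf{g}$, and (D2) for each class $\mathbf{g}$ the map $\sigma_d:\mathbf{g}\to\sigma_d(\mathbf{g})$ extends to $\mathbb{S}$ as an orientation preserving covering map such that $\mathbf{g}$ is the full preimage of $\sigma_d(\mathbf{g})$ under it. A geolamination $\mathcal{L}$ is a set of (possibly degenerate) chords (leaves), any two distinct ones meeting at most in a common endpoint, such that all points of $\mathbb{S}$ belong to $\mathcal{L}$ and the union $\mathcal{L}^+$ of all leaves (the solid) is closed. A gap is the closure of a component of $\mathbb{D}\setminus\mathcal{L}^+$; for a gap or leaf $G$, $G'=G\cap\mathbb{S}$ is its basis; $G$ is finite if $G'$ is finite; edges of a gap are the non-degenerate chords in its boundary. The image of a gap $G$ is $\sigma_d^k(G)=\mathrm{CH}(\sigma_d^k(G'))$. A gap/leaf $U$ is periodic if $\sigma_d^k(U')=U'$ for some $k>0$; an edge is (pre)periodic if one of its iterated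 images is a non-degenerate periodic leaf. For a $\sigma_d$-invariant lamination $\sim$, $\mathcal{L}_\sim$ is the geolamination consisting of all edges of convex hulls of $\sim$-classes and all points of $\mathbb{S}$; such geolaminations are called ($\sigma_d$-invariant) q-geolaminations and $\mathbb{L}^q_d$ is their family. $\overline{\mathbb{L}^q_d}$ is the set of geolaminations corresponding to the continua in the closure of $\{\mathcal{L}^+:\mathcal{L}\in\mathbb{L}^q_d\}$ in the Hausdorff metric. Convergence of geolaminations means Hausdorff convergence of their solids; convergence of gaps and leaves is in the Hausdorff metric. A leaf/gap $G$ of $\mathcal{L}$ is rigid if every q-geolamination sufficiently close to $\mathcal{L}$ has $G$ as its leaf/gap. *)

theory Defs
  imports "HOL-Analysis.Analysis"
begin

abbreviation circle :: "complex set" where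
  "circle \<equiv> sphere 0 1"

definition sigma :: "nat \<Rightarrow> complex \<Rightarrow> complex" where
  "sigma d z = z ^ d"

definition hausdorff_dist :: "'a::metric_space set \<Rightarrow> 'a set \<Rightarrow> real" where
  "hausdorff_dist A B = max (SUP a\<in>A. infdist a B) (SUP b\<in>B. infdist b A)"

(* Intended for nonempty compact sets, on which hausdorff_dist is a metric. *)
definition hausdorff_tendsto :: "(nat \<Rightarrow> 'a::metric_space set) \<Rightarrow> 'a set \<Rightarrow> bool" where
  "hausdorff_tendsto X A \<longleftrightarrow> (\<lambda>i. hausdorff_dist (X i) A) \<longlonglongrightarrow> 0"

definition lamination :: "(complex \<times> complex) set \<Rightarrow> bool" where
  "lamination R \<longleftrightarrow>
     equiv circle R \<and> closed R \<and> (\<forall>g \<in> circle // R. finite g) \<and>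
     (\<forall>g \<in> circle // R. \<forall>h \<in> circle // R. g \<noteq> h \<longrightarrow> convex hull g \<inter> convex hull h = {})"

(* A covering of the circle preserves orientation iff it lifts to a strictly increasing map of
   the universal cover. *)
definition orientation_preserving_covering :: "(complex \<Rightarrow> complex) \<Rightarrow> bool" where
  "orientation_preserving_covering p \<longleftrightarrow>
     covering_space circle p circle \<and>
     (\<exists>F :: real \<Rightarrow> real. continuous_on UNIV F \<and> strict_mono F \<and>
        (\<forall>t. p (cis (2 * pi * t)) = cis (2 * pi * F t)))"

definition invariant_lamination :: "nat \<Rightarrow> (complex \<times> complex) set \<Rightarrow> bool" where
  "invariant_lamination d R \<longleftrightarrow>
     lamination R \<and>
     (\<forall>g \<in> circle // R. sigma d ` g \<in> circle // R) \<and>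
     (\<forall>g \<in> circle // R. \<exists>p. orientation_preserving_covering p \<and>
        (\<forall>z\<in>g. p z = sigma d z) \<and> g = {z \<in> circle. p z \<in> sigma d ` g})"

definition chords :: "complex set set" where
  "chords = {closed_segment a b |a b. a \<in> circle \<and> b \<in> circle}"

definition solid :: "complex set set \<Rightarrow> complex set" where
  "solid L = \<Union>L"

(* A chord meets the circle exactly in its endpoints, so a common point on the circle is a
   common endpoint. *)
definition geolamination :: "complex set set \<Rightarrow> bool" where
  "geolamination L \<longleftrightarrow>
     L \<subseteq> chords \<and>
     (\<forall>l\<in>L. \<forall>m\<in>L. l \<noteq> m \<longrightarrow> l \<inter> m = {} \<or> (\<exists>x\<in>circle. l \<inter> m = {x})) \<and>
     (\<forall>x\<in>circle. {x} \<in> L) \<and>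
     closed (solid L)"

definition gaps :: "complex set set \<Rightarrow> complex set set" where
  "gaps L = closure ` components (ball 0 1 - solid L)"

definition basis :: "complex set \<Rightarrow> complex set" where
  "basis G = G \<inter> circle"

(* For gaps and for hulls of finite classes. The hull of a two-point class is its own frontier,
   hence its own unique edge; the hull of a singleton has no edges. *)
definition edges :: "complex set \<Rightarrow> complex set set" where
  "edges K = {closed_segment a b |a b.
     a \<in> circle \<and> b \<in> circle \<and> a \<noteq> b \<and> closed_segment a b \<subseteq> frontier K}"

(* sigma_d^k(G) for gaps as well as leaves: the hull of at most two points is a chord. *)
definition sigma_img :: "nat \<Rightarrow> nat \<Rightarrow> complex set \<Rightarrow> complex set" where
  "sigma_img d k G = convex hull ((sigma d ^^ k) ` basis G)"

definition periodic :: "nat \<Rightarrow> complex set \<Rightarrow> bool" where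
  "periodic d U \<longleftrightarrow> (\<exists>k>0. (sigma d ^^ k) ` basis U = basis U)"

definition nondegenerate :: "complex set \<Rightarrow> bool" where
  "nondegenerate l \<longleftrightarrow> (\<forall>x. l \<noteq> {x})"

definition preperiodic_edge :: "nat \<Rightarrow> complex set set \<Rightarrow> complex set \<Rightarrow> bool" where
  "preperiodic_edge d L l \<longleftrightarrow>
     (\<exists>j. sigma_img d j l \<in> L \<and> nondegenerate (sigma_img d j l) \<and> periodic d (sigma_img d j l))"

definition geolam_of :: "(complex \<times> complex) set \<Rightarrow> complex set set" where
  "geolam_of R = (\<Union>g \<in> circle // R. edges (convex hull g)) \<union> {{x} |x. x \<in> circle}"

definition q_geolaminations :: "nat \<Rightarrow> complex set set set" where
  "q_geolaminations d = {geolam_of R |R. invariant_lamination d R}"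

definition q_closure :: "nat \<Rightarrow> complex set set set" where
  "q_closure d = {L. geolamination L \<and>
     (\<forall>e>0. \<exists>M \<in> q_geolaminations d. hausdorff_dist (solid M) (solid L) < e)}"

(* l is eventually an edge of every sequence of gaps, of q-geolaminations tending to L, that
   tends to H. *)
definition persistent_edge ::
    "nat \<Rightarrow> complex set set \<Rightarrow> complex set \<Rightarrow> complex set \<Rightarrow> bool" where
  "persistent_edge d L H l \<longleftrightarrow>
     (\<forall>Ls Hs. (\<forall>i. Ls i \<in> q_geolaminations d) \<longrightarrow>
        hausdorff_tendsto (\<lambda>i. solid (Ls i)) (solid L) \<longrightarrow>
        (\<forall>i. Hs i \<in> gaps (Ls i)) \<longrightarrow>
        hausdorff_tendsto Hs H \<longrightarrow>
        (\<forall>\<^sub>F i in sequentially. l \<in> edges (Hs i)))"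

definition rigid_leaf :: "nat \<Rightarrow> complex set set \<Rightarrow> complex set \<Rightarrow> bool" where
  "rigid_leaf d L l \<longleftrightarrow> l \<in> L \<and>
     (\<exists>e>0. \<forall>M \<in> q_geolaminations d. hausdorff_dist (solid M) (solid L) < e \<longrightarrow> l \<in> M)"

definition rigid_gap :: "nat \<Rightarrow> complex set set \<Rightarrow> complex set \<Rightarrow> bool" where
  "rigid_gap d L G \<longleftrightarrow> G \<in> gaps L \<and>
     (\<exists>e>0. \<forall>M \<in> q_geolaminations d. hausdorff_dist (solid M) (solid L) < e \<longrightarrow> G \<in> gaps M)"

end

(* Fix an iterate f of sigma_d. The key fact is that a leaf m of a q-geolamination M never
   separates the f-images of two circle points of a gap U of M: the edge m lifts to pairwise disjoint
   leaves through all preimages of its endpoints, and counting these preimages on an arc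
   shows that one of the lifts would separate the two points of U.

   Now let U be a gap of M close to G, so that U has an edge l' close to l. The leaf f(l') lies on one side
   of lhat by the key fact, and it does not cut the gap of M that is close to H and has
   lhat as an edge; both being close to lhat, f(l') = lhat, hence l' = l. If f fixes the endpoints of
   an edge l of H, the same argument with l' itself in the role of lhat gives
   f(l') = l', and l' = l because fixed points of f are isolated. For a finite gap
   the key fact confines the vertices of U to the finite set of preimages of the vertices of H. *)

theory Submission
  imports Defs
begin

text \<open>Invariance is available only for the approximating q-geolaminations \<open>M\<close>,
  each of which comes with an invariant lamination. For \<open>L\<close> itself not even the image
  of an edge is known at first to be a leaf. So all dynamics takes place in \<open>M\<close>, and
  \<open>L\<close> enters through Hausdorff estimates that produce gaps and edges of
  \<open>M\<close> near given ones. It is never shown that the image of a gap of \<open>M\<close> is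
  a gap; signs of \<open>side\<close> at basis points replace that. \<open>side\<close> is the
  signed area form: affine in the point, which gives convexity and separation; continuous in all
  three arguments, which makes strict inequalities stable under approximation; and on the circle a
  statement about cyclic order, which links it to the increasing lifts behind (D2). The final
  equality of two close chords uses both directions: each chord has the endpoints of the other on
  its nonnegative side. Such chords can differ only if the short chord between their starting points
  meets the short chord between their end points, which closeness excludes.\<close>

section \<open>Chords and half-planes\<close>

text \<open>Positive iff \<open>z\<close> lies strictly to the left of the line directed from \<open>a\<close> to \<open>b\<close>.\<close>

definition side :: "complex \<Rightarrow> complex \<Rightarrow> complex \<Rightarrow> real" where
  "side a b z = Im (cnj (b - a) * (z - a))"

text \<open>With period 1, \<open>sigma d\<close> becomes multiplication by \<open>d\<close> on the
  parameter, and lifts of circle maps are exactly the functions \<open>F\<close> in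
  \<open>orientation_preserving_covering\<close>.\<close>

definition turn :: "real \<Rightarrow> complex" where
  "turn t = cis (2 * pi * t)"

lemma side_ends [simp]: "side a b a = 0" "side a b b = 0" "side a a z = 0"
  by (simp_all add: side_def algebra_simps)

lemma side_swap: "side b a z = - side a b z"
  by (simp add: side_def algebra_simps)

lemma side_rotate: "side a c b = - side a b c"
  by (simp add: side_def algebra_simps)

lemma side_convex_comb:
  "side a b ((1 - t) *\<^sub>R x + t *\<^sub>R y) = (1 - t) * side a b x + t * side a b y"
  by (simp add: side_def algebra_simps)

lemma side_inner: "side a b z = inner (\<i> * (b - a)) z - inner (\<i> * (b - a)) a"
  by (simp add: side_def inner_complex_def algebra_simps)

lemma tendsto_side [tendsto_intros]:
  assumes "(f \<longlongrightarrow> a) F" "(g \<longlongrightarrow> b) F" "(h \<longlongrightarrow> z) F"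
  shows "((\<lambda>x. side (f x) (g x) (h x)) \<longlongrightarrow> side a b z) F"
  unfolding side_def by (intro tendsto_intros assms)

lemma continuous_on_side [continuous_intros]:
  assumes "continuous_on S f" "continuous_on S g" "continuous_on S h"
  shows "continuous_on S (\<lambda>x. side (f x) (g x) (h x))"
  unfolding side_def by (intro continuous_intros assms)

lemma convex_side:
  "convex {z. side a b z \<ge> 0}" "convex {z. side a b z > 0}"
  "convex {z. side a b z \<le> 0}" "convex {z. side a b z < 0}"
  using convex_halfspace_ge[of "inner (\<i> * (b - a)) a" "\<i> * (b - a)"]
    convex_halfspace_gt[of "inner (\<i> * (b - a)) a" "\<i> * (b - a)"]
    convex_halfspace_le[of "\<i> * (b - a)" "inner (\<i> * (b - a)) a"]
    convex_halfspace_lt[of "\<i> * (b - a)" "inner (\<i> * (b - a)) a"]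
  by (simp_all add: side_inner)

lemma closed_side:
  "closed {z. side a b z \<ge> 0}" "closed {z. side a b z \<le> 0}"
  unfolding side_def by (intro closed_Collect_le continuous_intros)+

lemma side_eq_0_segment:
  assumes "a \<noteq> b" and "side a b z = 0"
  obtains s where "z = (1 - s) *\<^sub>R a + s *\<^sub>R b"
proof -
  \<comment> \<open>The points \<open>a\<close>, \<open>b\<close>, \<open>z\<close> are collinear
    iff this quotient is real; \<open>side a b z\<close> is its imaginary part times
    \<open>(cmod (b - a))\<^sup>2\<close>.\<close>
  define w where "w = (z - a) / (b - a)"
  have "(z - a) * cnj (b - a) = w * ((b - a) * cnj (b - a))"
    using assms(1) by (simp add: w_def)
  also have "\<dots> = w * of_real ((cmod (b - a))\<^sup>2)"
    by (metis complex_norm_square)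
  finally have "Im (cnj (b - a) * (z - a)) = Im w * (cmod (b - a))\<^sup>2"
    by (simp add: mult.commute)
  hence "Im w = 0"
    using assms by (simp add: side_def)
  hence w: "w = of_real (Re w)"
    by (simp add: complex_eq_iff)
  have "z = a + w * (b - a)"
    using assms(1) by (simp add: w_def)
  hence "z = a + of_real (Re w) * (b - a)"
    using w by simp
  hence "z = (1 - Re w) *\<^sub>R a + Re w *\<^sub>R b"
    by (simp add: scaleR_conv_of_real algebra_simps)
  thus thesis by (rule that)
qed

text \<open>Locates a point of the line through distinct \<open>a\<close> and \<open>b\<close> by
  its parameter: the norm is at most 1 iff \<open>s * (1 - s) \<ge> 0\<close>, and equal to 1 iff
  \<open>s\<close> is 0 or 1.\<close>

lemma norm_chord_point:
  fixes a b :: "'a::real_inner"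
  assumes "norm a = 1" "norm b = 1"
  shows "(norm ((1 - s) *\<^sub>R a + s *\<^sub>R b))\<^sup>2 = 1 - s * (1 - s) * (norm (b - a))\<^sup>2"
proof -
  have "inner a a = 1" "inner b b = 1"
    using assms by (simp_all add: dot_square_norm)
  thus ?thesis
    unfolding power2_norm_eq_inner
    by (simp add: inner_simps inner_commute[of b a] algebra_simps)
qed

lemma side_eq_0_disk:
  assumes "a \<in> circle" "b \<in> circle" "a \<noteq> b" "side a b z = 0" "norm z \<le> 1"
  shows "z \<in> closed_segment a b"
proof -
  obtain s where s: "z = (1 - s) *\<^sub>R a + s *\<^sub>R b"
    using assms side_eq_0_segment by blast
  have "(norm z)\<^sup>2 = 1 - s * (1 - s) * (norm (b - a))\<^sup>2"
    using assms(1,2) unfolding s by (intro norm_chord_point) auto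
  moreover have "(norm z)\<^sup>2 \<le> 1"
    using assms(5) by (simp add: power_le_one)
  ultimately have "0 \<le> s * (1 - s) * (norm (b - a))\<^sup>2"
    by linarith
  hence "0 \<le> s * (1 - s)"
    using assms(3) by (simp add: zero_le_mult_iff)
  hence "0 \<le> s \<and> s \<le> 1"
    by (auto simp: zero_le_mult_iff)
  thus ?thesis
    unfolding closed_segment_def using s by blast
qed

lemma side_eq_0_circle:
  assumes "a \<in> circle" "b \<in> circle" "a \<noteq> b" "side a b z = 0" "z \<in> circle"
  shows "z = a \<or> z = b"
proof -
  obtain s where s: "z = (1 - s) *\<^sub>R a + s *\<^sub>R b"
    using assms side_eq_0_segment by blast
  have "(norm z)\<^sup>2 = 1 - s * (1 - s) * (norm (b - a))\<^sup>2"
    using assms(1,2) unfolding s by (intro norm_chord_point) auto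
  hence "s = 0 \<or> s = 1"
    using assms by auto
  thus ?thesis using s by auto
qed

lemma closed_segment_side:
  assumes "z \<in> closed_segment a b"
  shows "side a b z = 0"
proof -
  obtain u where "z = (1 - u) *\<^sub>R a + u *\<^sub>R b"
    using assms unfolding closed_segment_def by blast
  thus ?thesis by (simp add: side_convex_comb)
qed

text \<open>An average with positive weights of two nonnegative numbers is nonpositive only if both
  vanish. So a chord that touches a leaf at an inner point without crossing it lies along the
  leaf.\<close>

lemma segment_side_le_0:
  assumes "z \<in> closed_segment x y" "side a b z \<le> 0" "side a b x \<ge> 0" "side a b y \<ge> 0" "z \<noteq> x" "z \<noteq> y"
  shows "side a b x = 0" "side a b y = 0"
proof -
  obtain u where u: "z = (1 - u) *\<^sub>R x + u *\<^sub>R y" "0 \<le> u" "u \<le> 1"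
    using assms(1) unfolding closed_segment_def by blast
  have u01: "0 < u" "u < 1"
    using assms(5,6) u by (metis diff_zero less_eq_real_def add_0_right scaleR_one scaleR_zero_left,
      metis add_0 diff_self less_eq_real_def scaleR_one scaleR_zero_left u(1) u(3) assms(6))
  have *: "(1 - u) * side a b x + u * side a b y \<le> 0"
    using assms(2) by (simp add: u side_convex_comb)
  have nn: "0 \<le> (1 - u) * side a b x" "0 \<le> u * side a b y"
    using assms(3,4) u01 by auto
  have "(1 - u) * side a b x = 0" "u * side a b y = 0"
    using * nn by linarith+
  thus "side a b x = 0" "side a b y = 0"
    using u01 by auto
qed

lemma chord_cong:
  assumes "a \<in> circle" "b \<in> circle" "a \<noteq> b" "x \<in> circle" "y \<in> circle" "x \<noteq> y"
    "side a b x = 0" "side a b y = 0"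
  shows "{x, y} = {a, b}" "closed_segment x y = closed_segment a b"
proof -
  have "(x = a \<or> x = b) \<and> (y = a \<or> y = b)"
    using side_eq_0_circle assms by metis
  thus "{x, y} = {a, b}" using assms by auto
  thus "closed_segment x y = closed_segment a b"
    by (metis doubleton_eq_iff closed_segment_commute)
qed

lemma segment_circle_ends:
  assumes "a \<in> circle" "b \<in> circle" "x \<in> circle" "x \<in> closed_segment a b"
  shows "x = a \<or> x = b"
proof (cases "a = b")
  case False
  thus ?thesis using side_eq_0_circle closed_segment_side assms by metis
qed (use assms in auto)

lemma basis_chord:
  assumes "a \<in> circle" "b \<in> circle"
  shows "basis (closed_segment a b) = {a, b}"
proof
  show "basis (closed_segment a b) \<subseteq> {a, b}"
    using segment_circle_ends[OF assms] unfolding basis_def by blast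
  show "{a, b} \<subseteq> basis (closed_segment a b)"
    using assms unfolding basis_def by simp
qed

lemma chord_subset_disk:
  assumes "a \<in> circle" "b \<in> circle"
  shows "closed_segment a b \<subseteq> cball 0 1"
  using assms by (intro closed_segment_subset) auto

lemma chord_interior_ball:
  assumes "a \<in> circle" "b \<in> circle" "z \<in> closed_segment a b" "z \<noteq> a" "z \<noteq> b"
  shows "z \<in> ball 0 1"
  using segment_circle_ends[of a b z] chord_subset_disk[of a b] assms
  by (auto simp: less_le)

lemma one_side_frontier:
  assumes "a \<noteq> b" "a \<in> S" "b \<in> S" "convex S" "\<And>z. z \<in> S \<Longrightarrow> side a b z \<ge> 0"
  shows "closed_segment a b \<subseteq> frontier S"
proof
  fix x assume x: "x \<in> closed_segment a b"
  hence xS: "x \<in> S"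
    using assms closed_segment_subset by blast
  have "x \<notin> interior S"
  proof
    assume "x \<in> interior S"
    then obtain e where e: "e > 0" "ball x e \<subseteq> S"
      by (auto simp: mem_interior)
    define n where "n = \<i> * (b - a)"
    have n: "norm n > 0" using assms(1) by (simp add: n_def norm_mult)
    \<comment> \<open>\<open>side a b\<close> is affine with gradient \<open>n\<close>, so a move of
      length \<open>e / 2\<close> against \<open>n\<close> makes it negative without leaving the
      ball.\<close>
    define y where "y = x - (e / (2 * norm n)) *\<^sub>R n"
    have "y \<in> ball x e"
      using e n by (simp add: y_def dist_norm)
    hence "side a b y \<ge> 0" using e assms(5) by blast
    moreover have "side a b y = side a b x - (e / (2 * norm n)) * inner n n"
      by (simp add: side_inner y_def n_def inner_simps)
    moreover have "(e / (2 * norm n)) * inner n n > 0"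
      using e n by auto
    ultimately show False
      using closed_segment_side[OF x] by simp
  qed
  thus "x \<in> frontier S"
    using xS closure_subset by (auto simp: frontier_def)
qed

text \<open>A supporting line at the midpoint contains both ends, since the midpoint is their
  average; so it is the line through \<open>a\<close> and \<open>b\<close>. Which side carries
  \<open>S\<close> depends on the sign of the factor between the two normals, hence the
  disjunction.\<close>

lemma frontier_one_side:
  assumes "convex S" "a \<in> S" "b \<in> S" "a \<noteq> b" "closed_segment a b \<subseteq> frontier S"
  shows "(\<forall>z\<in>S. side a b z \<ge> 0) \<or> (\<forall>z\<in>S. side a b z \<le> 0)"
proof -
  define m where "m = midpoint a b"
  have "m \<in> frontier S"
    using assms(5) by (auto simp: m_def)
  then have "m \<in> closure S" "m \<notin> interior S" by (auto simp: frontier_def)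
  obtain n where n: "n \<noteq> 0" "\<And>y. y \<in> S \<Longrightarrow> n \<bullet> m \<le> n \<bullet> y"
  \<comment> \<open>A flat \<open>S\<close>, such as the hull of a two-point class, can have the
    midpoint in its relative interior; then the line containing \<open>S\<close> is used, and the
    inequality is an equality.\<close>
  proof (cases "interior S = {}")
    case True
    then obtain n c where nc: "n \<noteq> 0" "S \<subseteq> {x. n \<bullet> x = c}"
      using empty_interior_subset_hyperplane assms(1) by metis
    have "m \<in> S"
      using assms(1-3) unfolding m_def by (meson convex_contains_segment midpoint_in_closed_segment subsetD)
    hence "n \<bullet> m \<le> n \<bullet> y" if "y \<in> S" for y
      using nc that by (metis (mono_tags) mem_Collect_eq order_refl subsetD)
    thus ?thesis using that nc(1) by blast
  next
    case False
    hence "m \<notin> rel_interior S"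
      using \<open>m \<notin> interior S\<close> rel_interior_nonempty_interior by blast
    then obtain n where "n \<noteq> 0" "\<And>y. y \<in> closure S \<Longrightarrow> n \<bullet> m \<le> n \<bullet> y"
      using supporting_hyperplane_relative_frontier[OF assms(1) \<open>m \<in> closure S\<close>] by metis
    thus ?thesis using that closure_subset by blast
  qed
  have na: "n \<bullet> m \<le> n \<bullet> a" "n \<bullet> m \<le> n \<bullet> b"
    using n(2) assms(2,3) by blast+
  have "n \<bullet> m = (n \<bullet> a + n \<bullet> b) / 2"
    by (simp add: m_def midpoint_def inner_simps)
  hence eq: "n \<bullet> a = n \<bullet> m" "n \<bullet> b = n \<bullet> m"
    using na by (auto simp: field_simps)
  \<comment> \<open>Division by \<open>\<i> * (b - a)\<close> compares \<open>n\<close> with the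
    normal of the line; orthogonality of \<open>n\<close> to \<open>b - a\<close> makes
    \<open>p\<close> real.\<close>
  define p where "p = n / (\<i> * (b - a))"
  have np: "n = p * (\<i> * (b - a))"
    using assms(4) by (simp add: p_def)
  have "n \<bullet> (b - a) = 0" using eq by (simp add: inner_simps)
  moreover have "n \<bullet> (b - a) = - Im p * ((Re (b - a))\<^sup>2 + (Im (b - a))\<^sup>2)"
    unfolding np inner_complex_def by (simp add: algebra_simps power2_eq_square)
  moreover have "(Re (b - a))\<^sup>2 + (Im (b - a))\<^sup>2 > 0"
    using assms(4) by (metis cmod_power2 eq_iff_diff_eq_0 norm_eq_zero zero_less_power2)
  ultimately have "Im p = 0" by auto
  hence n': "n = Re p *\<^sub>R (\<i> * (b - a))"
    using np by (simp add: complex_eq_iff)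
  have "n \<bullet> z - n \<bullet> a = Re p * side a b z" for z
    unfolding side_inner by (subst (1 2) n') (simp add: right_diff_distrib)
  hence "0 \<le> Re p * side a b z" if "z \<in> S" for z
    using n(2)[of z] that eq by (metis diff_ge_0_iff_ge)
  moreover have "Re p \<noteq> 0"
    using n(1) \<open>Im p = 0\<close> np by (auto simp: complex_eq_iff)
  ultimately show ?thesis
    by (smt (verit) mult_neg_pos mult_pos_neg zero_le_mult_iff)
qed

section \<open>The circle by angle, and the sign of \<open>side\<close> as cyclic order\<close>

lemma turn_circle [simp]: "turn t \<in> circle"
  by (simp add: turn_def)

lemma turn_eq_iff: "turn x = turn y \<longleftrightarrow> (\<exists>n::int. x = y + of_int n)"
proof -
  have "turn x = turn y \<longleftrightarrow> sin (2 * pi * x) = sin (2 * pi * y) \<and> cos (2 * pi * x) = cos (2 * pi * y)"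
    unfolding turn_def by (auto simp: complex_eq_iff)
  also have "\<dots> \<longleftrightarrow> (\<exists>n::int. 2 * pi * x = 2 * pi * (y + of_int n))"
    unfolding sin_cos_eq_iff by (simp add: distrib_left)
  also have "\<dots> \<longleftrightarrow> (\<exists>n::int. x = y + of_int n)"
    by simp
  finally show ?thesis .
qed

lemma turn_add_int [simp]: "turn (x + of_int n) = turn x"
  using turn_eq_iff by blast

lemma turn_surj:
  assumes "z \<in> circle"
  obtains t where "s \<le> t" "t < s + 1" "z = turn t"
proof -
  obtain u where u: "z = turn u"
  proof -
    have "z \<noteq> 0" "sgn z = z" using assms by (auto simp: sgn_div_norm)
    hence "z = cis (Arg z)" using cis_Arg by metis
    hence "z = turn (Arg z / (2 * pi))" by (simp add: turn_def)
    thus ?thesis using that by blast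
  qed
  define n where "n = \<lfloor>u - s\<rfloor>"
  have "z = turn (u + of_int (- n))" using u turn_add_int by metis
  moreover have "s \<le> u + of_int (- n)" "u + of_int (- n) < s + 1"
    unfolding n_def by linarith+
  ultimately show thesis using that by blast
qed

lemma turn_inj:
  assumes "turn x = turn y" "\<bar>x - y\<bar> < 1"
  shows "x = y"
proof -
  obtain n :: int where n: "x = y + of_int n" using assms turn_eq_iff by blast
  hence "\<bar>n\<bar> < 1" using assms(2) by linarith
  thus ?thesis using n by simp
qed

lemma sigma_turn: "sigma d (turn t) = turn (real d * t)"
  by (simp add: sigma_def turn_def Complex.DeMoivre mult.left_commute)

text \<open>\<open>side\<close> is twice the signed area of a triangle. For one inscribed in the
  unit circle this is half the product of the side lengths, and each side is twice the sine of half
  its central angle.\<close>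

lemma side_turn:
  "side (turn x) (turn y) (turn z) = 4 * sin (pi * (y - x)) * sin (pi * (z - x)) * sin (pi * (z - y))"
proof -
  define p q r where "p = pi * (y - x)" and "q = pi * (z - x)" and "r = pi * (z - y)"
  have r: "r = q - p" by (simp add: p_def q_def r_def algebra_simps)
  have ct: "cnj (turn u) * turn v = turn (v - u)" for u v
    by (simp add: turn_def cis_cnj cis_mult algebra_simps)
  have "cnj (turn y - turn x) * (turn z - turn x)
      = turn (z - y) - turn (x - y) - turn (z - x) + turn 0"
    using ct[of y z] ct[of y x] ct[of x z] ct[of x x]
    by (simp add: algebra_simps)
  hence "side (turn x) (turn y) (turn z) = Im (turn (z - y)) - Im (turn (x - y)) - Im (turn (z - x))"
    by (simp add: side_def turn_def)
  also have "\<dots> = sin (2 * r) - sin (- (2 * p)) - sin (2 * q)"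
    by (simp add: turn_def p_def q_def r_def algebra_simps)
  also have "\<dots> = 4 * sin p * sin q * sin r"
  proof -
    have c: "sin p * sin p = 1 - cos p * cos p" "sin q * sin q = 1 - cos q * cos q"
      using sin_cos_squared_add[of p] sin_cos_squared_add[of q]
      by (simp_all add: power2_eq_square algebra_simps)
    have "sin (2 * r) - sin (- (2 * p)) - sin (2 * q) = 
       2 * (sin q * cos p - cos q * sin p) * (cos q * cos p + sin q * sin p) + 2 * sin p * cos p - 2 * sin q * cos q"
      unfolding sin_minus sin_double by (simp add: r sin_diff cos_diff)
    also have "\<dots> = 2 * sin q * cos q * (cos p * cos p) + 2 * (sin q * sin q) * sin p * cos p
       - 2 * (cos q * cos q) * sin p * cos p - 2 * cos q * (sin p * sin p) * sin q
       + 2 * sin p * cos p - 2 * sin q * cos q"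
      by (simp add: algebra_simps)
    also have "\<dots> = 4 * (sin q * sin q) * sin p * cos p - 4 * (sin p * sin p) * sin q * cos q"
      unfolding c by (simp add: algebra_simps)
    also have "\<dots> = 4 * sin p * sin q * sin r"
      by (simp add: r sin_diff algebra_simps)
    finally show ?thesis .
  qed
  finally show ?thesis by (simp add: p_def q_def r_def)
qed

lemma sin_pi_pos: "0 < u \<Longrightarrow> u < 1 \<Longrightarrow> 0 < sin (pi * u)"
  by (intro sin_gt_zero) auto

lemma sin_pi_neg: "-1 < u \<Longrightarrow> u < 0 \<Longrightarrow> sin (pi * u) < 0"
  using sin_pi_pos[of "-u"] by simp

text \<open>The bridge from half-planes to order: with \<open>y\<close> and \<open>z\<close> in the
  turn after \<open>x\<close>, two of the three sines are positive and the third carries the sign of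
  \<open>z - y\<close>.\<close>

lemma side_turn_sign:
  assumes "x < y" "y < x + 1" "x < z" "z < x + 1"
  shows "side (turn x) (turn y) (turn z) < 0 \<longleftrightarrow> z < y"
    and "side (turn x) (turn y) (turn z) > 0 \<longleftrightarrow> y < z"
proof -
  have p: "sin (pi * (y - x)) > 0" "sin (pi * (z - x)) > 0"
    using assms by (auto intro!: sin_pi_pos)
  have "sin (pi * (z - y)) > 0" if "y < z" using assms that by (auto intro!: sin_pi_pos)
  moreover have "sin (pi * (z - y)) < 0" if "z < y" using assms that by (auto intro!: sin_pi_neg)
  ultimately have s: "sgn (sin (pi * (z - y))) = sgn (z - y)"
    by (cases z y rule: linorder_cases) auto
  have "sgn (side (turn x) (turn y) (turn z)) = sgn (z - y)"
    unfolding side_turn sgn_mult s using p by simp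
  thus "side (turn x) (turn y) (turn z) < 0 \<longleftrightarrow> z < y" "side (turn x) (turn y) (turn z) > 0 \<longleftrightarrow> y < z"
    by (metis diff_less_0_iff_less sgn_less, metis diff_gt_0_iff_gt sgn_greater)
qed

section \<open>Gaps of geolaminations\<close>

lemma geolamination_leafE:
  assumes "geolamination L" "l \<in> L"
  obtains a b where "a \<in> circle" "b \<in> circle" "l = closed_segment a b"
proof -
  have "l \<in> chords" using assms by (auto simp: geolamination_def)
  thus thesis using that by (auto simp: chords_def)
qed

lemma geolamination_circle: "geolamination L \<Longrightarrow> circle \<subseteq> solid L"
  by (auto simp: geolamination_def solid_def)

lemma solid_subset_disk:
  assumes "geolamination L"
  shows "solid L \<subseteq> cball 0 1"
proof
  fix x assume "x \<in> solid L"
  then obtain l where l: "l \<in> L" "x \<in> l" unfolding solid_def by blast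
  obtain a b where ab: "a \<in> circle" "b \<in> circle" "l = closed_segment a b"
    using geolamination_leafE[OF assms l(1)] .
  show "x \<in> cball 0 1" using chord_subset_disk[OF ab(1,2)] l(2) ab(3) by blast
qed

lemma compact_solid: "geolamination L \<Longrightarrow> compact (solid L)"
proof -
  assume L: "geolamination L"
  have "bounded (solid L)" by (rule bounded_subset[OF bounded_cball solid_subset_disk[OF L]])
  moreover have "closed (solid L)" using L by (simp add: geolamination_def)
  ultimately show ?thesis by (simp add: compact_eq_bounded_closed)
qed

lemma solid_nonempty: "geolamination L \<Longrightarrow> solid L \<noteq> {}"
  using geolamination_circle[of L] turn_circle[of 0] by blast

lemma solid_ball_leafE:
  assumes "geolamination L" "x \<in> solid L" "x \<in> ball 0 1"
  obtains a b where "a \<in> circle" "b \<in> circle" "a \<noteq> b" "closed_segment a b \<in> L" "x \<in> closed_segment a b"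
proof -
  obtain l where l: "l \<in> L" "x \<in> l" using assms unfolding solid_def by blast
  obtain a b where ab: "a \<in> circle" "b \<in> circle" "l = closed_segment a b"
    using geolamination_leafE[OF assms(1) l(1)] .
  have "a \<noteq> b" using ab l assms(3) by auto
  thus thesis using that ab l by blast
qed

lemma leaves_meet_in_ball:
  assumes "geolamination L" "l \<in> L" "m \<in> L" "x \<in> l" "x \<in> m" "x \<in> ball 0 1"
  shows "l = m"
proof (rule ccontr)
  assume "l \<noteq> m"
  then obtain y where "y \<in> circle" "l \<inter> m = {y}"
    using assms unfolding geolamination_def by blast
  hence "x = y" using assms by blast
  thus False using \<open>y \<in> circle\<close> assms(6) by simp
qed

text \<open>A zero of \<open>side\<close> in the closed disk lies on the chord, so the sign cannot
  change on a connected set that misses the chord.\<close>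

lemma connected_side:
  assumes "connected C" "C \<subseteq> cball 0 1" "a \<in> circle" "b \<in> circle" "a \<noteq> b" "C \<inter> closed_segment a b = {}"
  shows "(\<forall>z\<in>C. side a b z > 0) \<or> (\<forall>z\<in>C. side a b z < 0)"
proof (rule ccontr)
  assume *: "\<not> ?thesis"
  have nz: "side a b z \<noteq> 0" if "z \<in> C" for z
  proof
    assume "side a b z = 0"
    moreover have "norm z \<le> 1" using subsetD[OF assms(2) that] by simp
    ultimately have "z \<in> closed_segment a b" using side_eq_0_disk[OF assms(3,4,5)] by blast
    thus False using that assms(6) by blast
  qed
  obtain x y where "x \<in> C" "y \<in> C" "side a b x < 0" "side a b y > 0"
    using * nz by (metis linorder_neqE_linordered_idom)
  moreover have "connected (side a b ` C)"
    by (intro connected_continuous_image continuous_intros assms)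
  ultimately have "0 \<in> side a b ` C"
    by (meson connected_contains_Icc atLeastAtMost_iff image_eqI less_imp_le subsetD)
  thus False using nz by auto
qed

context
  fixes L C
  assumes L: "geolamination L" and C: "C \<in> components (ball 0 1 - solid L)"
begin

lemma component_open: "open C"
  using L C unfolding geolamination_def by (meson open_components open_Diff open_ball)

lemma component_subset: "C \<subseteq> ball 0 1" "C \<inter> solid L = {}" "C \<noteq> {}"
  using in_components_subset[OF C] in_components_nonempty[OF C] by auto

lemma component_leaf_side:
  assumes "a \<in> circle" "b \<in> circle" "a \<noteq> b" "closed_segment a b \<in> L"
  shows "(\<forall>z\<in>C. side a b z > 0) \<or> (\<forall>z\<in>C. side a b z < 0)"
proof (intro connected_side assms(1-3))
  show "connected C" using C by (rule in_components_connected)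
  show "C \<subseteq> cball 0 1" using component_subset(1) by auto
  show "C \<inter> closed_segment a b = {}" using component_subset(2) assms(4) unfolding solid_def by blast
qed

text \<open>\<open>C\<close> lies strictly on one side of every leaf, and open half-planes are
  convex; so a segment between points of \<open>C\<close> meets no leaf and stays in the same
  component.\<close>

lemma component_convex: "convex C"
  unfolding convex_contains_segment
proof (intro ballI)
  fix x y assume xy: "x \<in> C" "y \<in> C"
  have ball: "closed_segment x y \<subseteq> ball 0 1"
    using xy component_subset(1) by (intro closed_segment_subset) auto
  have "closed_segment x y \<inter> solid L = {}"
  proof (rule ccontr)
    assume "closed_segment x y \<inter> solid L \<noteq> {}"
    then obtain z where z: "z \<in> closed_segment x y" "z \<in> solid L" by blast
    obtain a b where ab: "a \<in> circle" "b \<in> circle" "a \<noteq> b" "closed_segment a b \<in> L" "z \<in> closed_segment a b"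
      using solid_ball_leafE[OF L z(2) subsetD[OF ball z(1)]] .
    have "side a b z = 0" using ab closed_segment_side by blast
    moreover have "side a b z \<noteq> 0"
      using component_leaf_side[OF ab(1-4)]
    proof
      assume "\<forall>z\<in>C. side a b z > 0"
      hence "closed_segment x y \<subseteq> {z. side a b z > 0}"
        using xy by (intro closed_segment_subset convex_side) auto
      thus ?thesis using z by auto
    next
      assume "\<forall>z\<in>C. side a b z < 0"
      hence "closed_segment x y \<subseteq> {z. side a b z < 0}"
        using xy by (intro closed_segment_subset convex_side) auto
      thus ?thesis using z by auto
    qed
    ultimately show False by simp
  qed
  thus "closed_segment x y \<subseteq> C"
    using components_maximal[OF C, of "closed_segment x y"] ball xy by auto
qed

text \<open>Holds because an open convex set is the interior of its closure. It lets a gap, which is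
  only a closure, give back its component.\<close>

lemma component_interior_closure: "interior (closure C) = C"
  using component_convex component_open by (simp add: convex_interior_closure interior_open)

lemma component_frontier: "closure C - C \<subseteq> solid L"
proof
  fix x assume x: "x \<in> closure C - C"
  have "C \<subseteq> cball 0 1" using component_subset(1) by auto
  hence "closure C \<subseteq> cball 0 1" by (rule closure_minimal) simp
  show "x \<in> solid L"
  proof (rule ccontr)
    assume nx: "x \<notin> solid L"
    hence xb: "x \<in> ball 0 1 - solid L"
    proof -
      have "norm x \<le> 1" using subsetD[OF \<open>closure C \<subseteq> cball 0 1\<close>, of x] x by simp
      moreover have "norm x \<noteq> 1" using subsetD[OF geolamination_circle[OF L], of x] nx by auto
      ultimately show ?thesis using nx by simp
    qed
    then obtain D where D: "D \<in> components (ball 0 1 - solid L)" "x \<in> D"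
      by (metis UnionE Union_components)
    have "open D" using L D unfolding geolamination_def by (meson open_components open_Diff open_ball)
    hence "D \<inter> C \<noteq> {}"
      using D x by (metis DiffD1 open_Int_closure_eq_empty disjoint_iff)
    hence "D = C" using components_eq D C by metis
    thus False using D x by auto
  qed
qed

end

lemma gapE:
  assumes "G \<in> gaps L"
  obtains C where "C \<in> components (ball 0 1 - solid L)" "G = closure C"
  using assms unfolding gaps_def by blast

lemma gap_convex:
  assumes "geolamination L" "G \<in> gaps L"
  shows "convex G"
proof -
  obtain C where "C \<in> components (ball 0 1 - solid L)" "G = closure C"
    using gapE[OF assms(2)] .
  thus ?thesis using component_convex[OF assms(1)] by (simp add: convex_closure)
qed

lemma gap_subset_disk:
  assumes "geolamination L" "G \<in> gaps L"
  shows "G \<subseteq> cball 0 1"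
proof -
  obtain C where C: "C \<in> components (ball 0 1 - solid L)" "G = closure C"
    using gapE[OF assms(2)] .
  have "C \<subseteq> cball 0 1" using component_subset(1)[OF assms(1) C(1)] by auto
  thus ?thesis unfolding C(2) by (rule closure_minimal) simp
qed

lemma gap_compact:
  assumes "geolamination L" "G \<in> gaps L"
  shows "compact G"
proof -
  obtain C where "G = closure C"
    using gapE[OF assms(2)] .
  hence "closed G" by simp
  moreover have "bounded G" by (rule bounded_subset[OF bounded_cball gap_subset_disk[OF assms]])
  ultimately show ?thesis by (simp add: compact_eq_bounded_closed)
qed

lemma gap_interior:
  assumes "geolamination L" "G \<in> gaps L"
  shows "interior G \<noteq> {}" "interior G \<subseteq> ball 0 1" "interior G \<inter> solid L = {}"
    "closure (interior G) = G" "interior G \<in> components (ball 0 1 - solid L)"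
proof -
  obtain C where C: "C \<in> components (ball 0 1 - solid L)" "G = closure C"
    using gapE[OF assms(2)] .
  have "interior G = C" using C component_interior_closure[OF assms(1) C(1)] by simp
  thus "interior G \<noteq> {}" "interior G \<subseteq> ball 0 1" "interior G \<inter> solid L = {}"
    "closure (interior G) = G" "interior G \<in> components (ball 0 1 - solid L)"
    using component_subset[OF assms(1) C(1)] C by simp_all
qed

lemma gap_frontier_solid:
  assumes "geolamination L" "G \<in> gaps L"
  shows "frontier G \<subseteq> solid L"
  using component_frontier[OF assms(1) gap_interior(5)[OF assms]] gap_interior(4)[OF assms]
    gap_compact[OF assms]
  by (simp add: frontier_def compact_imp_closed)

lemma gap_leaf_side:
  assumes "geolamination L" "G \<in> gaps L" "a \<in> circle" "b \<in> circle" "a \<noteq> b" "closed_segment a b \<in> L"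
  shows "(\<forall>z\<in>interior G. side a b z > 0) \<and> (\<forall>z\<in>G. side a b z \<ge> 0)
       \<or> (\<forall>z\<in>interior G. side a b z < 0) \<and> (\<forall>z\<in>G. side a b z \<le> 0)"
  using component_leaf_side[OF assms(1) gap_interior(5)[OF assms(1,2)] assms(3-6)]
proof
  assume *: "\<forall>z\<in>interior G. side a b z > 0"
  hence "closure (interior G) \<subseteq> {z. side a b z \<ge> 0}"
    by (intro closure_minimal closed_side) auto
  thus ?thesis using * gap_interior(4)[OF assms(1,2)] by auto
next
  assume *: "\<forall>z\<in>interior G. side a b z < 0"
  hence "closure (interior G) \<subseteq> {z. side a b z \<le> 0}"
    by (intro closure_minimal closed_side) auto
  thus ?thesis using * gap_interior(4)[OF assms(1,2)] by auto
qed

lemma edgesE: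
  assumes "l \<in> edges K"
  obtains a b where "a \<in> circle" "b \<in> circle" "a \<noteq> b" "closed_segment a b \<subseteq> frontier K" "l = closed_segment a b"
  using assms unfolding edges_def by blast

lemma gap_frontier_subset: "geolamination L \<Longrightarrow> G \<in> gaps L \<Longrightarrow> frontier G \<subseteq> G"
  by (intro frontier_subset_closed compact_imp_closed gap_compact)

lemma midpoint_ball:
  assumes "a \<in> circle" "b \<in> circle" "a \<noteq> b"
  shows "midpoint a b \<in> ball 0 1"
  using assms by (intro chord_interior_ball[of a b]) auto

text \<open>An edge is defined by lying in the frontier, so being a leaf has to be proved: the
  midpoint lies on some leaf, the gap lies on one side of that leaf, and so the edge runs along
  it.\<close>

lemma gap_edge_leaf:
  assumes "geolamination L" "G \<in> gaps L" "l \<in> edges G"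
  shows "l \<in> L"
proof -
  obtain a b where ab: "a \<in> circle" "b \<in> circle" "a \<noteq> b" "closed_segment a b \<subseteq> frontier G" "l = closed_segment a b"
    using edgesE[OF assms(3)] .
  define m where "m = midpoint a b"
  have m: "m \<in> closed_segment a b" "m \<noteq> a" "m \<noteq> b" by (simp_all add: m_def ab)
  have "m \<in> solid L" using m(1) ab(4) gap_frontier_solid[OF assms(1,2)] by blast
  have "m \<in> ball 0 1" unfolding m_def by (rule midpoint_ball[OF ab(1-3)])
  obtain c e where ce: "c \<in> circle" "e \<in> circle" "c \<noteq> e" "closed_segment c e \<in> L" "m \<in> closed_segment c e"
    using solid_ball_leafE[OF assms(1) \<open>m \<in> solid L\<close> \<open>m \<in> ball 0 1\<close>] .
  have aG: "a \<in> G" "b \<in> G" using ab gap_frontier_subset[OF assms(1,2)] by auto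
  have m0: "side c e m = 0" "side e c m = 0" using ce closed_segment_side by (auto simp: closed_segment_commute)
  consider "\<forall>z\<in>G. side c e z \<ge> 0" | "\<forall>z\<in>G. side e c z \<ge> 0"
    using gap_leaf_side[OF assms(1,2) ce(1-4)] by (auto simp: side_swap[of e c])
  hence "side c e a = 0 \<and> side c e b = 0"
  proof cases
    case 1
    thus ?thesis using segment_side_le_0[OF m(1), of c e] m(2,3) m0 aG by auto
  next
    case 2
    have "side e c a = 0 \<and> side e c b = 0"
      using 2 segment_side_le_0[OF m(1), of e c] m(2,3) m0 aG by auto
    thus ?thesis by (simp add: side_swap[of e c])
  qed
  hence "closed_segment a b = closed_segment c e"
    using chord_cong(2)[OF ce(1-3) ab(1-3)] by blast
  thus ?thesis using ce(4) ab(5) by metis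
qed

lemma open_segment_cases:
  assumes "z \<in> closed_segment x y" "z \<noteq> x" "z \<noteq> y"
  shows "z \<in> open_segment x y"
  using assms by (simp add: open_segment_def)

text \<open>The point is that the whole leaf through \<open>q\<close> belongs to the gap. A leaf
  hiding some \<open>x\<close> on it from an interior point \<open>z\<close> of the gap would
  separate \<open>x\<close> from \<open>q\<close>, and would thus cross the leaf through both inside
  the disk.\<close>

lemma gap_frontier_leaf:
  assumes "geolamination L" "G \<in> gaps L" "q \<in> frontier G" "q \<in> ball 0 1"
  obtains a b where "a \<in> circle" "b \<in> circle" "a \<noteq> b" "closed_segment a b \<in> L" "closed_segment a b \<in> edges G" "q \<in> closed_segment a b"
proof -
  have qG: "q \<in> G" using assms gap_frontier_subset by blast
  obtain a b where ab: "a \<in> circle" "b \<in> circle" "a \<noteq> b" "closed_segment a b \<in> L" "q \<in> closed_segment a b"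
    using solid_ball_leafE[OF assms(1) subsetD[OF gap_frontier_solid[OF assms(1,2)] assms(3)] assms(4)] .
  obtain z where z: "z \<in> interior G" using gap_interior[OF assms(1,2)] by blast
  have zG: "z \<in> G" using z interior_subset by blast
  have inG: "x \<in> G" if x: "x \<in> closed_segment a b" for x
  proof -
    have xd: "x \<in> cball 0 1" using chord_subset_disk[OF ab(1,2)] x by blast
    have "z \<in> ball 0 1" using z gap_interior(2)[OF assms(1,2)] by blast
    hence os_ball: "open_segment z x \<subseteq> ball 0 1"
      using in_interior_closure_convex_segment[of "cball 0 1" z x] xd by auto
    have "open_segment z x \<inter> solid L = {}"
    proof (rule ccontr)
      assume "open_segment z x \<inter> solid L \<noteq> {}"
      then obtain y where y: "y \<in> open_segment z x" "y \<in> solid L" by blast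
      have yb: "y \<in> ball 0 1" using os_ball y(1) by blast
      obtain c e where ce: "c \<in> circle" "e \<in> circle" "c \<noteq> e" "closed_segment c e \<in> L" "y \<in> closed_segment c e"
        using solid_ball_leafE[OF assms(1) y(2) yb] .
      \<comment> \<open>The leaf is oriented with the gap on its nonnegative side. As
        \<open>y\<close> is on it and \<open>z\<close> strictly inside, \<open>x\<close> is strictly
        outside, while \<open>q\<close> is not; so \<open>c e\<close> meets \<open>a b\<close> at a
        point \<open>p\<close> between \<open>q\<close> and \<open>x\<close>.\<close>
      have *: False if ce: "c \<in> circle" "e \<in> circle" "c \<noteq> e" "closed_segment c e \<in> L" "y \<in> closed_segment c e"
        and sG: "\<forall>z\<in>interior G. side c e z > 0" "\<forall>z\<in>G. side c e z \<ge> 0" for c e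
      proof -
        obtain t where t: "y = (1 - t) *\<^sub>R z + t *\<^sub>R x" "0 < t" "t < 1"
          using y(1) by (auto simp: in_segment)
        have "side c e y = 0" using ce closed_segment_side by blast
        hence "t * side c e x = - ((1 - t) * side c e z)"
          using t by (simp add: side_convex_comb)
        moreover have "(1 - t) * side c e z > 0" using t sG z by simp
        ultimately have "t * side c e x < 0" by linarith
        hence sx: "side c e x < 0" using t by (simp add: mult_less_0_iff)
        have sq: "side c e q \<ge> 0" using sG qG by blast
        have "connected (side c e ` closed_segment q x)"
          by (intro connected_continuous_image continuous_intros connected_segment)
        hence "0 \<in> side c e ` closed_segment q x"
          using sx sq by (meson connected_contains_Icc atLeastAtMost_iff image_eqI less_imp_le subsetD ends_in_segment)
        then obtain p where p: "p \<in> closed_segment q x" "side c e p = 0" by auto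
        have qx: "closed_segment q x \<subseteq> closed_segment a b"
          using x ab(5) by (simp add: subset_closed_segment)
        have pab: "p \<in> closed_segment a b" using p qx by blast
        hence "norm p \<le> 1" using chord_subset_disk[OF ab(1,2)] by auto
        hence pce: "p \<in> closed_segment c e" using side_eq_0_disk[OF ce(1-3) p(2)] by blast
        have "p \<notin> ball 0 1"
        proof
          assume "p \<in> ball 0 1"
          hence eq: "closed_segment a b = closed_segment c e"
            using leaves_meet_in_ball[OF assms(1) ab(4) ce(4) pab pce] by blast
          show False using sx closed_segment_side[OF x[unfolded eq]] by simp
        qed
        moreover have "p \<in> ball 0 1"
        proof -
          have "p \<noteq> x" using p sx by auto
          moreover have "open_segment q x \<subseteq> ball 0 1"
            using in_interior_closure_convex_segment[of "cball 0 1" q x] assms(4) xd by auto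
          ultimately show ?thesis using p(1) assms(4) by (cases "p = q") (auto simp: open_segment_def)
        qed
        ultimately show False by blast
      qed
      show False
        using gap_leaf_side[OF assms(1,2) ce(1-4)]
      proof
        assume "(\<forall>z\<in>interior G. side c e z > 0) \<and> (\<forall>z\<in>G. side c e z \<ge> 0)"
        thus False using *[OF ce] by blast
      next
        assume "(\<forall>z\<in>interior G. side c e z < 0) \<and> (\<forall>z\<in>G. side c e z \<le> 0)"
        hence sG: "\<forall>z\<in>interior G. side e c z > 0" "\<forall>z\<in>G. side e c z \<ge> 0"
          by (simp_all add: side_swap[of e c])
        have "closed_segment e c \<in> L" "y \<in> closed_segment e c"
          using ce(4,5) by (simp_all add: closed_segment_commute[of e c])
        thus False using *[OF ce(2,1) ce(3)[symmetric] _ _ sG] by blast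
      qed
    qed
    hence os: "insert z (open_segment z x) \<subseteq> ball 0 1 - solid L"
      using z gap_interior(2,3)[OF assms(1,2)] os_ball by blast
    show "x \<in> G"
    proof (cases "x = z")
      case False
      have cl: "closure (open_segment z x) = closed_segment z x"
        using False by (simp add: closure_open_segment)
      have "connected (insert z (open_segment z x))"
      proof (rule connected_intermediate_closure)
        show "connected (open_segment z x)" by (intro convex_connected convex_open_segment)
        show "insert z (open_segment z x) \<subseteq> closure (open_segment z x)"
          unfolding cl using segment_open_subset_closed by auto
      qed auto
      hence "insert z (open_segment z x) \<subseteq> interior G"
        using components_maximal[OF gap_interior(5)[OF assms(1,2)] _ os] z by blast
      hence "closure (open_segment z x) \<subseteq> closure (interior G)"
        by (intro closure_mono) auto
      thus ?thesis unfolding cl gap_interior(4)[OF assms(1,2)] by auto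
    qed (use zG in simp)
  qed
  have "closed_segment a b \<subseteq> frontier G"
    using gap_leaf_side[OF assms(1,2) ab(1-4)]
  proof
    assume "(\<forall>z\<in>interior G. side a b z > 0) \<and> (\<forall>z\<in>G. side a b z \<ge> 0)"
    thus ?thesis using ab(3) inG gap_convex[OF assms(1,2)] by (intro one_side_frontier) auto
  next
    assume "(\<forall>z\<in>interior G. side a b z < 0) \<and> (\<forall>z\<in>G. side a b z \<le> 0)"
    hence "closed_segment b a \<subseteq> frontier G"
      using ab(3) inG gap_convex[OF assms(1,2)] by (intro one_side_frontier) (auto simp: side_swap[of b a])
    thus ?thesis by (simp add: closed_segment_commute[of a b])
  qed
  hence "closed_segment a b \<in> edges G" using ab unfolding edges_def by blast
  thus thesis using that ab by blast
qed

text \<open>By Krein-Milman it is enough that extreme points lie on the circle: a frontier point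
  inside the disk is an inner point of an edge, hence not extreme.\<close>

lemma gap_hull_basis:
  assumes "geolamination L" "G \<in> gaps L"
  shows "G = convex hull (basis G)"
proof
  have "{x. x extreme_point_of G} \<subseteq> basis G"
  proof
    fix x assume "x \<in> {x. x extreme_point_of G}"
    hence x: "x extreme_point_of G" by simp
    hence xG: "x \<in> G" by (simp add: extreme_point_of_def)
    have "x \<in> circle"
    proof (rule ccontr)
      assume "x \<notin> circle"
      hence xb: "x \<in> ball 0 1" using xG gap_subset_disk[OF assms] by fastforce
      have "x \<notin> interior G" using x extreme_point_not_in_interior by blast
      hence "x \<in> frontier G" using xG closure_subset by (auto simp: frontier_def)
      then obtain a b where ab: "a \<in> circle" "b \<in> circle" "closed_segment a b \<in> edges G" "x \<in> closed_segment a b"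
        using gap_frontier_leaf[OF assms \<open>x \<in> frontier G\<close> xb] by blast
      then obtain a' b' where "closed_segment a' b' \<subseteq> frontier G" "closed_segment a b = closed_segment a' b'"
        unfolding edges_def by blast
      hence "closed_segment a b \<subseteq> G" using gap_frontier_subset[OF assms] by (metis subset_trans)
      moreover have "x \<in> open_segment a b"
        using ab xb by (auto simp: open_segment_def)
      moreover have "a \<in> closed_segment a b" "b \<in> closed_segment a b" by simp_all
      ultimately show False using x unfolding extreme_point_of_def by blast
    qed
    thus "x \<in> basis G" using xG by (simp add: basis_def)
  qed
  hence "convex hull {x. x extreme_point_of G} \<subseteq> convex hull (basis G)" by (rule hull_mono)
  thus "G \<subseteq> convex hull (basis G)"
    using Krein_Milman_Minkowski[OF gap_compact[OF assms] gap_convex[OF assms]] by simp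
  show "convex hull (basis G) \<subseteq> G"
    using gap_convex[OF assms] by (intro hull_minimal) (auto simp: basis_def)
qed

lemma gap_containing:
  assumes "connected K" "K \<noteq> {}" "K \<subseteq> ball 0 1 - solid L" "geolamination L"
  obtains G where "G \<in> gaps L" "K \<subseteq> interior G"
proof -
  obtain C where C: "C \<in> components (ball 0 1 - solid L)" "K \<subseteq> C"
    using exists_component_superset[of K "ball 0 1 - solid L"] assms by blast
  have "closure C \<in> gaps L" "interior (closure C) = C"
    using C component_interior_closure[OF assms(4) C(1)] by (auto simp: gaps_def)
  thus thesis using that C by metis
qed

text \<open>The disk is strictly convex, so a circle point of the hull is extreme in it, and extreme
  points of a hull belong to the generating set.\<close>

lemma basis_hull:
  assumes "K \<subseteq> circle"
  shows "basis (convex hull K) = K"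
proof
  show "K \<subseteq> basis (convex hull K)"
    using assms hull_subset[of K] by (auto simp: basis_def)
  show "basis (convex hull K) \<subseteq> K"
  proof
    fix x assume "x \<in> basis (convex hull K)"
    hence x: "x \<in> convex hull K" "x \<in> circle" by (auto simp: basis_def)
    have sub: "convex hull K \<subseteq> cball 0 1"
      using assms by (intro hull_minimal) auto
    have "x extreme_point_of (convex hull K)"
      unfolding extreme_point_of_def
    proof (intro conjI ballI x(1) notI)
      fix a b assume ab: "a \<in> convex hull K" "b \<in> convex hull K" "x \<in> open_segment a b"
      have "norm x < 1"
      proof -
        have "a \<noteq> b" using ab by auto
        have "norm a \<le> 1" "norm b \<le> 1" using sub ab by auto
        thus ?thesis using dist_decreases_open_segment[OF ab(3), of 0] by auto
      qed
      thus False using x by simp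
    qed
    thus "x \<in> K" by (rule extreme_point_of_convex_hull)
  qed
qed

section \<open>Hausdorff convergence of gaps\<close>

lemma edge_frontier: "l \<in> edges K \<Longrightarrow> l \<subseteq> frontier K"
  by (auto elim!: edgesE)

lemma hausdorff_dist_commute: "hausdorff_dist A B = hausdorff_dist B A"
  by (simp add: hausdorff_dist_def max.commute)

text \<open>Boundedness of \<open>A\<close> makes the real supremum an upper bound of its members;
  nonemptiness of \<open>B\<close> excludes the default value 0 of \<open>infdist\<close> to the
  empty set.\<close>

lemma hausdorff_dist_lessD:
  assumes "hausdorff_dist A B < e" "bounded A" "B \<noteq> {}" "a \<in> A"
  obtains b where "b \<in> B" "dist a b < e"
proof -
  obtain b0 where b0: "b0 \<in> B" using assms(3) by blast
  obtain r where r: "\<And>a. a \<in> A \<Longrightarrow> dist b0 a \<le> r"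
    using assms(2) bounded_any_center[of A b0] by blast
  have "infdist a' B \<le> r" if "a' \<in> A" for a'
    using infdist_le[OF b0, of a'] r[OF that] by (simp add: dist_commute)
  hence "bdd_above ((\<lambda>a. infdist a B) ` A)" by (auto simp: bdd_above_def)
  hence "infdist a B \<le> (SUP a\<in>A. infdist a B)" using assms(4) by (rule cSUP_upper2) simp
  also have "\<dots> < e" using assms(1) by (simp add: hausdorff_dist_def)
  finally have "(INF b\<in>B. dist a b) < e" using assms(3) by (simp add: infdist_notempty)
  then obtain b where "b \<in> B" "dist a b < e"
    using assms(3) by (subst (asm) cINF_less_iff) (auto intro: bdd_belowI2[of _ 0])
  thus thesis by (rule that)
qed

lemma hausdorff_dist_leI:
  assumes "A \<noteq> {}" "B \<noteq> {}" "\<And>a. a \<in> A \<Longrightarrow> infdist a B \<le> e" "\<And>b. b \<in> B \<Longrightarrow> infdist b A \<le> e"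
  shows "hausdorff_dist A B \<le> e"
  using assms by (auto simp: hausdorff_dist_def intro!: cSUP_least)

lemma gap_nonempty: "geolamination L \<Longrightarrow> G \<in> gaps L \<Longrightarrow> G \<noteq> {}"
  using gap_interior(1) interior_subset by blast

lemma gap_close_point:
  assumes "geolamination L" "G \<in> gaps L" "geolamination M" "U \<in> gaps M" "hausdorff_dist U G < e"
  shows "g \<in> G \<Longrightarrow> \<exists>u\<in>U. dist g u < e" and "u \<in> U \<Longrightarrow> \<exists>g\<in>G. dist u g < e"
proof -
  have b: "bounded U" "bounded G"
    using assms gap_compact compact_imp_bounded by metis+
  show "\<exists>u\<in>U. dist g u < e" if "g \<in> G"
  proof -
    have "hausdorff_dist G U < e" using assms(5) by (simp add: hausdorff_dist_commute)
    thus ?thesis using hausdorff_dist_lessD[OF _ b(2) gap_nonempty[OF assms(3,4)] that] by blast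
  qed
  show "\<exists>g\<in>G. dist u g < e" if "u \<in> U"
    using hausdorff_dist_lessD[OF assms(5) b(1) gap_nonempty[OF assms(1,2)] that] by blast
qed

text \<open>A compact convex \<open>K\<close> in the interior of \<open>G\<close> that comes within
  \<open>e'\<close> of every point of \<open>G\<close> misses the solid of a nearby \<open>M\<close>
  and so lies in one gap \<open>U\<close>. Conversely \<open>U\<close> cannot reach far out of
  \<open>G\<close>: convexity would put a neighbourhood of some frontier point of \<open>G\<close>
  into its interior, but \<open>M\<close> has solid points there.\<close>

theorem exists_close_gap:
  assumes "geolamination L" "G \<in> gaps L" "e > 0"
  shows "\<exists>\<delta>>0. \<forall>M. geolamination M \<longrightarrow> hausdorff_dist (solid M) (solid L) < \<delta> \<longrightarrow> (\<exists>U\<in>gaps M. hausdorff_dist U G < e)"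
proof -
  define e' where "e' = e / 2"
  have e': "e' > 0" using assms(3) by (simp add: e'_def)
  have Gc: "compact G" by (rule gap_compact[OF assms(1,2)])
  note Gi = gap_interior[OF assms(1,2)]
  have "G \<subseteq> (\<Union>p\<in>interior G. ball p e')"
  proof
    fix g assume "g \<in> G"
    hence "g \<in> closure (interior G)" using Gi(4) by simp
    then obtain p where "p \<in> interior G" "dist p g < e'" using e' closure_approachable by metis
    thus "g \<in> (\<Union>p\<in>interior G. ball p e')" by auto
  qed
  then obtain P where P: "P \<subseteq> interior G" "finite P" "G \<subseteq> (\<Union>p\<in>P. ball p e')"
    using compactE_image[OF Gc, of "interior G" "\<lambda>p. ball p e'"] by auto
  obtain z0 where z0: "z0 \<in> interior G" using Gi(1) by blast
  obtain \<rho> where \<rho>: "\<rho> > 0" "cball z0 \<rho> \<subseteq> interior G"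
    using z0 open_interior open_contains_cball by metis
  define K where "K = convex hull (P \<union> cball z0 \<rho>)"
  have K: "compact K" "convex K" "P \<subseteq> K" "cball z0 \<rho> \<subseteq> K" "K \<subseteq> interior G"
  proof -
    show "compact K" unfolding K_def
      by (intro compact_convex_hull compact_Un finite_imp_compact P(2) compact_cball)
    show "P \<subseteq> K" "cball z0 \<rho> \<subseteq> K" "convex K" unfolding K_def using hull_subset by fastforce+
    show "K \<subseteq> interior G" unfolding K_def
      using P(1) \<rho>(2) gap_convex[OF assms(1,2)] by (intro hull_minimal convex_interior) auto
  qed
  have "closed (solid L)" using assms(1) by (simp add: geolamination_def)
  moreover have "K \<inter> solid L = {}" using K(5) Gi(3) by blast
  ultimately obtain r where r: "r > 0" "\<And>x y. x \<in> K \<Longrightarrow> y \<in> solid L \<Longrightarrow> r \<le> dist x y"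
    using separate_compact_closed[OF K(1)] by metis
  \<comment> \<open>The first term keeps \<open>solid M\<close> off \<open>K\<close>. For the
    second: a \<open>w\<close> in \<open>U\<close> at distance above \<open>e'\<close> from
    \<open>G\<close> gives a crossing point \<open>q\<close> with \<open>1 - t > e' / 2\<close>, as
    the disk has diameter 2, and the cone from the ball of radius \<open>\<rho>\<close> to
    \<open>w\<close> contains the ball of radius \<open>\<rho> * (1 - t)\<close> about
    \<open>q\<close>.\<close>
  define \<delta> where "\<delta> = min r (\<rho> * e' / 2)"
  show ?thesis
  proof (intro exI conjI allI impI)
    show "\<delta> > 0" using r \<rho> e' by (simp add: \<delta>_def)
    fix M assume M: "geolamination M" "hausdorff_dist (solid M) (solid L) < \<delta>"
    have bM: "bounded (solid M)" "bounded (solid L)"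
      using compact_solid M(1) assms(1) compact_imp_bounded by blast+
    have "K \<inter> solid M = {}"
    proof (rule ccontr)
      assume "K \<inter> solid M \<noteq> {}"
      then obtain x where x: "x \<in> K" "x \<in> solid M" by blast
      obtain y where "y \<in> solid L" "dist x y < \<delta>"
        using hausdorff_dist_lessD[OF M(2) bM(1) solid_nonempty[OF assms(1)] x(2)] .
      thus False using r(2)[OF x(1)] by (force simp: \<delta>_def)
    qed
    hence "K \<subseteq> ball 0 1 - solid M" using K(5) Gi(2) by blast
    moreover have "K \<noteq> {}" using K(4) \<rho>(1) by auto
    ultimately obtain U where U: "U \<in> gaps M" "K \<subseteq> interior U"
      using gap_containing[OF convex_connected[OF K(2)] _ _ M(1)] by metis
    have cU: "convex U" by (rule gap_convex[OF M(1) U(1)])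
    have 1: "infdist g U \<le> e'" if g: "g \<in> G" for g
    proof -
      obtain p where "p \<in> P" "dist p g < e'" using P(3) g by auto
      moreover have "p \<in> U" using \<open>p \<in> P\<close> K(3) U(2) interior_subset by blast
      ultimately show ?thesis using infdist_le2[of p U g e'] by (simp add: dist_commute)
    qed
    have 2: "infdist w G \<le> e'" if w: "w \<in> U" for w
    proof (rule ccontr)
      assume far: "\<not> infdist w G \<le> e'"
      have "w \<notin> G" using far e' by auto
      moreover have z0G: "z0 \<in> G" using z0 interior_subset by blast
      ultimately have "closed_segment z0 w \<inter> frontier G \<noteq> {}"
        by (intro connected_Int_frontier) auto
      then obtain q where q: "q \<in> closed_segment z0 w" "q \<in> frontier G" by blast
      obtain t where t: "q = (1 - t) *\<^sub>R z0 + t *\<^sub>R w" "0 \<le> t" "t \<le> 1"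
        using q(1) by (auto simp: in_segment)
      have qG: "q \<in> G" "q \<in> solid L"
        using q(2) gap_frontier_subset[OF assms(1,2)] gap_frontier_solid[OF assms(1,2)] by auto
      have "w - q = (1 - t) *\<^sub>R (w - z0)" by (simp add: t algebra_simps)
      hence "dist w q = (1 - t) * norm (w - z0)" using t by (simp add: dist_norm)
      moreover have "norm (w - z0) \<le> 2"
      proof -
        have "norm w \<le> 1" using w gap_subset_disk[OF M(1) U(1)] by auto
        moreover have "norm z0 < 1" using z0 Gi(2) by auto
        ultimately show ?thesis using norm_triangle_ineq4[of w z0] by linarith
      qed
      ultimately have "dist w q \<le> (1 - t) * 2" using mult_left_mono[of "norm (w - z0)" 2 "1 - t"] t(3) by simp
      moreover have "infdist w G \<le> dist w q" by (rule infdist_le[OF qG(1)])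
      ultimately have "e' < (1 - t) * 2" using far by linarith
      hence t1: "1 - t > e' / 2" by simp
      hence t1': "1 - t > 0" using e' by linarith
      have "hausdorff_dist (solid L) (solid M) < \<delta>" using M(2) by (simp add: hausdorff_dist_commute)
      then obtain q' where q': "q' \<in> solid M" "dist q q' < \<delta>"
        using hausdorff_dist_lessD[OF _ bM(2) solid_nonempty[OF M(1)] qG(2)] by blast
      \<comment> \<open>\<open>u\<close> is chosen so that \<open>q'\<close> divides the segment
        from \<open>u\<close> to \<open>w\<close> in the ratio in which \<open>q\<close> divides the
        segment from \<open>z0\<close> to \<open>w\<close>.\<close>
      define u where "u = z0 + (1 / (1 - t)) *\<^sub>R (q' - q)"
      have "dist q q' \<le> \<rho> * (e' / 2)" using q'(2) by (simp add: \<delta>_def)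
      also have "\<dots> \<le> \<rho> * (1 - t)" using t1 \<rho>(1) by (intro mult_left_mono) auto
      finally have "norm (q' - q) / (1 - t) \<le> \<rho>"
        using t1' by (simp add: dist_norm norm_minus_commute divide_le_eq)
      hence "u \<in> cball z0 \<rho>" using t1' by (simp add: u_def dist_norm)
      hence u: "u \<in> interior U" using K(4) U(2) by blast
      have "(1 - t) *\<^sub>R u = (1 - t) *\<^sub>R z0 + (q' - q)"
        using t1' by (simp add: u_def scaleR_right_distrib)
      hence q'u: "q' = (1 - t) *\<^sub>R u + t *\<^sub>R w" by (simp add: t(1))
      have "q' \<in> interior U"
      proof (cases "t = 0 \<or> u = w")
        case True
        hence "q' = u" using q'u by (auto simp: algebra_simps)
        thus ?thesis using u by simp
      next
        case False
        hence "q' \<in> open_segment u w" unfolding in_segment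
          using q'u t(2) t1' by (intro conjI exI[of _ t]) auto
        thus ?thesis using in_interior_closure_convex_segment[OF cU u] w closure_subset by blast
      qed
      thus False using gap_interior(3)[OF M(1) U(1)] q'(1) by blast
    qed
    have "hausdorff_dist U G \<le> e'"
      using 1 2 gap_nonempty[OF M(1) U(1)] gap_nonempty[OF assms(1,2)] by (intro hausdorff_dist_leI) auto
    hence "hausdorff_dist U G < e" using e' by (simp add: e'_def)
    thus "\<exists>U\<in>gaps M. hausdorff_dist U G < e" using U(1) by blast
  qed
qed

text \<open>Near \<open>m\<close> there is a point \<open>w\<close> at positive distance from
  \<open>G\<close>. A gap close enough to \<open>G\<close> omits \<open>w\<close> but has a point
  near \<open>m\<close>, so its frontier meets the ball that contains both.\<close>

lemma frontier_close:
  assumes "geolamination L" "G \<in> gaps L" "m \<in> frontier G" "\<eta> > 0"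
  shows "\<exists>\<delta>>0. \<forall>M U. geolamination M \<longrightarrow> U \<in> gaps M \<longrightarrow> hausdorff_dist U G < \<delta> \<longrightarrow> (\<exists>q\<in>frontier U. dist q m < \<eta>)"
proof -
  have mG: "m \<in> G" using gap_frontier_subset[OF assms(1,2)] assms(3) by blast
  have "m \<notin> interior G" using assms(3) by (auto simp: frontier_def)
  hence "\<not> ball m \<eta> \<subseteq> G" using assms(4) by (auto simp: mem_interior)
  then obtain w where w: "w \<in> ball m \<eta>" "w \<notin> G" by blast
  define c where "c = infdist w G"
  have c: "c > 0" unfolding c_def
    using w(2) gap_nonempty[OF assms(1,2)] gap_compact[OF assms(1,2)]
    by (intro infdist_pos_not_in_closed compact_imp_closed)
  show ?thesis
  proof (intro exI conjI allI impI)
    show "min c \<eta> > 0" using c assms(4) by simp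
    fix M U assume MU: "geolamination M" "U \<in> gaps M" "hausdorff_dist U G < min c \<eta>"
    note close = gap_close_point[OF assms(1,2) MU]
    obtain u where u: "u \<in> U" "dist m u < min c \<eta>" using close(1)[OF mG] by blast
    have "w \<notin> U"
    proof
      assume "w \<in> U"
      then obtain g where "g \<in> G" "dist w g < min c \<eta>" using close(2) by blast
      thus False using infdist_le[of g G w] by (simp add: c_def)
    qed
    hence "ball m \<eta> \<inter> frontier U \<noteq> {}"
      using u w by (intro connected_Int_frontier) auto
    thus "\<exists>q\<in>frontier U. dist q m < \<eta>" by (auto simp: dist_commute)
  qed
qed


lemma LIMSEQ_inverse_Suc_dist:
  assumes "\<And>n. dist (x n) l < 1 / real (Suc n) \<or> dist l (x n) < 1 / real (Suc n)"
  shows "x \<longlonglongrightarrow> l"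
proof (rule metric_tendsto_imp_tendsto[OF LIMSEQ_inverse_real_of_nat])
  show "\<forall>\<^sub>F n in sequentially. dist (x n) l \<le> dist (inverse (real (Suc n))) 0"
  proof (intro always_eventually allI)
    fix n show "dist (x n) l \<le> dist (inverse (real (Suc n))) 0"
      using assms[of n] by (auto simp: dist_commute inverse_eq_divide)
  qed
qed

text \<open>In the limit the chord passes through the midpoint of \<open>a b\<close> and has
  \<open>a\<close> and \<open>b\<close> weakly on one side, so it lies along
  \<open>a b\<close>.\<close>

lemma close_edge_limit:
  fixes p :: "nat \<Rightarrow> complex"
  assumes ab: "a \<in> circle" "b \<in> circle" "a \<noteq> b"
    and pc: "\<And>n. p n \<in> circle" "\<And>n. c n \<in> circle"
    and q: "\<And>n. q n \<in> closed_segment (p n) (c n)" "q \<longlonglongrightarrow> midpoint a b"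
    and u: "\<And>n. side (p n) (c n) (u n) \<ge> 0" "u \<longlonglongrightarrow> a"
    and v: "\<And>n. side (p n) (c n) (v n) \<ge> 0" "v \<longlonglongrightarrow> b"
    and lim: "p \<longlonglongrightarrow> p'" "c \<longlonglongrightarrow> c'"
  shows "{a, b} = {p', c'}"
proof -
  define m where "m = midpoint a b"
  have m: "m \<in> closed_segment a b" "m \<noteq> a" "m \<noteq> b" by (simp_all add: m_def ab)
  have pc': "p' \<in> circle" "c' \<in> circle"
    using closed_sequentially[OF closed_sphere, of p 0 1 p'] closed_sequentially[OF closed_sphere, of c 0 1 c'] pc lim
    by auto
  have "(\<lambda>n. side (p n) (c n) (q n)) \<longlonglongrightarrow> side p' c' m"
    unfolding m_def by (intro tendsto_side q lim)
  moreover have "side (p n) (c n) (q n) = 0" for n using q(1) closed_segment_side by blast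
  ultimately have sm: "side p' c' m = 0" by (simp add: LIMSEQ_const_iff)
  have sa: "side p' c' a \<ge> 0"
    using tendsto_side[OF lim u(2)] u(1) by (intro LIMSEQ_le_const) auto
  have sb: "side p' c' b \<ge> 0"
    using tendsto_side[OF lim v(2)] v(1) by (intro LIMSEQ_le_const) auto
  \<comment> \<open>A degenerate limit would put the midpoint on the circle.\<close>
  have "p' \<noteq> c'"
  proof
    assume eq: "p' = c'"
    have "(\<lambda>n. dist (p n) (c n)) \<longlonglongrightarrow> dist p' c'" by (intro tendsto_intros lim)
    hence d0: "(\<lambda>n. dist (p n) (c n)) \<longlonglongrightarrow> 0" using eq by simp
    have "dist (q n) (p n) \<le> dist (p n) (c n)" for n
      using segment_bound(1)[OF q(1)[of n]] by (simp add: dist_norm norm_minus_commute)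
    hence "(\<lambda>n. dist (q n) (p n)) \<longlonglongrightarrow> 0"
      using tendsto_sandwich[OF _ _ tendsto_const d0] by simp
    moreover have "(\<lambda>n. dist (q n) (p n)) \<longlonglongrightarrow> dist m p'" unfolding m_def by (intro tendsto_intros lim q)
    ultimately have "dist m p' = 0" using LIMSEQ_unique by blast
    thus False using pc'(1) midpoint_ball[OF ab] by (auto simp: m_def)
  qed
  have "side p' c' a = 0" "side p' c' b = 0"
    using segment_side_le_0[OF m(1), of p' c'] sm sa sb m(2,3) by auto
  thus ?thesis using chord_cong(1)[OF pc' \<open>p' \<noteq> c'\<close> ab] by simp
qed

text \<open>Otherwise there are gaps arbitrarily close to \<open>G\<close> without such an edge.
  Each has a frontier point near the midpoint of \<open>a b\<close>, hence an edge through it with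
  points near \<open>a\<close> and \<open>b\<close> on one side; by compactness a subsequence of
  these edges converges, and the limit can only be \<open>a b\<close>.\<close>

theorem close_edge:
  assumes "geolamination L" "G \<in> gaps L" "a \<in> circle" "b \<in> circle" "a \<noteq> b"
    "closed_segment a b \<in> edges G" "e > 0"
  shows "\<exists>\<delta>>0. \<forall>M U. geolamination M \<longrightarrow> U \<in> gaps M \<longrightarrow> hausdorff_dist U G < \<delta> \<longrightarrow>
      (\<exists>a'\<in>circle. \<exists>b'\<in>circle. a' \<noteq> b' \<and> closed_segment a' b' \<in> edges U \<and> dist a' a < e \<and> dist b' b < e)"
proof (rule ccontr)
  assume none: "\<not> ?thesis"
  define m where "m = midpoint a b"
  have mb: "m \<in> ball 0 1" unfolding m_def by (rule midpoint_ball[OF assms(3-5)])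
  have "closed_segment a b \<subseteq> frontier G"
    using edge_frontier assms(6) by blast
  hence mG: "m \<in> frontier G" and abG: "a \<in> G" "b \<in> G"
    using gap_frontier_subset[OF assms(1,2)] by (auto simp: m_def)
  define far where "far U \<longleftrightarrow>
      \<not> (\<exists>a'\<in>circle. \<exists>b'\<in>circle. a' \<noteq> b' \<and> closed_segment a' b' \<in> edges U \<and> dist a' a < e \<and> dist b' b < e)" for U
  have "\<exists>U q p c u v. far U \<and> dist q m < 1 / real (Suc n) \<and> p \<in> circle \<and> c \<in> circle \<and> p \<noteq> c \<and> 
      closed_segment p c \<in> edges U \<and> q \<in> closed_segment p c \<and> 
      dist a u < 1 / real (Suc n) \<and> dist b v < 1 / real (Suc n) \<and> side p c u \<ge> 0 \<and> side p c v \<ge> 0" for n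
  proof -
    \<comment> \<open>The bound \<open>1 - norm m\<close> keeps the frontier point \<open>q\<close>
      inside the open disk, where it must lie on an edge.\<close>
    define \<eta> where "\<eta> = min (1 / real (Suc n)) (1 - norm m)"
    have \<eta>: "\<eta> > 0" using mb by (simp add: \<eta>_def)
    obtain \<delta> where \<delta>: "\<delta> > 0"
      "\<And>M U. geolamination M \<Longrightarrow> U \<in> gaps M \<Longrightarrow> hausdorff_dist U G < \<delta> \<Longrightarrow> \<exists>q\<in>frontier U. dist q m < \<eta>"
      using frontier_close[OF assms(1,2) mG \<eta>] by blast
    have "min \<delta> \<eta> > 0" using \<delta>(1) \<eta> by simp
    then obtain M U where MU: "geolamination M" "U \<in> gaps M" "hausdorff_dist U G < min \<delta> \<eta>" "far U"
      using none unfolding far_def by blast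
    obtain q where q: "q \<in> frontier U" "dist q m < \<eta>" using \<delta>(2) MU by force
    have "norm q \<le> norm m + norm (q - m)" using norm_triangle_sub by blast
    hence "norm q < 1" using q(2) by (simp add: \<eta>_def dist_norm)
    then obtain p c where pc: "p \<in> circle" "c \<in> circle" "p \<noteq> c" "closed_segment p c \<in> M"
      "closed_segment p c \<in> edges U" "q \<in> closed_segment p c"
      using gap_frontier_leaf[OF MU(1,2) q(1)] by auto
    note close = gap_close_point(1)[OF assms(1,2) MU(1-3)]
    obtain u v where uv: "u \<in> U" "dist a u < min \<delta> \<eta>" "v \<in> U" "dist b v < min \<delta> \<eta>"
      using close[OF abG(1)] close[OF abG(2)] by blast
    have d: "dist q m < 1 / real (Suc n)" "dist a u < 1 / real (Suc n)" "dist b v < 1 / real (Suc n)"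
      using q(2) uv by (auto simp: \<eta>_def)
    show ?thesis
      using gap_leaf_side[OF MU(1,2) pc(1-4)]
    proof
      assume "(\<forall>z\<in>interior U. side p c z > 0) \<and> (\<forall>z\<in>U. side p c z \<ge> 0)"
      hence "side p c u \<ge> 0" "side p c v \<ge> 0" using uv by auto
      thus ?thesis using MU(4) pc d by blast
    next
      assume "(\<forall>z\<in>interior U. side p c z < 0) \<and> (\<forall>z\<in>U. side p c z \<le> 0)"
      hence "side c p u \<ge> 0" "side c p v \<ge> 0" using uv by (auto simp: side_swap[of c p])
      moreover have "closed_segment c p \<in> edges U" "q \<in> closed_segment c p"
        using pc(5,6) by (simp_all add: closed_segment_commute[of c p])
      ultimately show ?thesis using MU(4) pc(1-3) d by metis
    qed
  qed
  then obtain U q p c u v where S: "\<And>n. far (U n)" "\<And>n. dist (q n) m < 1 / real (Suc n)"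
    "\<And>n. p n \<in> circle" "\<And>n. c n \<in> circle" "\<And>n. p n \<noteq> c n" "\<And>n. closed_segment (p n) (c n) \<in> edges (U n)"
    "\<And>n. q n \<in> closed_segment (p n) (c n)" "\<And>n. dist a (u n) < 1 / real (Suc n)" "\<And>n. dist b (v n) < 1 / real (Suc n)"
    "\<And>n. side (p n) (c n) (u n) \<ge> 0" "\<And>n. side (p n) (c n) (v n) \<ge> 0"
    by metis
  have lims: "q \<longlonglongrightarrow> m" "u \<longlonglongrightarrow> a" "v \<longlonglongrightarrow> b"
    using S(2,8,9) by (auto intro!: LIMSEQ_inverse_Suc_dist)
  have "compact (circle \<times> circle)" by (intro compact_Times compact_sphere)
  moreover have "\<And>n. (p n, c n) \<in> circle \<times> circle" using S(3,4) by blast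
  ultimately obtain l r where lr: "l \<in> circle \<times> circle" "strict_mono r" "((\<lambda>n. (p n, c n)) \<circ> r) \<longlonglongrightarrow> l"
    unfolding compact_def by meson
  define p' c' where "p' = fst l" and "c' = snd l"
  have pl: "(p \<circ> r) \<longlonglongrightarrow> p'" "(c \<circ> r) \<longlonglongrightarrow> c'"
    using tendsto_fst[OF lr(3)] tendsto_snd[OF lr(3)] by (simp_all add: p'_def c'_def o_def)
  have "{a, b} = {p', c'}"
  proof (rule close_edge_limit[OF assms(3-5), where p = "p \<circ> r" and c = "c \<circ> r" and q = "q \<circ> r" and u = "u \<circ> r" and v = "v \<circ> r"])
    show "(q \<circ> r) \<longlonglongrightarrow> midpoint a b" "(u \<circ> r) \<longlonglongrightarrow> a" "(v \<circ> r) \<longlonglongrightarrow> b"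
      using LIMSEQ_subseq_LIMSEQ[OF lims(1) lr(2)] LIMSEQ_subseq_LIMSEQ[OF lims(2) lr(2)] LIMSEQ_subseq_LIMSEQ[OF lims(3) lr(2)]
      by (simp_all add: m_def)
  qed (use S pl in auto)
  hence cases: "(p' = a \<and> c' = b) \<or> (p' = b \<and> c' = a)" by (auto simp: doubleton_eq_iff)
  have ev: "\<forall>\<^sub>F n in sequentially. dist (p (r n)) p' < e" "\<forall>\<^sub>F n in sequentially. dist (c (r n)) c' < e"
    using tendstoD[OF pl(1) assms(7)] tendstoD[OF pl(2) assms(7)] by (simp_all add: o_def)
  obtain n where n: "dist (p (r n)) p' < e" "dist (c (r n)) c' < e"
    using eventually_happens'[OF sequentially_bot eventually_conj[OF ev]] by blast
  have "closed_segment (c (r n)) (p (r n)) \<in> edges (U (r n))"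
    using S(6)[of "r n"] by (simp add: closed_segment_commute[of "c (r n)"])
  hence "\<not> far (U (r n))"
    using cases n S(3,4,5,6)[of "r n"] unfolding far_def by metis
  thus False using S(1) by blast
qed

section \<open>The geolamination of a lamination\<close>

lemma chord_in_hull: "a \<in> S \<Longrightarrow> b \<in> S \<Longrightarrow> closed_segment a b \<subseteq> convex hull S"
  by (intro closed_segment_subset hull_inc convex_convex_hull)

lemma turn_minus_1 [simp]: "turn (x - 1) = turn x"
  using turn_add_int[of x "-1"] by simp

lemma sigma_circle: "z \<in> circle \<Longrightarrow> sigma d z \<in> circle"
  by (simp add: sigma_def norm_power)

context
  fixes R :: "(complex \<times> complex) set"
  assumes R: "lamination R"
begin

lemma lamination_props:
  shows "equiv circle R" "closed R" "g \<in> circle // R \<Longrightarrow> finite g"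
    "g \<in> circle // R \<Longrightarrow> h \<in> circle // R \<Longrightarrow> g \<noteq> h \<Longrightarrow> convex hull g \<inter> convex hull h = {}"
  using R by (simp_all add: lamination_def)

lemmas class_finite = lamination_props(3)

lemma class_subset: "g \<in> circle // R \<Longrightarrow> g \<subseteq> circle"
  by (rule in_quotient_imp_subset[OF lamination_props(1)])

lemma class_exists:
  assumes "z \<in> circle"
  obtains g where "g \<in> circle // R" "z \<in> g"
proof -
  have "equiv circle R" by (rule lamination_props(1))
  hence "z \<in> R `` {z}" using assms by (rule equiv_class_self)
  thus thesis using that[of "R `` {z}"] assms by (simp add: quotientI)
qed

lemma class_unique: "g \<in> circle // R \<Longrightarrow> h \<in> circle // R \<Longrightarrow> z \<in> g \<Longrightarrow> z \<in> h \<Longrightarrow> g = h"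
  using quotient_disj[OF lamination_props(1), of g h] by blast

lemma hulls_meet:
  assumes "g \<in> circle // R" "h \<in> circle // R" "x \<in> convex hull g" "x \<in> convex hull h"
  shows "g = h"
  using assms lamination_props(4)[of g h] by blast

lemma class_hull_one_side:
  assumes "g \<in> circle // R" "l \<in> edges (convex hull g)"
  obtains a b where "a \<in> g" "b \<in> g" "a \<noteq> b" "\<forall>z\<in>g. side a b z \<ge> 0" "l = closed_segment a b"
proof -
  obtain a b where ab: "a \<in> circle" "b \<in> circle" "a \<noteq> b" "closed_segment a b \<subseteq> frontier (convex hull g)"
    "l = closed_segment a b"
    using edgesE[OF assms(2)] .
  have "closed (convex hull g)"
    using class_finite[OF assms(1)] by (intro compact_imp_closed finite_imp_compact_convex_hull)
  hence "closed_segment a b \<subseteq> convex hull g"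
    using frontier_subset_closed subset_trans[OF ab(4)] by metis
  hence hull: "a \<in> convex hull g" "b \<in> convex hull g" by auto
  hence "a \<in> basis (convex hull g)" "b \<in> basis (convex hull g)"
    using ab(1,2) by (simp_all add: basis_def)
  hence g: "a \<in> g" "b \<in> g"
    by (simp_all only: basis_hull[OF class_subset[OF assms(1)]])
  have sub: "g \<subseteq> convex hull g" by (rule hull_subset)
  consider "\<forall>z\<in>convex hull g. side a b z \<ge> 0" | "\<forall>z\<in>convex hull g. side a b z \<le> 0"
    using frontier_one_side[OF convex_convex_hull hull ab(3,4)] by blast
  thus thesis
  proof cases
    case 1
    hence "\<forall>z\<in>g. side a b z \<ge> 0" using sub by blast
    thus thesis by (rule that[OF g ab(3) _ ab(5)])
  next
    case 2
    hence "\<forall>z\<in>g. side b a z \<ge> 0" using sub by (auto simp: side_swap[of b a])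
    moreover have "l = closed_segment b a" using ab(5) by (simp add: closed_segment_commute)
    ultimately show thesis using ab(3) by (intro that[OF g(2,1)]) auto
  qed
qed

lemma class_edge_leaf:
  assumes "g \<in> circle // R" "a \<in> g" "b \<in> g" "\<forall>z\<in>g. side a b z \<ge> 0"
  shows "closed_segment a b \<in> geolam_of R"
proof (cases "a = b")
  case True
  thus ?thesis using class_subset[OF assms(1)] assms(2) by (auto simp: geolam_of_def)
next
  case False
  have "convex hull g \<subseteq> {z. side a b z \<ge> 0}"
    using assms(4) by (intro hull_minimal convex_side(1)) auto
  hence "\<And>z. z \<in> convex hull g \<Longrightarrow> side a b z \<ge> 0" by blast
  hence fr: "closed_segment a b \<subseteq> frontier (convex hull g)"
    by (intro one_side_frontier[OF False hull_inc[OF assms(2)] hull_inc[OF assms(3)] convex_convex_hull])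
  have "a \<in> circle" "b \<in> circle"
    using subsetD[OF class_subset[OF assms(1)]] assms(2,3) by simp_all
  hence "closed_segment a b \<in> edges (convex hull g)"
    using False fr unfolding edges_def by blast
  thus ?thesis using assms(1) unfolding geolam_of_def by blast
qed

text \<open>Normal form of a leaf used from here on: an oriented pair in one class with the class on
  its nonnegative side, so that \<open>b\<close> follows \<open>a\<close> counterclockwise in the
  class. Degenerate leaves fit in with \<open>a = b\<close>, because
  \<open>side a a z = 0\<close>.\<close>

lemma geolam_of_leafE:
  assumes "l \<in> geolam_of R"
  obtains g a b where "g \<in> circle // R" "a \<in> g" "b \<in> g" "\<forall>z\<in>g. side a b z \<ge> 0" "l = closed_segment a b"
  using assms unfolding geolam_of_def
proof (elim UnE UN_E)
  fix g assume g: "g \<in> circle // R" "l \<in> edges (convex hull g)"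
  obtain a b where "a \<in> g" "b \<in> g" "a \<noteq> b" "\<forall>z\<in>g. side a b z \<ge> 0" "l = closed_segment a b"
    using class_hull_one_side[OF g] .
  thus thesis by (intro that[OF g(1)])
next
  assume "l \<in> {{x} |x. x \<in> circle}"
  then obtain x where x: "x \<in> circle" "l = {x}" by blast
  obtain g where "g \<in> circle // R" "x \<in> g" using class_exists[OF x(1)] .
  thus thesis using x(2) by (intro that[of g x x]) auto
qed

lemma geolam_of_circle_leafE:
  assumes "closed_segment x y \<in> geolam_of R" "x \<in> circle" "y \<in> circle"
  obtains g a b where "g \<in> circle // R" "a \<in> g" "b \<in> g" "\<forall>z\<in>g. side a b z \<ge> 0"
    "(a = x \<and> b = y) \<or> (a = y \<and> b = x)"
proof -
  obtain g a b where *: "g \<in> circle // R" "a \<in> g" "b \<in> g" "\<forall>z\<in>g. side a b z \<ge> 0" 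
    "closed_segment x y = closed_segment a b"
    using geolam_of_leafE[OF assms(1)] .
  have "{x, y} = {a, b}" using *(5) by simp
  hence "(a = x \<and> b = y) \<or> (a = y \<and> b = x)" by (auto simp: doubleton_eq_iff)
  thus thesis by (rule that[OF *(1-4)])
qed

text \<open>A common point inside the disk makes the two class hulls meet, so there is one class; it
  lies on one side of the first leaf, which forces the second leaf along the first. Common points on
  the circle are endpoints of both.\<close>

lemma geolam_of_noncrossing:
  assumes l: "l \<in> geolam_of R" and m: "m \<in> geolam_of R" and "l \<noteq> m"
  shows "l \<inter> m = {} \<or> (\<exists>x\<in>circle. l \<inter> m = {x})"
proof -
  obtain g a b where g: "g \<in> circle // R" "a \<in> g" "b \<in> g" "\<forall>z\<in>g. side a b z \<ge> 0" "l = closed_segment a b"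
    using geolam_of_leafE[OF l] .
  obtain h c e where h: "h \<in> circle // R" "c \<in> h" "e \<in> h" "\<forall>z\<in>h. side c e z \<ge> 0" "m = closed_segment c e"
    using geolam_of_leafE[OF m] .
  have circ: "a \<in> circle" "b \<in> circle" "c \<in> circle" "e \<in> circle"
    using class_subset g(1-3) h(1-3) by blast+
  have hull: "l \<subseteq> convex hull g" "m \<subseteq> convex hull h"
    using chord_in_hull g(2,3,5) h(2,3,5) by metis+
  have *: "x \<in> circle" if x: "x \<in> l" "x \<in> m" for x
  proof (rule ccontr)
    assume nc: "x \<notin> circle"
    have gh: "g = h" using hulls_meet[OF g(1) h(1)] hull x by blast
    have ne: "a \<noteq> b" "c \<noteq> e" "x \<noteq> c" "x \<noteq> e" using nc x circ g(5) h(5) by auto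
    have "side a b x = 0" using x(1) g(5) closed_segment_side by blast
    hence "side a b c = 0" "side a b e = 0"
      using segment_side_le_0[OF x(2)[unfolded h(5)], of a b] g(4) h(2,3) gh ne by auto
    hence "closed_segment c e = closed_segment a b"
      using chord_cong(2)[OF circ(1,2) ne(1) circ(3,4) ne(2)] by blast
    thus False using assms(3) g(5) h(5) by metis
  qed
  have ends: "x = a \<or> x = b" "x = c \<or> x = e" if "x \<in> l" "x \<in> m" for x
    using segment_circle_ends[OF circ(1,2) *[OF that]] segment_circle_ends[OF circ(3,4) *[OF that]] that g(5) h(5)
    by blast+
  have "x = y" if xy: "x \<in> l" "x \<in> m" "y \<in> l" "y \<in> m" for x y
  proof (rule ccontr)
    assume "x \<noteq> y"
    hence "{a, b} = {c, e}" using ends[OF xy(1,2)] ends[OF xy(3,4)] by auto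
    thus False using assms(3) g(5) h(5) by simp
  qed
  thus ?thesis using * by blast
qed

text \<open>A chord between the two sides would meet \<open>a b\<close>, so both classes would be
  the same, and that class lies on one side of its own edge.\<close>

lemma class_not_cut:
  assumes g: "g \<in> circle // R" and h: "h \<in> circle // R" and ab: "a \<in> h" "b \<in> h" "\<forall>z\<in>h. side a b z \<ge> 0"
    and uv: "u \<in> g" "v \<in> g" "side a b u < 0" "side a b v > 0"
  shows False
proof -
  have ne: "a \<noteq> b" using uv by auto
  have circ: "a \<in> circle" "b \<in> circle" "u \<in> circle" "v \<in> circle"
    using class_subset g h ab uv by blast+
  have "connected (side a b ` closed_segment u v)"
    by (intro connected_continuous_image continuous_intros connected_segment)
  hence "0 \<in> side a b ` closed_segment u v"
    using uv by (meson connected_contains_Icc atLeastAtMost_iff image_eqI less_imp_le subsetD ends_in_segment)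
  then obtain x where x: "x \<in> closed_segment u v" "side a b x = 0" by auto
  have "norm x \<le> 1" using chord_subset_disk[OF circ(3,4)] x(1) by auto
  hence "x \<in> closed_segment a b" using side_eq_0_disk[OF circ(1,2) ne x(2)] by blast
  moreover have "closed_segment a b \<subseteq> convex hull h" "closed_segment u v \<subseteq> convex hull g"
    using chord_in_hull ab(1,2) uv(1,2) by blast+
  ultimately have "g = h" using hulls_meet[OF g h] x(1) by blast
  thus False using ab(3) uv by force
qed

text \<open>A limit of leaves either shrinks to a circle point or, as the relation is closed, joins
  two points of one class. This class need not be among those of the approximating leaves, so it
  remains to see that it lies on one side of the limit chord.\<close>

lemma closed_solid_geolam_of: "closed (solid (geolam_of R))"
  unfolding closed_sequential_limits
proof (intro allI impI, elim conjE)
  fix x l assume x: "\<forall>n. x n \<in> solid (geolam_of R)" "x \<longlonglongrightarrow> l"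
  have circle_solid: "z \<in> solid (geolam_of R)" if "z \<in> circle" for z
    using that unfolding solid_def geolam_of_def by blast
  have "\<exists>g a b. g \<in> circle // R \<and> a \<in> g \<and> b \<in> g \<and> (\<forall>z\<in>g. side a b z \<ge> 0) \<and> x n \<in> closed_segment a b" for n
  proof -
    obtain m where m: "m \<in> geolam_of R" "x n \<in> m" using x(1) unfolding solid_def by blast
    obtain g a b where "g \<in> circle // R" "a \<in> g" "b \<in> g" "\<forall>z\<in>g. side a b z \<ge> 0" "m = closed_segment a b"
      using geolam_of_leafE[OF m(1)] .
    thus ?thesis using m(2) by (intro exI[of _ g] exI[of _ a] exI[of _ b]) simp
  qed
  then obtain g a b where S: "\<And>n. g n \<in> circle // R" "\<And>n. a n \<in> g n" "\<And>n. b n \<in> g n"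
    "\<And>n. \<forall>z\<in>g n. side (a n) (b n) z \<ge> 0" "\<And>n. x n \<in> closed_segment (a n) (b n)"
    by metis
  have circ: "a n \<in> circle" "b n \<in> circle" for n
    using class_subset S(1-3) by blast+
  have "compact (circle \<times> circle)" by (intro compact_Times compact_sphere)
  moreover have "\<And>n. (a n, b n) \<in> circle \<times> circle" using circ by blast
  ultimately obtain k r where kr: "k \<in> circle \<times> circle" "strict_mono r" "((\<lambda>n. (a n, b n)) \<circ> r) \<longlonglongrightarrow> k"
    unfolding compact_def by meson
  define a' b' where "a' = fst k" and "b' = snd k"
  have circ': "a' \<in> circle" "b' \<in> circle" using kr(1) by (auto simp: a'_def b'_def)
  have lim: "(\<lambda>n. a (r n)) \<longlonglongrightarrow> a'" "(\<lambda>n. b (r n)) \<longlonglongrightarrow> b'"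
    using tendsto_fst[OF kr(3)] tendsto_snd[OF kr(3)] by (simp_all add: a'_def b'_def o_def)
  have xr: "(\<lambda>n. x (r n)) \<longlonglongrightarrow> l"
    using LIMSEQ_subseq_LIMSEQ[OF x(2) kr(2)] by (simp add: o_def)
  have xn: "norm (x n) \<le> 1" for n using chord_subset_disk[OF circ] S(5) by (auto simp: subset_iff)
  have nl: "norm l \<le> 1"
    using LIMSEQ_le_const2[OF tendsto_norm[OF x(2)], of 1] xn by blast
  have eqv: "equiv circle R" and clR: "closed R" by (rule lamination_props)+
  have "(a n, b n) \<in> R" for n
    using quotient_eq_iff[OF eqv S(1) S(1) S(2) S(3)] by blast
  hence abR: "(a', b') \<in> R"
    using closed_sequentially[OF clR _ tendsto_Pair[OF lim]] by blast
  show "l \<in> solid (geolam_of R)"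
  proof (cases "a' = b'")
    case True
    have "(\<lambda>n. dist (a (r n)) (b (r n))) \<longlonglongrightarrow> dist a' b'" by (intro tendsto_intros lim)
    hence d0: "(\<lambda>n. dist (a (r n)) (b (r n))) \<longlonglongrightarrow> 0" using True by simp
    have "dist (x (r n)) (a (r n)) \<le> dist (a (r n)) (b (r n))" for n
      using segment_bound(1)[OF S(5)[of "r n"]] by (simp add: dist_norm norm_minus_commute)
    hence "(\<lambda>n. dist (x (r n)) (a (r n))) \<longlonglongrightarrow> 0"
      using tendsto_sandwich[OF _ _ tendsto_const d0] by simp
    moreover have "(\<lambda>n. dist (x (r n)) (a (r n))) \<longlonglongrightarrow> dist l a'" by (intro tendsto_intros lim xr)
    ultimately have "dist l a' = 0" using LIMSEQ_unique by blast
    thus ?thesis using circ' circle_solid by simp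
  next
    case False
    define h where "h = R `` {a'}"
    have h: "h \<in> circle // R" "a' \<in> h" "b' \<in> h"
      using circ' abR equiv_class_self[OF eqv circ'(1)] by (auto simp: h_def quotientI)
    \<comment> \<open>Strict signs at \<open>u\<close> and \<open>v\<close> persist for the chords
      near the limit, and such a chord would cut the class \<open>h\<close>.\<close>
    have nocut: "\<not> (side a' b' u < 0 \<and> side a' b' v > 0)" if uv: "u \<in> h" "v \<in> h" for u v
    proof
      assume s: "side a' b' u < 0 \<and> side a' b' v > 0"
      have "\<forall>\<^sub>F n in sequentially. side (a (r n)) (b (r n)) u < 0"
        using s by (intro order_tendstoD(2)[OF tendsto_side[OF lim tendsto_const]]) auto
      moreover have "\<forall>\<^sub>F n in sequentially. side (a (r n)) (b (r n)) v > 0"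
        using s by (intro order_tendstoD(1)[OF tendsto_side[OF lim tendsto_const]]) auto
      ultimately have "\<forall>\<^sub>F n in sequentially. side (a (r n)) (b (r n)) u < 0 \<and> side (a (r n)) (b (r n)) v > 0"
        by (rule eventually_conj)
      then obtain n where "side (a (r n)) (b (r n)) u < 0" "side (a (r n)) (b (r n)) v > 0"
        using eventually_happens'[OF sequentially_bot] by blast
      thus False using class_not_cut[OF h(1) S(1) S(2) S(3) S(4) uv] by blast
    qed
    have leaf: "closed_segment a' b' \<in> geolam_of R"
    proof (cases "\<forall>z\<in>h. side a' b' z \<ge> 0")
      case True
      thus ?thesis using class_edge_leaf[OF h] by blast
    next
      case False
      then obtain u where "u \<in> h" "side a' b' u < 0" by force
      hence "\<forall>z\<in>h. side b' a' z \<ge> 0" using nocut by (force simp: side_swap[of b' a'])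
      hence "closed_segment b' a' \<in> geolam_of R" using class_edge_leaf[OF h(1,3,2)] by blast
      thus ?thesis by (simp add: closed_segment_commute)
    qed
    have "(\<lambda>n. side (a (r n)) (b (r n)) (x (r n))) \<longlonglongrightarrow> side a' b' l"
      by (intro tendsto_side lim xr)
    moreover have "side (a (r n)) (b (r n)) (x (r n)) = 0" for n using S(5) closed_segment_side by blast
    ultimately have "side a' b' l = 0" by (simp add: LIMSEQ_const_iff)
    hence "l \<in> closed_segment a' b'" using side_eq_0_disk[OF circ' False _ nl] by blast
    thus ?thesis using leaf unfolding solid_def by blast
  qed
qed

theorem geolamination_geolam_of: "geolamination (geolam_of R)"
  unfolding geolamination_def
proof (intro conjI ballI impI)
  show "geolam_of R \<subseteq> chords"
  proof
    fix l assume l: "l \<in> geolam_of R"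
    obtain g a b where g: "g \<in> circle // R" "a \<in> g" "b \<in> g" "\<forall>z\<in>g. side a b z \<ge> 0" "l = closed_segment a b"
      using geolam_of_leafE[OF l] .
    show "l \<in> chords" using subsetD[OF class_subset[OF g(1)]] g(2,3,5) unfolding chords_def by blast
  qed
  show "{x} \<in> geolam_of R" if "x \<in> circle" for x using that by (auto simp: geolam_of_def)
  show "l \<inter> m = {} \<or> (\<exists>x\<in>circle. l \<inter> m = {x})" if "l \<in> geolam_of R" "m \<in> geolam_of R" "l \<noteq> m" for l m
    using geolam_of_noncrossing[OF that] .
qed (rule closed_solid_geolam_of)

end

section \<open>Images and preimages of leaves\<close>

lemma invariant_lamination_lamination: "invariant_lamination d R \<Longrightarrow> lamination R"
  by (simp add: invariant_lamination_def)

lemma class_image: "invariant_lamination d R \<Longrightarrow> g \<in> circle // R \<Longrightarrow> sigma d ` g \<in> circle // R"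
  by (simp add: invariant_lamination_def)

text \<open>The last inequality says that the degree is at least one: \<open>F (t + 1) - F t\<close>
  is an integer, and positive because \<open>F\<close> increases.\<close>

lemma class_lift:
  assumes "invariant_lamination d R" "g \<in> circle // R"
  obtains F :: "real \<Rightarrow> real" where "continuous_on UNIV F" "strict_mono F"
    "\<forall>t. turn t \<in> g \<longleftrightarrow> turn (F t) \<in> sigma d ` g" "\<forall>t. turn t \<in> g \<longrightarrow> turn (F t) = sigma d (turn t)"
    "\<forall>t. F t + 1 \<le> F (t + 1)"
proof -
  obtain p where p: "orientation_preserving_covering p" "\<forall>z\<in>g. p z = sigma d z"
    "g = {z \<in> circle. p z \<in> sigma d ` g}"
    using assms unfolding invariant_lamination_def by meson
  obtain F :: "real \<Rightarrow> real" where F: "continuous_on UNIV F" "strict_mono F"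
    "\<And>t. p (cis (2 * pi * t)) = cis (2 * pi * F t)"
    using p(1) unfolding orientation_preserving_covering_def by blast
  have pF: "p (turn t) = turn (F t)" for t using F(3) by (simp add: turn_def)
  have "F t + 1 \<le> F (t + 1)" for t
  proof -
    have "turn (t + 1) = turn t" using turn_add_int[of t 1] by simp
    hence "turn (F (t + 1)) = turn (F t)" using pF[of "t + 1"] pF[of t] by simp
    then obtain n :: int where n: "F (t + 1) = F t + of_int n" using turn_eq_iff by blast
    have "F t < F (t + 1)" using F(2) by (simp add: strict_mono_less)
    hence "n \<ge> 1" using n by simp
    thus ?thesis using n by simp
  qed
  moreover have "turn t \<in> g \<longleftrightarrow> turn (F t) \<in> sigma d ` g" for t
  proof -
    have "turn t \<in> g \<longleftrightarrow> turn t \<in> {z \<in> circle. p z \<in> sigma d ` g}" using p(3) by simp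
    thus ?thesis using pF turn_circle by simp
  qed
  moreover have "turn (F t) = sigma d (turn t)" if "turn t \<in> g" for t
    using p(2) that pF by metis
  ultimately show thesis using that F(1,2) by blast
qed

lemma lift_surj:
  assumes "continuous_on UNIV F" "strict_mono (F :: real \<Rightarrow> real)" "F s < y" "y < F t"
  obtains u where "s < u" "u < t" "F u = y"
proof -
  have "s \<le> t" using assms by (metis strict_mono_less less_trans less_imp_le)
  then obtain u where u: "s \<le> u" "u \<le> t" "F u = y"
    using IVT'[of F s y t] assms continuous_on_subset by (metis less_imp_le subset_UNIV)
  moreover have "u \<noteq> s" "u \<noteq> t" using u assms by auto
  ultimately show thesis using that by force
qed

text \<open>Going back along the lift from \<open>b\<close>, a point over \<open>A\<close> is met
  before a full turn. The arc from \<open>A\<close> to \<open>B\<close> has no inner points in the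
  image class, so the arc above it has none in \<open>g\<close>.\<close>

lemma edge_lift_end:
  assumes R: "invariant_lamination d R" "g \<in> circle // R"
    and AB: "A \<in> sigma d ` g" "A \<noteq> B" "\<forall>z\<in>sigma d ` g. side A B z \<ge> 0"
    and b: "b \<in> g" "sigma d b = B"
  obtains a where "a \<in> g" "sigma d a = A" "\<forall>z\<in>g. side a b z \<ge> 0"
proof -
  obtain F :: "real \<Rightarrow> real" where F: "continuous_on UNIV F" "strict_mono F"
    "\<forall>t. turn t \<in> g \<longleftrightarrow> turn (F t) \<in> sigma d ` g" "\<forall>t. turn t \<in> g \<longrightarrow> turn (F t) = sigma d (turn t)"
    "\<forall>t. F t + 1 \<le> F (t + 1)"
    using class_lift[OF R] .
  have gc: "g \<subseteq> circle" by (rule class_subset[OF invariant_lamination_lamination[OF R(1)] R(2)])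
  obtain t1 where t1: "b = turn t1" using turn_surj[of b 0] gc b(1) by blast
  have B: "turn (F t1) = B" using F(4) t1 b by blast
  have "A \<in> circle" using AB(1) gc sigma_circle by blast
  then obtain x where x: "F t1 - 1 \<le> x" "x < F t1" "A = turn x"
    using turn_surj[of A "F t1 - 1"] by auto
  have "x \<noteq> F t1 - 1" using x(3) B AB(2) by auto
  hence x1: "F t1 - 1 < x" using x(1) by simp
  \<comment> \<open>Going back a full turn lowers \<open>F\<close> by at least 1, hence below
    \<open>x\<close>, so the preimage of \<open>x\<close> is found within that turn.\<close>
  have "F (t1 - 1) < x" using F(5)[rule_format, of "t1 - 1"] x1 by simp
  then obtain t0 where t0: "t1 - 1 < t0" "t0 < t1" "F t0 = x" using lift_surj[OF F(1,2)] x(2) by blast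
  define a where "a = turn t0"
  have a: "a \<in> g" using F(3)[rule_format, of t0] t0(3) x(3) AB(1) by (simp add: a_def)
  moreover have "sigma d a = A" using F(4)[rule_format, of t0] a t0(3) x(3) by (simp add: a_def)
  moreover have "side a b z \<ge> 0" if z: "z \<in> g" for z
  proof (rule ccontr)
    assume "\<not> side a b z \<ge> 0"
    hence neg: "side a b z < 0" by simp
    obtain s where s: "t0 \<le> s" "s < t0 + 1" "z = turn s" using turn_surj[of z t0] gc z by blast
    have "s \<noteq> t0" using neg s(3) by (auto simp: a_def)
    hence s0: "t0 < s" using s(1) by simp
    have st: "s < t1" using side_turn_sign(1)[of t0 t1 s] t0 s0 s neg by (simp add: a_def t1)
    have Fs: "x < F s" "F s < F t1" using F(2) s0 st t0(3) by (auto simp: strict_mono_less)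
    have "turn (F s) \<in> sigma d ` g" using F(3) z s(3) by blast
    hence "side A B (turn (F s)) \<ge> 0" using AB(3) by blast
    moreover have "side (turn x) (turn (F t1)) (turn (F s)) < 0"
      using side_turn_sign(1)[of x "F t1" "F s"] Fs x1 by simp
    ultimately show False using x(3) B by simp
  qed
  ultimately show thesis using that by blast
qed

text \<open>The arc from \<open>a\<close> to \<open>b\<close> has no inner points in
  \<open>g\<close>, and \<open>g\<close> is the full preimage of its image under the covering, so
  the image arc has no inner points in the image class. The image arc cannot wrap around: gaining a
  full turn, the lift would meet \<open>sigma d a\<close> again inside the arc.\<close>

lemma edge_image:
  assumes R: "invariant_lamination d R" "g \<in> circle // R"
    and ab: "a \<in> g" "b \<in> g" "\<forall>z\<in>g. side a b z \<ge> 0" "sigma d a \<noteq> sigma d b"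
  shows "\<forall>w\<in>sigma d ` g. side (sigma d a) (sigma d b) w \<ge> 0"
proof
  fix w assume w: "w \<in> sigma d ` g"
  obtain F :: "real \<Rightarrow> real" where F: "continuous_on UNIV F" "strict_mono F"
    "\<forall>t. turn t \<in> g \<longleftrightarrow> turn (F t) \<in> sigma d ` g" "\<forall>t. turn t \<in> g \<longrightarrow> turn (F t) = sigma d (turn t)"
    "\<forall>t. F t + 1 \<le> F (t + 1)"
    using class_lift[OF R] .
  have gc: "g \<subseteq> circle" by (rule class_subset[OF invariant_lamination_lamination[OF R(1)] R(2)])
  obtain t0 where t0: "a = turn t0" using turn_surj[of a 0] gc ab(1) by blast
  obtain t1 where t1: "t0 \<le> t1" "t1 < t0 + 1" "b = turn t1" using turn_surj[of b t0] gc ab(2) by blast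
  have "t1 \<noteq> t0" using ab(4) t0 t1 by auto
  hence t01: "t0 < t1" using t1 by simp
  have A: "turn (F t0) = sigma d a" and B: "turn (F t1) = sigma d b" using F(4) t0 t1 ab by blast+
  have free: False if "t0 < s" "s < t1" "turn (F s) \<in> sigma d ` g" for s
  proof -
    have "turn s \<in> g" using F(3) that by blast
    hence "side a b (turn s) \<ge> 0" using ab(3) by blast
    thus False using side_turn_sign(1)[of t0 t1 s] that t1 t01 t0 by simp
  qed
  have F1: "F t1 < F t0 + 1"
  proof (rule ccontr)
    assume "\<not> F t1 < F t0 + 1"
    moreover have t: "turn (F t0 + 1) = sigma d a" using turn_add_int[of "F t0" 1] A by simp
    ultimately have "F t0 + 1 < F t1" using B ab(4) by (metis linorder_cases)
    then obtain s where s: "t0 < s" "s < t1" "F s = F t0 + 1" using lift_surj[OF F(1,2), of t0 "F t0 + 1" t1] by auto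
    have "turn (F s) \<in> sigma d ` g" using s(3) t ab(1) by simp
    thus False using free s(1,2) by blast
  qed
  have F01: "F t0 < F t1" using F(2) t01 by (simp add: strict_mono_less)
  show "side (sigma d a) (sigma d b) w \<ge> 0"
  proof (rule ccontr)
    assume "\<not> side (sigma d a) (sigma d b) w \<ge> 0"
    hence neg: "side (sigma d a) (sigma d b) w < 0" by simp
    have "w \<in> circle" using w gc sigma_circle by blast
    then obtain y where y: "F t0 \<le> y" "y < F t0 + 1" "w = turn y" using turn_surj[of w "F t0"] by blast
    have "y \<noteq> F t0" using neg y(3) A by auto
    hence y0: "F t0 < y" using y(1) by simp
    have "y < F t1" using side_turn_sign(1)[of "F t0" "F t1" y] F01 F1 y0 y neg A B by simp
    then obtain s where "t0 < s" "s < t1" "F s = y" using lift_surj[OF F(1,2) y0] by blast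
    thus False using free y(3) w by blast
  qed
qed

lemma leaf_image:
  assumes R: "invariant_lamination d R" and l: "closed_segment a b \<in> geolam_of R" "a \<in> circle" "b \<in> circle"
  shows "closed_segment (sigma d a) (sigma d b) \<in> geolam_of R"
proof -
  note lam = invariant_lamination_lamination[OF R]
  obtain g x y where g: "g \<in> circle // R" "x \<in> g" "y \<in> g" "\<forall>z\<in>g. side x y z \<ge> 0"
    "(x = a \<and> y = b) \<or> (x = b \<and> y = a)"
    using geolam_of_circle_leafE[OF lam l] .
  have "\<forall>w\<in>sigma d ` g. side (sigma d x) (sigma d y) w \<ge> 0"
  proof (cases "sigma d x = sigma d y")
    case False
    thus ?thesis using edge_image[OF R g(1-4)] by blast
  qed simp
  hence "closed_segment (sigma d x) (sigma d y) \<in> geolam_of R"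
    using class_edge_leaf[OF lam class_image[OF R g(1)]] g(2,3) by blast
  thus ?thesis using g(5) by (metis closed_segment_commute)
qed

text \<open>In the arc from \<open>c1\<close> to \<open>c2\<close> there is one more preimage of \<open>B\<close> than there are preimages
  of \<open>A\<close>, so the edges above \<open>AB\<close> cannot match the two sets inside the arc.\<close>

lemma edge_pullback:
  assumes R: "invariant_lamination d R" and d: "d \<ge> 1"
    and h: "h \<in> circle // R" "A \<in> h" "B \<in> h" "\<forall>z\<in>h. side A B z \<ge> 0"
    and c: "c1 \<in> circle" "c2 \<in> circle" "side A B (sigma d c1) < 0" "side A B (sigma d c2) > 0"
  shows "\<exists>a\<in>circle. \<exists>b\<in>circle. closed_segment a b \<in> geolam_of R \<and> side a b c1 * side a b c2 < 0"
proof (rule ccontr)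
  assume none: "\<not> ?thesis"
  note lam = invariant_lamination_lamination[OF R]
  have AB: "A \<noteq> B" using c(3) by auto
  have ABc: "A \<in> circle" "B \<in> circle" using class_subset[OF lam h(1)] h by blast+
  have dpos: "real d > 0" using d by simp
  obtain t1 where t1: "c1 = turn t1" using turn_surj[OF c(1)] by metis
  obtain t2 where t2: "t1 \<le> t2" "t2 < t1 + 1" "c2 = turn t2" using turn_surj[OF c(2)] by metis
  have s1: "sigma d c1 = turn (d * t1)" and s2: "sigma d c2 = turn (d * t2)"
    using sigma_turn t1 t2 by simp_all
  \<comment> \<open>\<open>x0\<close> is the last lift of \<open>A\<close> before
    \<open>d * t1\<close>, and \<open>y0\<close> below is the next lift of \<open>B\<close>; the
    sign at \<open>c1\<close> then gives \<open>x0 < d * t1 < y0 < x0 + 1\<close>.\<close>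
  obtain x0 where x0': "d * t1 - 1 \<le> x0" "x0 < d * t1" "A = turn x0"
    using turn_surj[OF ABc(1), of "d * t1 - 1"] by auto
  have "x0 \<noteq> d * t1 - 1" using c(3) x0'(3) s1 by auto
  hence x0: "d * t1 < x0 + 1" using x0'(1) by simp
  obtain y0 where y0: "x0 \<le> y0" "y0 < x0 + 1" "B = turn y0" using turn_surj[OF ABc(2)] by metis
  have "y0 \<noteq> x0" using AB x0'(3) y0(3) by auto
  hence xy: "x0 < y0" using y0(1) by simp
  have ty: "d * t1 < y0"
    using side_turn_sign(1)[OF xy y0(2) x0'(2) x0] c(3) s1 x0'(3) y0(3) by simp
  \<comment> \<open>Likewise the sign at \<open>c2\<close> gives
    \<open>y0 + r < d * t2 < x0 + r + 1\<close>. So between \<open>d * t1\<close> and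
    \<open>d * t2\<close> the lifts of \<open>A\<close> are \<open>x0 + 1, ..., x0 + r\<close>, and
    those of \<open>B\<close> are \<open>y0, ..., y0 + r\<close>.\<close>
  define r where "r = \<lfloor>d * t2 - x0\<rfloor>"
  have r: "x0 \<le> d * t2 - r" "d * t2 - r < x0 + 1" unfolding r_def by linarith+
  have z2: "turn (d * t2 - r) = sigma d c2" using turn_add_int[of "d * t2" "- r"] s2 by simp
  have "d * t2 - r \<noteq> x0" using c(4) z2 x0'(3) by auto
  hence r1: "x0 < d * t2 - r" using r(1) by simp
  have r2: "y0 < d * t2 - r"
    using side_turn_sign(2)[OF xy y0(2) r1 r(2)] c(4) z2 x0'(3) y0(3) by simp
  have "d * t1 \<le> d * t2" using t2(1) by (simp add: mult_left_mono)
  hence "x0 < d * t2" using x0'(2) by linarith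
  hence r0: "r \<ge> 0" unfolding r_def by simp
  define SA where "SA = (\<lambda>j. turn ((x0 + real j) / d)) ` {1..nat r}"
  define SB where "SB = (\<lambda>j. turn ((y0 + real j) / d)) ` {0..nat r}"
  have inB: "t1 < (y0 + real j) / d" "(y0 + real j) / d < t2" if "j \<le> nat r" for j
  proof -
    have "real j \<le> of_int r" using that r0 by linarith
    hence "d * t1 < y0 + real j" "y0 + real j < d * t2" using ty r2 by linarith+
    thus "t1 < (y0 + real j) / d" "(y0 + real j) / d < t2" using dpos by (simp_all add: field_simps)
  qed
  have "inj_on (\<lambda>j. turn ((y0 + real j) / d)) {0..nat r}"
  proof
    fix i j assume ij: "i \<in> {0..nat r}" "j \<in> {0..nat r}" "turn ((y0 + real i) / d) = turn ((y0 + real j) / d)"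
    have "\<bar>(y0 + real i) / d - (y0 + real j) / d\<bar> < 1"
      using inB[of i] inB[of j] ij t2(2) by auto
    hence "(y0 + real i) / d = (y0 + real j) / d" using turn_inj ij(3) by blast
    thus "i = j" using dpos by simp
  qed
  hence cardB: "card SB = nat r + 1" unfolding SB_def by (simp add: card_image)
  have cardA: "card SA \<le> nat r" "finite SA" unfolding SA_def using card_image_le[of "{1..nat r}"] by auto
  \<comment> \<open>The edge over \<open>A B\<close> that ends in \<open>b\<close> starts in a
    preimage \<open>a\<close> of \<open>A\<close>. Were \<open>a\<close> outside the arc, this edge
    would separate \<open>c1\<close> from \<open>c2\<close>, against the assumption.\<close>
  have match: "\<exists>a\<in>SA. \<exists>g\<in>circle // R. a \<in> g \<and> b \<in> g \<and> a \<noteq> b \<and> (\<forall>z\<in>g. side a b z \<ge> 0)" if b: "b \<in> SB" for b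
  proof -
    obtain j where j: "j \<le> nat r" "b = turn ((y0 + real j) / d)" using b unfolding SB_def by auto
    define u where "u = (y0 + real j) / d"
    have u: "t1 < u" "u < t2" "b = turn u" using inB[OF j(1)] j(2) by (simp_all add: u_def)
    have "sigma d b = turn (y0 + of_int (int j))" using sigma_turn[of d u] u(3) dpos by (simp add: u_def)
    hence sb: "sigma d b = B" using y0(3) by (simp only: turn_add_int)
    obtain g where g: "g \<in> circle // R" "b \<in> g" using class_exists[OF lam turn_circle] u(3) by metis
    have gh: "sigma d ` g = h"
      using class_unique[OF lam class_image[OF R g(1)] h(1), of B] g(2) sb h(3) by blast
    obtain a where a: "a \<in> g" "sigma d a = A" "\<forall>z\<in>g. side a b z \<ge> 0"
      using edge_lift_end[OF R g(1) _ AB _ g(2) sb] h(2,4) gh by metis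
    have ab: "a \<noteq> b" using a(2) sb AB by auto
    have circ: "a \<in> circle" "b \<in> circle" using class_subset[OF lam g(1)] a(1) g(2) by blast+
    have "closed_segment a b \<in> geolam_of R" using class_edge_leaf[OF lam g(1) a(1) g(2) a(3)] .
    hence nosep: "side a b c1 * side a b c2 \<ge> 0" using none circ by force
    obtain s where s: "t1 \<le> s" "s < t1 + 1" "a = turn s" using turn_surj[OF circ(1)] by metis
    have "turn (d * s) = turn x0" using sigma_turn[of d s] a(2) s(3) x0'(3) by simp
    then obtain n :: int where n: "d * s = x0 + of_int n" using turn_eq_iff by blast
    have "d * t1 \<le> d * s" using s(1) by (simp add: mult_left_mono)
    hence "of_int n > (0::real)" using n x0'(2) by linarith
    hence n1: "n \<ge> 1" by simp
    have "s \<noteq> t2" using a(2) s(3) c(4) t2(3) by auto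
    moreover have "\<not> t2 < s"
    proof
      \<comment> \<open>Since \<open>s - 1 < t1\<close>, going round from \<open>a\<close> the order
        is \<open>c1\<close>, \<open>b\<close>, \<open>c2\<close>.\<close>
      assume "t2 < s"
      hence "side (turn (s - 1)) (turn u) (turn t1) < 0" "side (turn (s - 1)) (turn u) (turn t2) > 0"
        using side_turn_sign(1)[of "s - 1" u t1] side_turn_sign(2)[of "s - 1" u t2] s(2) t2(1,2) u by auto
      hence "side a b c1 < 0" "side a b c2 > 0" using s(3) u(3) t1 t2(3) by simp_all
      thus False using nosep by (simp add: zero_le_mult_iff)
    qed
    ultimately have "s < t2" by simp
    hence "d * s < d * t2" using dpos by simp
    hence "of_int n < of_int r + (1::real)" using n r(2) by linarith
    hence "n \<le> r" by linarith
    hence "nat n \<in> {1..nat r}" using n1 by (auto simp: nat_mono)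
    moreover have "a = turn ((x0 + real (nat n)) / d)"
    proof -
      have "s = (x0 + of_int n) / d" using n dpos by (simp add: field_simps)
      thus ?thesis using s(3) n1 by simp
    qed
    ultimately have "a \<in> SA" unfolding SA_def by blast
    thus ?thesis using g a(1,3) ab by blast
  qed
  then obtain \<phi> where \<phi>: "\<And>b. b \<in> SB \<Longrightarrow> \<phi> b \<in> SA \<and> (\<exists>g\<in>circle // R. \<phi> b \<in> g \<and> b \<in> g \<and> \<phi> b \<noteq> b \<and> (\<forall>z\<in>g. side (\<phi> b) b z \<ge> 0))"
    by metis
  \<comment> \<open>In its class \<open>b\<close> is the next point after \<open>a\<close>, hence
    determined by \<open>a\<close>: for two candidates both signs are nonnegative, while
    \<open>side\<close> is antisymmetric in them.\<close>
  have "inj_on \<phi> SB"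
  proof
    fix b b' assume bb: "b \<in> SB" "b' \<in> SB" "\<phi> b = \<phi> b'"
    define a where "a = \<phi> b"
    obtain g where g: "g \<in> circle // R" "a \<in> g" "b \<in> g" "a \<noteq> b" "\<forall>z\<in>g. side a b z \<ge> 0"
      using \<phi>[OF bb(1)] unfolding a_def by blast
    obtain g' where g': "g' \<in> circle // R" "a \<in> g'" "b' \<in> g'" "a \<noteq> b'" "\<forall>z\<in>g'. side a b' z \<ge> 0"
      using \<phi>[OF bb(2)] unfolding a_def bb(3) by blast
    have gg: "g = g'" using class_unique[OF lam g(1) g'(1) g(2) g'(2)] .
    have "side a b b' \<ge> 0" "side a b' b \<ge> 0" using g g' gg by auto
    hence "side a b b' = 0" by (simp add: side_rotate[of a b' b])
    moreover have "a \<in> circle" "b \<in> circle" "b' \<in> circle" using class_subset[OF lam g(1)] g(2,3) g'(3) gg by blast+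
    ultimately show "b = b'" using side_eq_0_circle[of a b b'] g(4) g'(4) by auto
  qed
  hence "card SB \<le> card SA" using \<phi> cardA(2) by (intro card_inj_on_le) auto
  thus False using cardA(1) cardB by simp
qed

lemma leaf_pullback:
  assumes R: "invariant_lamination d R" and d: "d \<ge> 1"
    and m: "A \<in> circle" "B \<in> circle" "closed_segment A B \<in> geolam_of R"
    and c: "c1 \<in> circle" "c2 \<in> circle" "side A B (sigma d c1) * side A B (sigma d c2) < 0"
  shows "\<exists>a\<in>circle. \<exists>b\<in>circle. closed_segment a b \<in> geolam_of R \<and> side a b c1 * side a b c2 < 0"
proof -
  obtain g x y where g: "g \<in> circle // R" "x \<in> g" "y \<in> g" "\<forall>z\<in>g. side x y z \<ge> 0"
    "(x = A \<and> y = B) \<or> (x = B \<and> y = A)"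
    using geolam_of_circle_leafE[OF invariant_lamination_lamination[OF R] m(3,1,2)] .
  have "side x y (sigma d c1) * side x y (sigma d c2) < 0"
    using c(3) g(5) side_swap[of A B] by auto
  hence "(side x y (sigma d c1) < 0 \<and> side x y (sigma d c2) > 0) \<or> (side x y (sigma d c2) < 0 \<and> side x y (sigma d c1) > 0)"
    by (auto simp: mult_less_0_iff)
  thus ?thesis
  proof
    assume "side x y (sigma d c1) < 0 \<and> side x y (sigma d c2) > 0"
    thus ?thesis using edge_pullback[OF R d g(1-4) c(1,2)] by blast
  next
    assume "side x y (sigma d c2) < 0 \<and> side x y (sigma d c1) > 0"
    hence "\<exists>a\<in>circle. \<exists>b\<in>circle. closed_segment a b \<in> geolam_of R \<and> side a b c2 * side a b c1 < 0"
      using edge_pullback[OF R d g(1-4) c(2,1)] by blast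
    thus ?thesis by (simp add: mult.commute)
  qed
qed

section \<open>Iterates of \<open>sigma\<close>, and images of gaps against leaves\<close>

lemma sigma_pow: "(sigma d ^^ k) z = z ^ (d ^ k)"
  by (induction k) (simp_all add: sigma_def power_mult[symmetric] mult.commute)

lemma sigma_pow_circle: "z \<in> circle \<Longrightarrow> (sigma d ^^ k) z \<in> circle"
  by (simp add: sigma_pow norm_power)

lemma leaf_image_pow:
  assumes "invariant_lamination d R" "closed_segment a b \<in> geolam_of R" "a \<in> circle" "b \<in> circle"
  shows "closed_segment ((sigma d ^^ k) a) ((sigma d ^^ k) b) \<in> geolam_of R"
proof (induction k)
  case (Suc k)
  thus ?case using leaf_image[OF assms(1) Suc] sigma_pow_circle assms(3,4) by simp
qed (use assms in simp)

lemma leaf_pullback_pow: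
  assumes R: "invariant_lamination d R" and d: "d \<ge> 1"
    and m: "A \<in> circle" "B \<in> circle" "closed_segment A B \<in> geolam_of R"
    and c: "c1 \<in> circle" "c2 \<in> circle" "side A B ((sigma d ^^ k) c1) * side A B ((sigma d ^^ k) c2) < 0"
  shows "\<exists>a\<in>circle. \<exists>b\<in>circle. closed_segment a b \<in> geolam_of R \<and> side a b c1 * side a b c2 < 0"
  using m c(3)
proof (induction k arbitrary: A B)
  case 0
  have "side A B c1 * side A B c2 < 0" using 0(4) by simp
  thus ?case using 0(1-3) by blast
next
  case (Suc k)
  obtain a b where "a \<in> circle" "b \<in> circle" "closed_segment a b \<in> geolam_of R"
    "side a b ((sigma d ^^ k) c1) * side a b ((sigma d ^^ k) c2) < 0"
    using leaf_pullback[OF R d Suc.prems(1-3) sigma_pow_circle[OF c(1)] sigma_pow_circle[OF c(2)]] Suc.prems(4)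
    unfolding funpow.simps o_apply by blast
  thus ?case using Suc.IH by blast
qed

text \<open>A separating leaf would pull back to a leaf with \<open>c1\<close> and \<open>c2\<close>
  strictly on opposite sides, which no gap allows. The conclusion is weak because the image of
  \<open>c2\<close> may be an endpoint of the leaf.\<close>

theorem gap_image_one_side:
  assumes R: "invariant_lamination d R" and d: "d \<ge> 1" and U: "U \<in> gaps (geolam_of R)"
    and AB: "A \<in> circle" "B \<in> circle" "closed_segment A B \<in> geolam_of R"
    and c: "c1 \<in> basis U" "c2 \<in> basis U" "side A B ((sigma d ^^ k) c1) > 0"
  shows "side A B ((sigma d ^^ k) c2) \<ge> 0"
proof (rule ccontr)
  assume "\<not> ?thesis"
  hence neg: "side A B ((sigma d ^^ k) c1) * side A B ((sigma d ^^ k) c2) < 0"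
    using c(3) by (simp add: mult_pos_neg)
  have cU: "c1 \<in> circle" "c2 \<in> circle" "c1 \<in> U" "c2 \<in> U" using c(1,2) by (auto simp: basis_def)
  obtain a b where ab: "a \<in> circle" "b \<in> circle" "closed_segment a b \<in> geolam_of R" "side a b c1 * side a b c2 < 0"
    using leaf_pullback_pow[OF R d AB cU(1,2) neg] by blast
  have "a \<noteq> b" using ab(4) by auto
  note s = gap_leaf_side[OF geolamination_geolam_of[OF invariant_lamination_lamination[OF R]] U ab(1,2) this ab(3)]
  hence "side a b c1 * side a b c2 \<ge> 0" using cU(3,4) by (auto simp: mult_nonpos_nonpos)
  thus False using ab(4) by simp
qed

lemma side_cycle: "side b c a = side a b c"
  by (simp add: side_def algebra_simps)

section \<open>Thresholds in place of sequences, and pinning of nearby chords\<close>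

lemma q_geolaminationE:
  assumes "M \<in> q_geolaminations d"
  obtains R where "invariant_lamination d R" "M = geolam_of R" "geolamination M"
proof -
  obtain R where "invariant_lamination d R" "M = geolam_of R"
    using assms unfolding q_geolaminations_def by blast
  thus thesis using that geolamination_geolam_of[OF invariant_lamination_lamination] by blast
qed

lemma q_geolamination: "M \<in> q_geolaminations d \<Longrightarrow> geolamination M"
  by (erule q_geolaminationE) simp

lemma hausdorff_dist_nonneg:
  assumes "bounded A" "A \<noteq> {}" "B \<noteq> {}"
  shows "0 \<le> hausdorff_dist A B"
proof (rule ccontr)
  assume "\<not> ?thesis"
  hence neg: "hausdorff_dist A B < 0" by simp
  obtain a where "a \<in> A" using assms(2) by blast
  then obtain b where "dist a b < 0" using hausdorff_dist_lessD[OF neg assms(1,3)] by blast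
  thus False using zero_le_dist[of a b] by linarith
qed

lemma solid_dist_nonneg: "geolamination M \<Longrightarrow> geolamination L \<Longrightarrow> 0 \<le> hausdorff_dist (solid M) (solid L)"
  by (intro hausdorff_dist_nonneg compact_imp_bounded compact_solid solid_nonempty)

lemma gap_dist_nonneg:
  "geolamination M \<Longrightarrow> U \<in> gaps M \<Longrightarrow> geolamination L \<Longrightarrow> G \<in> gaps L \<Longrightarrow> 0 \<le> hausdorff_dist U G"
  using hausdorff_dist_nonneg compact_imp_bounded[OF gap_compact] gap_nonempty by metis

text \<open>A threshold can be combined with the other smallness conditions by \<open>min\<close>.
  If none existed, failures at \<open>1 / real (Suc n)\<close> would form sequences contradicting
  persistence; their convergence uses that the distances are nonnegative.\<close>

lemma persistent_edge_iff:
  assumes L: "geolamination L" and H: "H \<in> gaps L"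
  shows "persistent_edge d L H l \<longleftrightarrow>
    (\<exists>\<delta>>0. \<forall>M\<in>q_geolaminations d. \<forall>U\<in>gaps M.
       hausdorff_dist (solid M) (solid L) < \<delta> \<longrightarrow> hausdorff_dist U H < \<delta> \<longrightarrow> l \<in> edges U)"
    (is "?lhs \<longleftrightarrow> ?rhs")
proof
  assume lhs: ?lhs
  show ?rhs
  proof (rule ccontr)
    assume none: "\<not> ?rhs"
    have "\<exists>M U. M \<in> q_geolaminations d \<and> U \<in> gaps M \<and> hausdorff_dist (solid M) (solid L) < 1 / real (Suc n) \<and>
       hausdorff_dist U H < 1 / real (Suc n) \<and> l \<notin> edges U" for n
    proof -
      have "1 / real (Suc n) > 0" by simp
      thus ?thesis using none by blast
    qed
    then obtain M U where MU: "\<And>n. M n \<in> q_geolaminations d" "\<And>n. U n \<in> gaps (M n)"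
      "\<And>n. hausdorff_dist (solid (M n)) (solid L) < 1 / real (Suc n)"
      "\<And>n. hausdorff_dist (U n) H < 1 / real (Suc n)" "\<And>n. l \<notin> edges (U n)"
      by metis
    have "hausdorff_tendsto (\<lambda>n. solid (M n)) (solid L)" unfolding hausdorff_tendsto_def
    proof (rule LIMSEQ_inverse_Suc_dist)
      show "dist (hausdorff_dist (solid (M n)) (solid L)) 0 < 1 / real (Suc n) \<or> 
        dist 0 (hausdorff_dist (solid (M n)) (solid L)) < 1 / real (Suc n)" for n
        using MU(3)[of n] solid_dist_nonneg[OF q_geolamination[OF MU(1)[of n]] L] by simp
    qed
    moreover have "hausdorff_tendsto U H" unfolding hausdorff_tendsto_def
    proof (rule LIMSEQ_inverse_Suc_dist)
      show "dist (hausdorff_dist (U n) H) 0 < 1 / real (Suc n) \<or> dist 0 (hausdorff_dist (U n) H) < 1 / real (Suc n)" for n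
        using MU(4)[of n] gap_dist_nonneg[OF q_geolamination[OF MU(1)[of n]] MU(2)[of n] L H] by simp
    qed
    ultimately have "\<forall>\<^sub>F n in sequentially. l \<in> edges (U n)"
      using lhs MU(1,2) unfolding persistent_edge_def by blast
    then obtain n where "l \<in> edges (U n)" using eventually_happens'[OF sequentially_bot] by blast
    thus False using MU(5) by blast
  qed
next
  assume ?rhs
  then obtain \<delta> where \<delta>: "\<delta> > 0" "\<And>M U. M \<in> q_geolaminations d \<Longrightarrow> U \<in> gaps M \<Longrightarrow>
       hausdorff_dist (solid M) (solid L) < \<delta> \<Longrightarrow> hausdorff_dist U H < \<delta> \<Longrightarrow> l \<in> edges U"
    by blast
  show ?lhs unfolding persistent_edge_def
  proof (intro allI impI)
    fix M U assume MU: "\<forall>i. M i \<in> q_geolaminations d" "hausdorff_tendsto (\<lambda>i. solid (M i)) (solid L)"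
      "\<forall>i. U i \<in> gaps (M i)" "hausdorff_tendsto U H"
    have "\<forall>\<^sub>F i in sequentially. hausdorff_dist (solid (M i)) (solid L) < \<delta>"
      "\<forall>\<^sub>F i in sequentially. hausdorff_dist (U i) H < \<delta>"
      using MU(2,4) \<delta>(1) unfolding hausdorff_tendsto_def by (auto intro: order_tendstoD(2))
    thus "\<forall>\<^sub>F i in sequentially. l \<in> edges (U i)"
    proof eventually_elim
      case (elim i)
      thus ?case using \<delta>(2) MU(1,3) by blast
    qed
  qed
qed

text \<open>The two chords meet, and the path from \<open>P\<close> to \<open>Q\<close> through the
  common point is no longer than both chords together.\<close>

lemma crossing_chords_dist:
  assumes "P \<in> circle" "P' \<in> circle" "P \<noteq> P'" "Q \<in> circle" "Q' \<in> circle"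
    "side P' P Q * side P' P Q' \<le> 0"
  shows "dist P Q \<le> dist P P' + dist Q Q'"
proof -
  have "connected (side P' P ` closed_segment Q Q')"
    by (intro connected_continuous_image continuous_intros connected_segment)
  moreover have "side P' P Q \<in> side P' P ` closed_segment Q Q'" "side P' P Q' \<in> side P' P ` closed_segment Q Q'"
    by auto
  moreover have "(side P' P Q \<le> 0 \<and> 0 \<le> side P' P Q') \<or> (side P' P Q' \<le> 0 \<and> 0 \<le> side P' P Q)"
    using assms(6) by (auto simp: mult_le_0_iff)
  ultimately have "0 \<in> side P' P ` closed_segment Q Q'"
    by (meson connected_contains_Icc atLeastAtMost_iff subsetD)
  then obtain p where p: "p \<in> closed_segment Q Q'" "side P' P p = 0" by auto
  have "norm p \<le> 1" using chord_subset_disk[OF assms(4,5)] p(1) by auto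
  hence "p \<in> closed_segment P' P" using side_eq_0_disk[OF assms(2,1) assms(3)[symmetric] p(2)] by blast
  hence "dist P p \<le> dist P P'"
    using segment_bound(2)[of p P' P] by (simp add: dist_norm norm_minus_commute)
  moreover have "dist p Q \<le> dist Q Q'"
    using segment_bound(1)[OF p(1)] by (simp add: dist_norm norm_minus_commute)
  ultimately show ?thesis using dist_triangle[of P Q p] by linarith
qed

text \<open>If \<open>X'\<close> differed from \<open>X\<close>, a cyclic permutation of the signs
  would put \<open>Y\<close> and \<open>Y'\<close> weakly on opposite sides of the chord
  \<open>X X'\<close>. Then the short chords \<open>X X'\<close> and \<open>Y Y'\<close> meet, so
  \<open>X\<close> and \<open>Y\<close> are too close. The other ends are symmetric.\<close>

lemma nested_close_chords:
  assumes c: "X \<in> circle" "Y \<in> circle" "X' \<in> circle" "Y' \<in> circle"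
    and s: "side X Y X' \<ge> 0" "side X Y Y' \<ge> 0" "side X' Y' X \<ge> 0" "side X' Y' Y \<ge> 0"
    and d: "dist X X' < dist X Y / 2" "dist Y Y' < dist X Y / 2"
  shows "X' = X" "Y' = Y"
proof -
  have lt: "dist X X' + dist Y Y' < dist X Y" using d by linarith
  show "X' = X"
  proof (rule ccontr)
    assume ne: "X' \<noteq> X"
    have "side X' X Y \<ge> 0" "side X' X Y' \<le> 0"
      using s(1,3) side_cycle[of X Y X'] side_rotate[of X' X Y'] by simp_all
    hence "side X' X Y * side X' X Y' \<le> 0" by (simp add: mult_nonneg_nonpos)
    thus False using crossing_chords_dist[OF c(1,3) _ c(2,4)] ne lt by force
  qed
  show "Y' = Y"
  proof (rule ccontr)
    assume ne: "Y' \<noteq> Y"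
    have "side Y' Y X \<le> 0" "side Y' Y X' \<ge> 0"
      using s(2,4) side_cycle[of Y' Y X] side_rotate[of X Y' Y] side_cycle[of Y' Y X'] by simp_all
    hence "side Y' Y X * side Y' Y X' \<le> 0" by (simp add: mult_nonpos_nonneg)
    hence "dist Y X \<le> dist Y Y' + dist X X'" using crossing_chords_dist[OF c(2,4) _ c(1,3)] ne by force
    thus False using lt by (simp add: dist_commute)
  qed
qed

text \<open>The point \<open>c\<close> tells on which side of \<open>X Y\<close> the image of
  \<open>U\<close> lies, and \<open>v\<close> tells on which side of the image of \<open>a b\<close>
  the gap \<open>V\<close> lies. \<open>X Y\<close> is kept free of \<open>L\<close> so as to allow
  two uses: a persistent edge of a gap \<open>V\<close> near \<open>H\<close>, and
  \<open>a b\<close> itself with \<open>V = U\<close>.\<close>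

theorem edge_pinned:
  assumes R: "invariant_lamination d R" "d \<ge> 1" and U: "U \<in> gaps (geolam_of R)" and V: "V \<in> gaps (geolam_of R)"
    and XY: "X \<in> circle" "Y \<in> circle" "closed_segment X Y \<in> geolam_of R" "X \<in> V" "Y \<in> V"
    and ab: "a \<in> basis U" "b \<in> basis U" "closed_segment a b \<in> geolam_of R"
    and c: "c \<in> basis U" "side X Y ((sigma d ^^ k) c) > 0"
    and v: "v \<in> V" "side ((sigma d ^^ k) a) ((sigma d ^^ k) b) v > 0"
    and d: "dist X ((sigma d ^^ k) a) < dist X Y / 2" "dist Y ((sigma d ^^ k) b) < dist X Y / 2"
  shows "(sigma d ^^ k) a = X" "(sigma d ^^ k) b = Y"
proof -
  define f where "f = sigma d ^^ k"
  note d = d[folded f_def] and v = v[folded f_def] and c = c[folded f_def]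
  have abc: "a \<in> circle" "b \<in> circle" using ab by (auto simp: basis_def)
  have fc: "f a \<in> circle" "f b \<in> circle" unfolding f_def by (intro sigma_pow_circle abc)+
  note lam = geolamination_geolam_of[OF invariant_lamination_lamination[OF R(1)]]
  have 1: "side X Y (f a) \<ge> 0" "side X Y (f b) \<ge> 0"
    using gap_image_one_side[OF R U XY(1-3) c(1), of _ k] c(2) ab(1,2) unfolding f_def by blast+
  have leaf: "closed_segment (f a) (f b) \<in> geolam_of R"
    unfolding f_def by (rule leaf_image_pow[OF R(1) ab(3) abc])
  have ne: "f a \<noteq> f b" using v(2) by auto
  have "\<forall>z\<in>V. side (f a) (f b) z \<ge> 0"
    using gap_leaf_side[OF lam V fc ne leaf] v by force
  hence 2: "side (f a) (f b) X \<ge> 0" "side (f a) (f b) Y \<ge> 0" using XY(4,5) by blast+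
  show "(sigma d ^^ k) a = X" "(sigma d ^^ k) b = Y"
    using nested_close_chords[OF XY(1,2) fc 1 2 d] by (simp_all add: f_def)
qed

section \<open>Stability and isolation estimates\<close>

lemma side_near:
  assumes "side x y z > 0"
  shows "\<exists>\<epsilon>>0. \<forall>x' y' z'. dist x x' < \<epsilon> \<longrightarrow> dist y y' < \<epsilon> \<longrightarrow> dist z z' < \<epsilon> \<longrightarrow> side x' y' z' > 0"
proof (rule ccontr)
  assume none: "\<not> ?thesis"
  have "\<exists>x' y' z'. dist x x' < 1 / real (Suc n) \<and> dist y y' < 1 / real (Suc n) \<and> dist z z' < 1 / real (Suc n) \<and> side x' y' z' \<le> 0" for n
  proof -
    have "1 / real (Suc n) > 0" by simp
    thus ?thesis using none by (meson not_le_imp_less)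
  qed
  then obtain p q r where S: "\<And>n. dist x (p n) < 1 / real (Suc n)" "\<And>n. dist y (q n) < 1 / real (Suc n)"
    "\<And>n. dist z (r n) < 1 / real (Suc n)" "\<And>n. side (p n) (q n) (r n) \<le> 0"
    by metis
  have "p \<longlonglongrightarrow> x" "q \<longlonglongrightarrow> y" "r \<longlonglongrightarrow> z" using S by (auto intro: LIMSEQ_inverse_Suc_dist)
  hence "(\<lambda>n. side (p n) (q n) (r n)) \<longlonglongrightarrow> side x y z" by (rule tendsto_side)
  hence "side x y z \<le> 0" using S(4) by (intro LIMSEQ_le_const2) auto
  thus False using assms by simp
qed

lemma sigma_pow_uniform:
  assumes "e > 0"
  shows "\<exists>\<epsilon>>0. \<forall>z\<in>circle. \<forall>z'\<in>circle. dist z' z < \<epsilon> \<longrightarrow> dist ((sigma d ^^ k) z') ((sigma d ^^ k) z) < e"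
proof -
  have "continuous_on circle (sigma d ^^ k)"
    unfolding sigma_pow by (intro continuous_intros)
  hence "uniformly_continuous_on circle (sigma d ^^ k)"
    by (rule compact_uniformly_continuous) simp
  thus ?thesis using assms unfolding uniformly_continuous_on_def by blast
qed

lemma finite_isolated:
  fixes z :: complex
  assumes "finite S"
  shows "\<exists>\<epsilon>>0. \<forall>w\<in>S. dist w z < \<epsilon> \<longrightarrow> w = z"
proof -
  obtain e where "e > 0" "\<And>w. w \<in> S \<Longrightarrow> w \<noteq> z \<Longrightarrow> e \<le> dist z w"
    using finite_set_avoid[OF assms] by blast
  thus ?thesis by (metis dist_commute not_le)
qed

text \<open>Fibres of a power map are finite. This turns equality of images of nearby endpoints into
  equality of the endpoints.\<close>

lemma sigma_pow_locally_inj: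
  assumes "d \<ge> 1"
  shows "\<exists>\<epsilon>>0. \<forall>w. dist w z < \<epsilon> \<longrightarrow> (sigma d ^^ k) w = (sigma d ^^ k) z \<longrightarrow> w = z"
  using finite_isolated[OF finite_nth_roots[of "d ^ k" "z ^ (d ^ k)"], of z] assms
  by (auto simp: sigma_pow)

text \<open>Fixed points on the circle are roots of unity for the exponent \<open>d ^ k - 1\<close>,
  which is positive because \<open>d \<ge> 2\<close> and \<open>k > 0\<close>; so there are finitely
  many.\<close>

lemma sigma_pow_fixed_isolated:
  assumes "d \<ge> 2" "k > 0"
  shows "\<exists>\<epsilon>>0. \<forall>w\<in>circle. dist w z < \<epsilon> \<longrightarrow> (sigma d ^^ k) w = w \<longrightarrow> w = z"
proof -
  have "d ^ k \<ge> 2" using assms by (metis order_trans self_le_power less_eq_Suc_le numeral_2_eq_2 Suc_leD One_nat_def)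
  then obtain n where n: "d ^ k = Suc n" "n > 0" by (cases "d ^ k") auto
  have "w ^ n = 1" if "w \<in> circle" "(sigma d ^^ k) w = w" for w
  proof -
    have "w * w ^ n = w * 1" "w \<noteq> 0" using that n by (auto simp: sigma_pow)
    thus ?thesis using mult_left_cancel by blast
  qed
  moreover obtain \<epsilon> where "\<epsilon> > 0" "\<forall>w\<in>{w. w ^ n = 1}. dist w z < \<epsilon> \<longrightarrow> w = z"
    using finite_isolated[OF finite_nth_roots[OF n(2)]] by blast
  ultimately show ?thesis by blast
qed

text \<open>On the circle, distance at least \<open>e\<close> from \<open>v\<close> means
  \<open>inner v y \<le> 1 - e\<^sup>2 / 2\<close>, a half-plane condition inherited by the hull.
  The bound \<open>e\<^sup>2 / 2\<close> is the height of the cap that is cut off.\<close>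

lemma hull_point_near_circle:
  assumes "K \<subseteq> circle" "x \<in> convex hull K" "v \<in> circle" "dist x v < e\<^sup>2 / 2" "e > 0"
  obtains y where "y \<in> K" "dist y v < e"
proof (rule ccontr)
  assume none: "\<not> thesis"
  have vv: "inner v v = 1" using assms(3) by (simp add: dot_square_norm)
  have "K \<subseteq> {y. inner v y \<le> 1 - e\<^sup>2 / 2}"
  proof
    fix y assume y: "y \<in> K"
    hence "inner y y = 1" using assms(1) by (auto simp: dot_square_norm)
    have "e \<le> norm (y - v)" using none that y by (force simp: dist_norm)
    hence "e\<^sup>2 \<le> (norm (y - v))\<^sup>2" using assms(5) by (intro power_mono) auto
    also have "\<dots> = 2 - 2 * inner v y"
      using vv \<open>inner y y = 1\<close> by (simp add: power2_norm_eq_inner inner_simps inner_commute)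
    finally show "y \<in> {y. inner v y \<le> 1 - e\<^sup>2 / 2}" by simp
  qed
  hence "convex hull K \<subseteq> {y. inner v y \<le> 1 - e\<^sup>2 / 2}"
    by (intro hull_minimal convex_halfspace_le)
  hence "inner v x \<le> 1 - e\<^sup>2 / 2" using assms(2) by blast
  moreover have "inner v x = 1 - inner v (v - x)" using vv by (simp add: inner_simps)
  moreover have "inner v (v - x) \<le> norm v * norm (v - x)" by (rule norm_cauchy_schwarz)
  ultimately show False using assms(3,4) by (simp add: dist_norm norm_minus_commute)
qed

text \<open>Closeness of gaps yields a nearby point of the other gap, not a basis point. As that gap
  is the hull of its basis, the cap estimate supplies one, at the price of the quadratic
  bound.\<close>

lemma basis_close:
  assumes L: "geolamination L" "G \<in> gaps L" and M: "geolamination M" "U \<in> gaps M"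
    and e: "e > 0" "hausdorff_dist U G < e\<^sup>2 / 2"
  shows "g \<in> basis G \<Longrightarrow> \<exists>u\<in>basis U. dist u g < e" and "u \<in> basis U \<Longrightarrow> \<exists>g\<in>basis G. dist g u < e"
proof -
  note cl = gap_close_point[OF L M e(2)]
  have bc: "basis S \<subseteq> circle" for S by (auto simp: basis_def)
  show "\<exists>u\<in>basis U. dist u g < e" if g: "g \<in> basis G"
  proof -
    have gG: "g \<in> G" "g \<in> circle" using g by (auto simp: basis_def)
    obtain x where x: "x \<in> U" "dist g x < e\<^sup>2 / 2" using cl(1)[OF gG(1)] by blast
    have "x \<in> convex hull (basis U)" "dist x g < e\<^sup>2 / 2"
      using x gap_hull_basis[OF M] by (simp_all add: dist_commute)
    thus ?thesis using hull_point_near_circle[OF bc _ gG(2) _ e(1)] by blast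
  qed
  show "\<exists>g\<in>basis G. dist g u < e" if u: "u \<in> basis U"
  proof -
    have uU: "u \<in> U" "u \<in> circle" using u by (auto simp: basis_def)
    obtain x where x: "x \<in> G" "dist u x < e\<^sup>2 / 2" using cl(2)[OF uU(1)] by blast
    have "x \<in> convex hull (basis G)" "dist x u < e\<^sup>2 / 2"
      using x gap_hull_basis[OF L] by (simp_all add: dist_commute)
    thus ?thesis using hull_point_near_circle[OF bc _ uU(2) _ e(1)] by blast
  qed
qed

section \<open>Oriented edges and the half-planes of a gap\<close>

lemma edge_orientE:
  assumes "geolamination L" "H \<in> gaps L" "l \<in> edges H"
  obtains A B where "A \<in> circle" "B \<in> circle" "A \<noteq> B" "l = closed_segment A B" "A \<in> H" "B \<in> H"
    "\<forall>z\<in>H. side A B z \<ge> 0"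
proof -
  obtain a b where ab: "a \<in> circle" "b \<in> circle" "a \<noteq> b" "closed_segment a b \<subseteq> frontier H" "l = closed_segment a b"
    using edgesE[OF assms(3)] .
  have H: "a \<in> H" "b \<in> H" using ab(4) gap_frontier_subset[OF assms(1,2)] by auto
  show thesis
    using frontier_one_side[OF gap_convex[OF assms(1,2)] H ab(3,4)]
  proof
    assume "\<forall>z\<in>H. side a b z \<ge> 0"
    thus thesis using that[OF ab(1-3,5) H] by blast
  next
    assume "\<forall>z\<in>H. side a b z \<le> 0"
    hence "\<forall>z\<in>H. side b a z \<ge> 0" by (simp add: side_swap[of b a])
    moreover have "l = closed_segment b a" using ab(5) by (simp add: closed_segment_commute)
    ultimately show thesis using that[OF ab(2,1) ab(3)[symmetric] _ H(2,1)] by blast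
  qed
qed

text \<open>A gap has interior points and is the hull of its basis, so the basis cannot lie on the
  line of an edge.\<close>

lemma gap_basis_strict:
  assumes "geolamination L" "H \<in> gaps L" "A \<in> circle" "B \<in> circle" "A \<noteq> B" "closed_segment A B \<in> edges H"
    "\<forall>z\<in>H. side A B z \<ge> 0"
  obtains C where "C \<in> basis H" "side A B C > 0"
proof (rule ccontr)
  assume none: "\<not> thesis"
  have leaf: "closed_segment A B \<in> L" using gap_edge_leaf[OF assms(1,2,6)] .
  obtain z where z: "z \<in> interior H" using gap_interior(1)[OF assms(1,2)] by blast
  have zH: "z \<in> H" using z interior_subset by blast
  have "side A B z > 0"
    using gap_leaf_side[OF assms(1-5) leaf] z assms(7) zH by force
  moreover have "side A B z \<le> 0"
  proof -
    have "basis H \<subseteq> {z. side A B z \<le> 0}" using none that by force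
    hence "convex hull (basis H) \<subseteq> {z. side A B z \<le> 0}" by (intro hull_minimal convex_side(3))
    thus ?thesis using zH gap_hull_basis[OF assms(1,2)] by auto
  qed
  ultimately show False by simp
qed

text \<open>The segment from an interior point of \<open>H\<close> to \<open>y\<close> leaves
  \<open>H\<close> across an edge, and \<open>side\<close> is affine along it: positive, then 0,
  then negative.\<close>

lemma outside_edge:
  assumes "geolamination L" "H \<in> gaps L" "y \<in> circle" "y \<notin> H"
  obtains A B where "A \<in> basis H" "B \<in> basis H" "A \<noteq> B" "closed_segment A B \<in> edges H"
    "\<forall>z\<in>H. side A B z \<ge> 0" "side A B y < 0"
proof -
  obtain z0 where z0: "z0 \<in> interior H" using gap_interior(1)[OF assms(1,2)] by blast
  have z0H: "z0 \<in> H" using z0 interior_subset by blast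
  have "closed_segment z0 y \<inter> frontier H \<noteq> {}"
    using z0H assms(4) by (intro connected_Int_frontier) auto
  then obtain q where q: "q \<in> closed_segment z0 y" "q \<in> frontier H" by blast
  have qH: "q \<in> H" using q(2) gap_frontier_subset[OF assms(1,2)] by blast
  have ne: "q \<noteq> y" "q \<noteq> z0" using qH assms(4) q(2) z0 by (auto simp: frontier_def)
  have "z0 \<in> ball 0 1" using z0 gap_interior(2)[OF assms(1,2)] by blast
  hence "open_segment z0 y \<subseteq> ball 0 1"
    using in_interior_closure_convex_segment[of "cball 0 1" z0 y] assms(3) by auto
  hence qb: "q \<in> ball 0 1" using open_segment_cases[OF q(1)] ne by blast
  obtain a b where ab: "a \<in> circle" "b \<in> circle" "a \<noteq> b" "closed_segment a b \<in> L" "closed_segment a b \<in> edges H" "q \<in> closed_segment a b"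
    using gap_frontier_leaf[OF assms(1,2) q(2) qb] .
  obtain A B where AB: "A \<in> circle" "B \<in> circle" "A \<noteq> B" "closed_segment a b = closed_segment A B" "A \<in> H" "B \<in> H"
    "\<forall>z\<in>H. side A B z \<ge> 0"
    using edge_orientE[OF assms(1,2) ab(5)] .
  have "closed_segment A B \<in> L" using ab(4) AB(4) by metis
  hence s0: "side A B z0 > 0"
    using gap_leaf_side[OF assms(1,2) AB(1-3)] z0 AB(7) z0H by force
  have "q \<in> closed_segment A B" using ab(6) AB(4) by metis
  hence sq: "side A B q = 0" by (rule closed_segment_side)
  obtain t where t: "q = (1 - t) *\<^sub>R z0 + t *\<^sub>R y" "0 \<le> t" "t \<le> 1"
    using q(1) by (auto simp: in_segment)
  have "t \<noteq> 1" using t(1) ne(1) by auto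
  hence "(1 - t) * side A B z0 > 0" using s0 t(3) by simp
  moreover have "(1 - t) * side A B z0 + t * side A B y = 0" using sq t(1) by (simp add: side_convex_comb)
  ultimately have "t * side A B y < 0" by linarith
  hence "side A B y < 0" using t(2) by (simp add: mult_less_0_iff)
  moreover have "closed_segment A B \<in> edges H" using ab(5) AB(4) by metis
  ultimately show thesis using that AB by (simp add: basis_def)
qed

section \<open>Persistent edges\<close>

lemma edge_ends_basis:
  assumes "geolamination L" "G \<in> gaps L" "closed_segment a b \<in> edges G" "a \<in> circle" "b \<in> circle"
  shows "a \<in> basis G" "b \<in> basis G"
  using subset_trans[OF edge_frontier[OF assms(3)] gap_frontier_subset[OF assms(1,2)]] assms(4,5)
  by (auto simp: basis_def)

theorem persistent_edge_pullback:
  assumes d: "d \<ge> 1" and L: "geolamination L" and G: "G \<in> gaps L" and H: "H \<in> gaps L"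
    and ab: "a \<in> circle" "b \<in> circle" "a \<noteq> b" "closed_segment a b \<in> edges G"
    and img: "basis H = (sigma d ^^ k) ` basis G"
    and AB: "A = (sigma d ^^ k) a" "B = (sigma d ^^ k) b" "A \<noteq> B" "closed_segment A B \<in> edges H"
      "\<forall>z\<in>H. side A B z \<ge> 0"
    and pers: "persistent_edge d L H (closed_segment A B)"
  shows "persistent_edge d L G (closed_segment a b)"
proof -
  define f where "f = sigma d ^^ k"
  have fAB: "f a = A" "f b = B" using AB(1,2) by (simp_all add: f_def)
  have ABc: "A \<in> circle" "B \<in> circle" unfolding AB(1,2) by (intro sigma_pow_circle ab(1,2))+
  obtain \<delta>0 where \<delta>0: "\<delta>0 > 0" "\<And>M U. M \<in> q_geolaminations d \<Longrightarrow> U \<in> gaps M \<Longrightarrow>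
       hausdorff_dist (solid M) (solid L) < \<delta>0 \<Longrightarrow> hausdorff_dist U H < \<delta>0 \<Longrightarrow> closed_segment A B \<in> edges U"
    using pers unfolding persistent_edge_iff[OF L H] by blast
  obtain C where C: "C \<in> basis H" "side A B C > 0"
    using gap_basis_strict[OF L H ABc AB(3,4,5)] .
  have "C \<in> f ` basis G" using C(1) img by (simp add: f_def)
  then obtain c where c: "c \<in> basis G" "f c = C" by blast
  obtain \<epsilon>1 where \<epsilon>1: "\<epsilon>1 > 0"
    "\<And>x y z. dist A x < \<epsilon>1 \<Longrightarrow> dist B y < \<epsilon>1 \<Longrightarrow> dist C z < \<epsilon>1 \<Longrightarrow> side x y z > 0"
    using side_near[OF C(2)] by blast
  \<comment> \<open>\<open>\<epsilon>1\<close> preserves the sign at \<open>C\<close>;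
    \<open>dist A B / 2\<close> is the closeness that \<open>edge_pinned\<close> demands.\<close>
  define \<eta> where "\<eta> = min \<epsilon>1 (dist A B / 2)"
  have \<eta>: "\<eta> > 0" using \<epsilon>1(1) AB(3) by (simp add: \<eta>_def)
  obtain \<epsilon>2 where \<epsilon>2': "\<epsilon>2 > 0"
    "\<forall>z\<in>circle. \<forall>z'\<in>circle. dist z' z < \<epsilon>2 \<longrightarrow> dist (f z') (f z) < \<eta>"
    using sigma_pow_uniform[OF \<eta>, where d = d and k = k, folded f_def] by (elim exE conjE)
  note \<epsilon>2 = \<epsilon>2'(1) \<epsilon>2'(2)[rule_format]
  obtain \<epsilon>3 where \<epsilon>3': "\<epsilon>3 > 0" "\<forall>w. dist w a < \<epsilon>3 \<longrightarrow> f w = f a \<longrightarrow> w = a"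
    using sigma_pow_locally_inj[OF d, where z = a and k = k, folded f_def] by (elim exE conjE)
  note \<epsilon>3 = \<epsilon>3'(1) \<epsilon>3'(2)[rule_format]
  obtain \<epsilon>4 where \<epsilon>4': "\<epsilon>4 > 0" "\<forall>w. dist w b < \<epsilon>4 \<longrightarrow> f w = f b \<longrightarrow> w = b"
    using sigma_pow_locally_inj[OF d, where z = b and k = k, folded f_def] by (elim exE conjE)
  note \<epsilon>4 = \<epsilon>4'(1) \<epsilon>4'(2)[rule_format]
  define \<epsilon> where "\<epsilon> = min \<epsilon>2 (min \<epsilon>3 \<epsilon>4)"
  have \<epsilon>: "\<epsilon> > 0" using \<epsilon>2(1) \<epsilon>3(1) \<epsilon>4(1) by (simp add: \<epsilon>_def)
  obtain \<delta>1 where \<delta>1: "\<delta>1 > 0" "\<And>M U. geolamination M \<Longrightarrow> U \<in> gaps M \<Longrightarrow> hausdorff_dist U G < \<delta>1 \<Longrightarrow>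
      \<exists>a'\<in>circle. \<exists>b'\<in>circle. a' \<noteq> b' \<and> closed_segment a' b' \<in> edges U \<and> dist a' a < \<epsilon> \<and> dist b' b < \<epsilon>"
    using close_edge[OF L G ab \<epsilon>] by blast
  \<comment> \<open>The gap \<open>V\<close> near \<open>H\<close> has to be within
    \<open>\<delta>0\<close>, to have \<open>A B\<close> as an edge, and within
    \<open>\<epsilon>1\<close>, to contain a point near \<open>C\<close> that shows on which side of
    the image leaf \<open>V\<close> lies.\<close>
  have "min \<delta>0 \<epsilon>1 > 0" using \<delta>0(1) \<epsilon>1(1) by simp
  then obtain \<delta>2 where \<delta>2: "\<delta>2 > 0" "\<And>M. geolamination M \<Longrightarrow> hausdorff_dist (solid M) (solid L) < \<delta>2 \<Longrightarrow>
      \<exists>V\<in>gaps M. hausdorff_dist V H < min \<delta>0 \<epsilon>1"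
    using exists_close_gap[OF L H] by blast
  \<comment> \<open>The last term is the quadratic bound of \<open>basis_close\<close>: it yields a
    basis point of \<open>U\<close> within \<open>\<epsilon>2\<close> of \<open>c\<close>.\<close>
  define \<delta> where "\<delta> = min (min \<delta>0 \<delta>1) (min \<delta>2 (\<epsilon>2\<^sup>2 / 2))"
  show ?thesis unfolding persistent_edge_iff[OF L G]
  proof (intro exI conjI ballI impI)
    show "\<delta> > 0" using \<delta>0(1) \<delta>1(1) \<delta>2(1) \<epsilon>2(1) by (simp add: \<delta>_def)
    fix M U assume M: "M \<in> q_geolaminations d" and U: "U \<in> gaps M"
      and near: "hausdorff_dist (solid M) (solid L) < \<delta>" "hausdorff_dist U G < \<delta>"
    obtain R where R: "invariant_lamination d R" "M = geolam_of R" "geolamination M"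
      using q_geolaminationE[OF M] .
    have "hausdorff_dist (solid M) (solid L) < \<delta>2" using near(1) by (simp add: \<delta>_def)
    then obtain V where V: "V \<in> gaps M" "hausdorff_dist V H < min \<delta>0 \<epsilon>1" using \<delta>2(2) R(3) by blast
    have eV: "closed_segment A B \<in> edges V" using \<delta>0(2)[OF M V(1)] near(1) V(2) by (simp add: \<delta>_def)
    have lAB: "closed_segment A B \<in> M" by (rule gap_edge_leaf[OF R(3) V(1) eV])
    have ABV: "A \<in> V" "B \<in> V" using edge_ends_basis[OF R(3) V(1) eV ABc] by (auto simp: basis_def)
    have CH: "C \<in> H" using C(1) by (simp add: basis_def)
    obtain v where v: "v \<in> V" "dist C v < min \<delta>0 \<epsilon>1" using gap_close_point(1)[OF L H R(3) V CH] by blast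
    have "hausdorff_dist U G < \<delta>1" using near(2) by (simp add: \<delta>_def)
    then obtain a' b' where ab': "a' \<in> circle" "b' \<in> circle" "closed_segment a' b' \<in> edges U"
      "dist a' a < \<epsilon>" "dist b' b < \<epsilon>"
      using \<delta>1(2)[OF R(3) U] by blast
    have abU: "a' \<in> basis U" "b' \<in> basis U" using edge_ends_basis[OF R(3) U ab'(3,1,2)] .
    have lab: "closed_segment a' b' \<in> M" by (rule gap_edge_leaf[OF R(3) U ab'(3)])
    have "hausdorff_dist U G < \<epsilon>2\<^sup>2 / 2" using near(2) by (simp add: \<delta>_def)
    then obtain c' where c': "c' \<in> basis U" "dist c' c < \<epsilon>2"
      using basis_close(1)[OF L G R(3) U \<epsilon>2(1) _ c(1)] by blast
    have cc: "c \<in> circle" "c' \<in> circle" using c(1) c'(1) by (auto simp: basis_def)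
    have df: "dist A (f a') < \<eta>" "dist B (f b') < \<eta>" "dist C (f c') < \<eta>"
      using \<epsilon>2(2)[OF ab(1) ab'(1)] \<epsilon>2(2)[OF ab(2) ab'(2)] \<epsilon>2(2)[OF cc c'(2)] ab'(4,5) fAB c(2)
      by (simp_all add: \<epsilon>_def dist_commute)
    have sc: "side A B (f c') > 0" using \<epsilon>1 df(3) by (simp add: \<eta>_def)
    have sv: "side (f a') (f b') v > 0" using \<epsilon>1(2) df(1,2) v(2) by (simp add: \<eta>_def)
    have "f a' = A" "f b' = B"
      using edge_pinned[OF R(1) d U[unfolded R(2)] V(1)[unfolded R(2)] ABc lAB[unfolded R(2)] ABV abU
          lab[unfolded R(2)] c'(1) sc[unfolded f_def] v(1) sv[unfolded f_def]] df(1,2)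
      by (simp_all add: f_def \<eta>_def)
    hence "a' = a" "b' = b" using \<epsilon>3(2) \<epsilon>4(2) ab'(4,5) fAB by (simp_all add: \<epsilon>_def)
    thus "closed_segment a b \<in> edges U" using ab'(3) by simp
  qed
qed

theorem persistent_fixed_edge:
  assumes d: "d \<ge> 2" and k: "k > 0" and L: "geolamination L" and H: "H \<in> gaps L"
    and AB: "A \<in> circle" "B \<in> circle" "A \<noteq> B" "closed_segment A B \<in> edges H" "\<forall>z\<in>H. side A B z \<ge> 0"
    and fixed: "(sigma d ^^ k) A = A" "(sigma d ^^ k) B = B" "(sigma d ^^ k) ` basis H = basis H"
  shows "persistent_edge d L H (closed_segment A B)"
proof -
  define f where "f = sigma d ^^ k"
  have fAB: "f A = A" "f B = B" using fixed(1,2) by (simp_all add: f_def)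
  have d1: "d \<ge> 1" using d by simp
  obtain C where C: "C \<in> basis H" "side A B C > 0"
    using gap_basis_strict[OF L H AB] .
  have "C \<in> f ` basis H" using C(1) fixed(3) by (simp add: f_def)
  then obtain c where c: "c \<in> basis H" "f c = C" by blast
  obtain \<epsilon>1 where \<epsilon>1: "\<epsilon>1 > 0"
    "\<And>x y z. dist A x < \<epsilon>1 \<Longrightarrow> dist B y < \<epsilon>1 \<Longrightarrow> dist C z < \<epsilon>1 \<Longrightarrow> side x y z > 0"
    using side_near[OF C(2)] by blast
  \<comment> \<open>With \<open>dist A B \<ge> 10 * \<eta>\<close> the nearby edge is longer than
    \<open>8 * \<eta>\<close>, and its ends move by less than \<open>2 * \<eta>\<close>, below half
    its length as pinning demands.\<close>
  define \<eta> where "\<eta> = min \<epsilon>1 (dist A B / 10)"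
  have \<eta>: "\<eta> > 0" using \<epsilon>1(1) AB(3) by (simp add: \<eta>_def)
  obtain \<epsilon>2 where \<epsilon>2': "\<epsilon>2 > 0"
    "\<forall>z\<in>circle. \<forall>z'\<in>circle. dist z' z < \<epsilon>2 \<longrightarrow> dist (f z') (f z) < \<eta>"
    using sigma_pow_uniform[OF \<eta>, where d = d and k = k, folded f_def] by (elim exE conjE)
  note \<epsilon>2 = \<epsilon>2'(1) \<epsilon>2'(2)[rule_format]
  obtain \<epsilon>3 where \<epsilon>3': "\<epsilon>3 > 0" "\<forall>w\<in>circle. dist w A < \<epsilon>3 \<longrightarrow> f w = w \<longrightarrow> w = A"
    using sigma_pow_fixed_isolated[OF d k, where z = A, folded f_def] by (elim exE conjE)
  note \<epsilon>3 = \<epsilon>3'(1) \<epsilon>3'(2)[rule_format]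
  obtain \<epsilon>4 where \<epsilon>4': "\<epsilon>4 > 0" "\<forall>w\<in>circle. dist w B < \<epsilon>4 \<longrightarrow> f w = w \<longrightarrow> w = B"
    using sigma_pow_fixed_isolated[OF d k, where z = B, folded f_def] by (elim exE conjE)
  note \<epsilon>4 = \<epsilon>4'(1) \<epsilon>4'(2)[rule_format]
  define \<epsilon> where "\<epsilon> = min (min \<epsilon>2 \<eta>) (min \<epsilon>3 \<epsilon>4)"
  have \<epsilon>: "\<epsilon> > 0" using \<epsilon>2(1) \<epsilon>3(1) \<epsilon>4(1) \<eta> by (simp add: \<epsilon>_def)
  obtain \<delta>1 where \<delta>1: "\<delta>1 > 0" "\<And>M U. geolamination M \<Longrightarrow> U \<in> gaps M \<Longrightarrow> hausdorff_dist U H < \<delta>1 \<Longrightarrow>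
      \<exists>a'\<in>circle. \<exists>b'\<in>circle. a' \<noteq> b' \<and> closed_segment a' b' \<in> edges U \<and> dist a' A < \<epsilon> \<and> dist b' B < \<epsilon>"
    using close_edge[OF L H AB(1-4) \<epsilon>] by blast
  define \<delta> where "\<delta> = min \<delta>1 (min \<epsilon>1 (\<epsilon>2\<^sup>2 / 2))"
  show ?thesis unfolding persistent_edge_iff[OF L H]
  proof (intro exI conjI ballI impI)
    show "\<delta> > 0" using \<delta>1(1) \<epsilon>1(1) \<epsilon>2(1) by (simp add: \<delta>_def)
    fix M U assume M: "M \<in> q_geolaminations d" and U: "U \<in> gaps M"
      and near: "hausdorff_dist U H < \<delta>"
    obtain R where R: "invariant_lamination d R" "M = geolam_of R" "geolamination M"
      using q_geolaminationE[OF M] .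
    have CH: "C \<in> H" using C(1) by (simp add: basis_def)
    obtain v where v: "v \<in> U" "dist C v < \<delta>" using gap_close_point(1)[OF L H R(3) U near CH] by blast
    have "hausdorff_dist U H < \<delta>1" using near by (simp add: \<delta>_def)
    then obtain a b where ab: "a \<in> circle" "b \<in> circle" "closed_segment a b \<in> edges U"
      "dist a A < \<epsilon>" "dist b B < \<epsilon>"
      using \<delta>1(2)[OF R(3) U] by blast
    have abU: "a \<in> basis U" "b \<in> basis U" using edge_ends_basis[OF R(3) U ab(3,1,2)] .
    have abU': "a \<in> U" "b \<in> U" using abU by (simp_all add: basis_def)
    have leaf: "closed_segment a b \<in> M" by (rule gap_edge_leaf[OF R(3) U ab(3)])
    have "hausdorff_dist U H < \<epsilon>2\<^sup>2 / 2" using near by (simp add: \<delta>_def)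
    then obtain c' where c': "c' \<in> basis U" "dist c' c < \<epsilon>2"
      using basis_close(1)[OF L H R(3) U \<epsilon>2(1) _ c(1)] by blast
    have cc: "c \<in> circle" "c' \<in> circle" using c(1) c'(1) by (auto simp: basis_def)
    have df: "dist A (f a) < \<eta>" "dist B (f b) < \<eta>" "dist C (f c') < \<eta>"
      using \<epsilon>2(2)[OF AB(1) ab(1)] \<epsilon>2(2)[OF AB(2) ab(2)] \<epsilon>2(2)[OF cc c'(2)] ab(4,5) fAB c(2)
      by (simp_all add: \<epsilon>_def dist_commute)
    have da: "dist A a < \<eta>" "dist B b < \<eta>" using ab(4,5) by (simp_all add: \<epsilon>_def dist_commute)
    have sc: "side a b (f c') > 0" using \<epsilon>1(2) da df(3) by (simp add: \<eta>_def)
    have sv: "side (f a) (f b) v > 0" using \<epsilon>1(2) df(1,2) v(2) by (simp add: \<eta>_def \<delta>_def)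
    have "dist A B \<le> dist A a + dist a b + dist b B"
      using dist_triangle[of A B a] dist_triangle[of a B b] by linarith
    moreover have "10 * \<eta> \<le> dist A B" by (simp add: \<eta>_def)
    moreover have "dist b B < \<eta>" using da(2) by (simp add: dist_commute)
    ultimately have "dist a b > 8 * \<eta>" using da(1) by linarith
    moreover have "dist a (f a) < 2 * \<eta>" "dist b (f b) < 2 * \<eta>"
      using dist_triangle3[of a "f a" A] dist_triangle3[of b "f b" B] da df(1,2) by linarith+
    ultimately have small: "dist a (f a) < dist a b / 2" "dist b (f b) < dist a b / 2"
      using \<eta> by (simp_all add: field_simps)
    have "f a = a" "f b = b"
      using edge_pinned[OF R(1) d1 U[unfolded R(2)] U[unfolded R(2)] ab(1,2) leaf[unfolded R(2)] abU' abU
          leaf[unfolded R(2)] c'(1) sc[unfolded f_def] v(1) sv[unfolded f_def]] small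
      by (simp_all add: f_def)
    hence "a = A" "b = B" using \<epsilon>3(2)[OF ab(1)] \<epsilon>4(2)[OF ab(2)] ab(4,5) by (simp_all add: \<epsilon>_def)
    thus "closed_segment A B \<in> edges U" using ab(3) by simp
  qed
qed

section \<open>Images of edges in the closure, and periodic edges\<close>

lemma q_closureE:
  assumes "L \<in> q_closure d" "e > 0"
  obtains M where "M \<in> q_geolaminations d" "hausdorff_dist (solid M) (solid L) < e"
  using assms unfolding q_closure_def by blast

text \<open>The image of an edge lies in the solid because it is a limit of leaves of nearby
  q-geolaminations; it need not be a leaf of \<open>L\<close> a priori.\<close>

lemma edge_image_solid:
  assumes LC: "L \<in> q_closure d" and L: "geolamination L" and G: "G \<in> gaps L"
    and ab: "a \<in> circle" "b \<in> circle" "a \<noteq> b" "closed_segment a b \<in> edges G"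
  shows "closed_segment ((sigma d ^^ k) a) ((sigma d ^^ k) b) \<subseteq> solid L"
proof
  define f where "f = sigma d ^^ k"
  fix x assume "x \<in> closed_segment ((sigma d ^^ k) a) ((sigma d ^^ k) b)"
  then obtain t where t: "x = (1 - t) *\<^sub>R f a + t *\<^sub>R f b" "0 \<le> t" "t \<le> 1"
    by (auto simp: in_segment f_def)
  have "infdist x (solid L) \<le> 0 + e" if e: "e > 0" for e
  proof -
    have e2: "e / 2 > 0" using e by simp
    obtain \<epsilon> where \<epsilon>': "\<epsilon> > 0"
      "\<forall>z\<in>circle. \<forall>z'\<in>circle. dist z' z < \<epsilon> \<longrightarrow> dist (f z') (f z) < e / 2"
      using sigma_pow_uniform[OF e2, where d = d and k = k, folded f_def] by (elim exE conjE)
    note \<epsilon> = \<epsilon>'(1) \<epsilon>'(2)[rule_format]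
    obtain \<delta>1 where \<delta>1: "\<delta>1 > 0" "\<And>M U. geolamination M \<Longrightarrow> U \<in> gaps M \<Longrightarrow> hausdorff_dist U G < \<delta>1 \<Longrightarrow>
        \<exists>a'\<in>circle. \<exists>b'\<in>circle. a' \<noteq> b' \<and> closed_segment a' b' \<in> edges U \<and> dist a' a < \<epsilon> \<and> dist b' b < \<epsilon>"
      using close_edge[OF L G ab \<epsilon>(1)] by blast
    obtain \<delta>2 where \<delta>2: "\<delta>2 > 0" "\<And>M. geolamination M \<Longrightarrow> hausdorff_dist (solid M) (solid L) < \<delta>2 \<Longrightarrow>
        \<exists>V\<in>gaps M. hausdorff_dist V G < \<delta>1"
      using exists_close_gap[OF L G \<delta>1(1)] by blast
    have "min \<delta>2 (e / 2) > 0" using \<delta>2(1) e by simp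
    then obtain M where M: "M \<in> q_geolaminations d" "hausdorff_dist (solid M) (solid L) < min \<delta>2 (e / 2)"
      using q_closureE[OF LC] by blast
    obtain R where R: "invariant_lamination d R" "M = geolam_of R" "geolamination M"
      using q_geolaminationE[OF M(1)] .
    obtain U where U: "U \<in> gaps M" "hausdorff_dist U G < \<delta>1" using \<delta>2(2)[OF R(3)] M(2) by auto
    obtain a' b' where ab': "a' \<in> circle" "b' \<in> circle" "closed_segment a' b' \<in> edges U"
      "dist a' a < \<epsilon>" "dist b' b < \<epsilon>"
      using \<delta>1(2)[OF R(3) U] by blast
    have "closed_segment (f a') (f b') \<in> M"
      using leaf_image_pow[OF R(1) _ ab'(1,2)] gap_edge_leaf[OF R(3) U(1) ab'(3)] R(2) by (simp add: f_def)
    \<comment> \<open>The point of the nearby leaf with the same parameter \<open>t\<close> as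
      \<open>x\<close>.\<close>
    moreover define x' where "x' = (1 - t) *\<^sub>R f a' + t *\<^sub>R f b'"
    have "x' \<in> closed_segment (f a') (f b')" using t(2,3) unfolding x'_def by (auto simp: in_segment)
    ultimately have "x' \<in> solid M" unfolding solid_def by blast
    moreover have "bounded (solid M)" by (intro compact_imp_bounded compact_solid R(3))
    moreover have "hausdorff_dist (solid M) (solid L) < e / 2" using M(2) by simp
    ultimately obtain y where y: "y \<in> solid L" "dist x' y < e / 2"
      using hausdorff_dist_lessD solid_nonempty[OF L] by metis
    have "x' - x = (1 - t) *\<^sub>R (f a' - f a) + t *\<^sub>R (f b' - f b)"
      by (simp add: x'_def t(1) algebra_simps)
    hence "norm (x' - x) \<le> (1 - t) * norm (f a' - f a) + t * norm (f b' - f b)"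
      using norm_triangle_ineq[of "(1 - t) *\<^sub>R (f a' - f a)" "t *\<^sub>R (f b' - f b)"] t(2,3) by simp
    also have "\<dots> \<le> (1 - t) * (e / 2) + t * (e / 2)"
      using \<epsilon>(2)[OF ab(1) ab'(1,4)] \<epsilon>(2)[OF ab(2) ab'(2,5)] t(2,3)
      by (intro add_mono mult_left_mono) (auto simp: dist_norm)
    also have "\<dots> = e / 2" by (simp add: field_simps)
    finally have "dist x x' \<le> e / 2" by (simp add: dist_norm norm_minus_commute)
    hence "dist x y \<le> e" using dist_triangle[of x y x'] y(2) by simp
    thus ?thesis using infdist_le2[OF y(1)] by simp
  qed
  hence "infdist x (solid L) \<le> 0" by (rule field_le_epsilon)
  hence "infdist x (solid L) = 0" using infdist_nonneg[of x "solid L"] by linarith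
  thus "x \<in> solid L"
    using in_closed_iff_infdist_zero[of "solid L" x] solid_nonempty[OF L] L by (simp add: geolamination_def)
qed

text \<open>The interior of a gap misses the solid, so a chord of the gap that lies in the solid
  lies in the frontier.\<close>

lemma chord_in_gap_edge:
  assumes "geolamination L" "H \<in> gaps L" "A \<in> basis H" "B \<in> basis H" "A \<noteq> B" "closed_segment A B \<subseteq> solid L"
  shows "closed_segment A B \<in> edges H"
proof -
  have "closed_segment A B \<subseteq> H"
    using assms(3,4) gap_convex[OF assms(1,2)] by (intro closed_segment_subset) (auto simp: basis_def)
  hence "closed_segment A B \<subseteq> frontier H"
    using assms(6) gap_interior(3)[OF assms(1,2)] closure_subset[of H] by (auto simp: frontier_def)
  thus ?thesis using assms(3-5) unfolding edges_def basis_def by blast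
qed

lemma basis_subset_circle: "basis G \<subseteq> circle"
  by (auto simp: basis_def)

lemma basis_sigma_img: "basis (sigma_img d k G) = (sigma d ^^ k) ` basis G"
  unfolding sigma_img_def
  by (rule basis_hull) (use sigma_pow_circle basis_subset_circle in blast)

lemma sigma_img_chord:
  assumes "a \<in> circle" "b \<in> circle"
  shows "sigma_img d k (closed_segment a b) = closed_segment ((sigma d ^^ k) a) ((sigma d ^^ k) b)"
  unfolding sigma_img_def basis_chord[OF assms] by (simp add: segment_convex_hull)

lemma funpow_image_fixed: "f ` S = S \<Longrightarrow> (f ^^ n) ` S = S"
proof (induction n)
  case (Suc n)
  have "(f ^^ Suc n) ` S = f ` (f ^^ n) ` S" by auto
  thus ?case using Suc by simp
qed simp

lemma funpow_fixed: "f x = x \<Longrightarrow> (f ^^ n) x = x"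
  by (induction n) auto

lemma periodic_pair_fixed:
  assumes "f ` {x, y} = {x, y}"
  shows "(f ^^ 2) x = x" "(f ^^ 2) y = y"
  using assms by (auto simp: numeral_2_eq_2 doubleton_eq_iff)

lemma persistent_periodic_edge:
  assumes d: "d \<ge> 2" and L: "geolamination L" and H: "H \<in> gaps L" and l: "l \<in> edges H"
    and per: "periodic d H" "periodic d l"
  shows "persistent_edge d L H l"
proof -
  obtain A B where AB: "A \<in> circle" "B \<in> circle" "A \<noteq> B" "l = closed_segment A B" "A \<in> H" "B \<in> H"
    "\<forall>z\<in>H. side A B z \<ge> 0"
    using edge_orientE[OF L H l] .
  obtain n where n: "n > 0" "(sigma d ^^ n) ` basis H = basis H" using per(1) unfolding periodic_def by blast
  obtain m where m: "m > 0" "(sigma d ^^ m) ` {A, B} = {A, B}"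
    using per(2) unfolding periodic_def AB(4) basis_chord[OF AB(1,2)] by blast
  \<comment> \<open>A common multiple of the two periods, doubled because the leaf may return with
    its ends swapped.\<close>
  define k where "k = n * (2 * m)"
  have k: "(sigma d ^^ k) = (((sigma d ^^ m) ^^ 2) ^^ n)" "(sigma d ^^ k) = ((sigma d ^^ n) ^^ (2 * m))"
    by (simp_all add: k_def funpow_mult mult.commute mult.left_commute)
  have "k > 0" using n m by (simp add: k_def)
  moreover have "(sigma d ^^ k) A = A" "(sigma d ^^ k) B = B"
    unfolding k(1) by (rule funpow_fixed, rule periodic_pair_fixed[OF m(2)])+
  moreover have "(sigma d ^^ k) ` basis H = basis H"
    unfolding k(2) by (rule funpow_image_fixed[OF n(2)])
  ultimately show ?thesis
    unfolding AB(4) using persistent_fixed_edge[OF d _ L H AB(1-3) l[unfolded AB(4)] AB(7)] by blast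
qed

lemma persistent_edge_preimage:
  assumes d: "d \<ge> 1" and L: "geolamination L" and G: "G \<in> gaps L" and H: "H \<in> gaps L"
    and lhat: "lhat \<in> edges H" and l: "l \<in> edges G" and img: "H = sigma_img d k G" "sigma_img d k l = lhat"
    and pers: "persistent_edge d L H lhat"
  shows "persistent_edge d L G l"
proof -
  obtain A B where AB: "A \<in> circle" "B \<in> circle" "A \<noteq> B" "lhat = closed_segment A B" "A \<in> H" "B \<in> H"
    "\<forall>z\<in>H. side A B z \<ge> 0"
    using edge_orientE[OF L H lhat] .
  obtain a b where ab: "a \<in> circle" "b \<in> circle" "a \<noteq> b" "l = closed_segment a b"
    using edgesE[OF l] by metis
  have bas: "basis H = (sigma d ^^ k) ` basis G" using img(1) basis_sigma_img by metis
  have "closed_segment ((sigma d ^^ k) a) ((sigma d ^^ k) b) = closed_segment A B"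
    using img(2) sigma_img_chord[OF ab(1,2)] ab(4) AB(4) by metis
  hence "((sigma d ^^ k) a = A \<and> (sigma d ^^ k) b = B) \<or> ((sigma d ^^ k) b = A \<and> (sigma d ^^ k) a = B)"
    by (auto simp: doubleton_eq_iff)
  thus ?thesis
  proof
    assume "(sigma d ^^ k) a = A \<and> (sigma d ^^ k) b = B"
    thus ?thesis
      using persistent_edge_pullback[OF d L G H ab(1-3) l[unfolded ab(4)] bas _ _ AB(3) lhat[unfolded AB(4)] AB(7) pers[unfolded AB(4)]]
        ab(4) by metis
  next
    have l': "l = closed_segment b a" using ab(4) by (simp add: closed_segment_commute)
    assume "(sigma d ^^ k) b = A \<and> (sigma d ^^ k) a = B"
    thus ?thesis
      using persistent_edge_pullback[OF d L G H ab(2,1) ab(3)[symmetric] l[unfolded l'] bas _ _ AB(3) lhat[unfolded AB(4)] AB(7) pers[unfolded AB(4)]]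
        l' by metis
  qed
qed

section \<open>Rigidity\<close>

text \<open>Rigidity assumes closeness of solids only; the gap near \<open>G\<close> that
  persistence requires is provided by \<open>exists_close_gap\<close>.\<close>

lemma persistent_edge_rigid:
  assumes L: "geolamination L" and G: "G \<in> gaps L" and l: "l \<in> edges G" and pers: "persistent_edge d L G l"
  shows "rigid_leaf d L l"
proof -
  obtain \<delta> where \<delta>: "\<delta> > 0" "\<And>M U. M \<in> q_geolaminations d \<Longrightarrow> U \<in> gaps M \<Longrightarrow>
       hausdorff_dist (solid M) (solid L) < \<delta> \<Longrightarrow> hausdorff_dist U G < \<delta> \<Longrightarrow> l \<in> edges U"
    using pers unfolding persistent_edge_iff[OF L G] by blast
  obtain \<delta>2 where \<delta>2: "\<delta>2 > 0" "\<And>M. geolamination M \<Longrightarrow> hausdorff_dist (solid M) (solid L) < \<delta>2 \<Longrightarrow>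
      \<exists>U\<in>gaps M. hausdorff_dist U G < \<delta>"
    using exists_close_gap[OF L G \<delta>(1)] by blast
  have "l \<in> M" if M: "M \<in> q_geolaminations d" "hausdorff_dist (solid M) (solid L) < min \<delta> \<delta>2" for M
  proof -
    note gM = q_geolamination[OF M(1)]
    obtain U where U: "U \<in> gaps M" "hausdorff_dist U G < \<delta>" using \<delta>2(2)[OF gM] M(2) by auto
    hence "l \<in> edges U" using \<delta>(2) M by simp
    thus ?thesis by (rule gap_edge_leaf[OF gM U(1)])
  qed
  moreover have "min \<delta> \<delta>2 > 0" using \<delta>(1) \<delta>2(1) by simp
  ultimately show ?thesis unfolding rigid_leaf_def using gap_edge_leaf[OF L G l] by blast
qed

lemma rigid_preperiodic_edge:
  assumes d: "d \<ge> 2" and LC: "L \<in> q_closure d" and L: "geolamination L" and G: "G \<in> gaps L" and l: "l \<in> edges G"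
    and H: "sigma_img d k G \<in> gaps L" "periodic d (sigma_img d k G)"
    and pre: "preperiodic_edge d L l"
  shows "rigid_leaf d L l"
proof -
  define H where "H = sigma_img d k G"
  note H = H[folded H_def]
  define f where "f = (\<lambda>i. sigma d ^^ i)"
  have f_add: "f (i + j) x = f i (f j x)" for i j x by (simp add: f_def funpow_add)
  have f_mult: "f (i * j) x = (f i ^^ j) x" for i j x by (simp add: f_def funpow_mult mult.commute)
  have fc: "z \<in> circle \<Longrightarrow> f i z \<in> circle" for i z unfolding f_def by (rule sigma_pow_circle)
  obtain a b where ab: "a \<in> circle" "b \<in> circle" "a \<noteq> b" "l = closed_segment a b"
    using edgesE[OF l] by metis
  obtain j where j: "nondegenerate (sigma_img d j l)" "periodic d (sigma_img d j l)"
    using pre unfolding preperiodic_edge_def by blast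
  define x y where "x = f j a" and "y = f j b"
  have xy: "x \<in> circle" "y \<in> circle" using fc ab by (simp_all add: x_def y_def)
  have img_j: "sigma_img d j l = closed_segment x y"
    using sigma_img_chord[OF ab(1,2)] by (simp add: ab(4) x_def y_def f_def)
  have "x \<noteq> y" using j(1) unfolding img_j nondegenerate_def by auto
  obtain m where m: "m > 0" "f m ` {x, y} = {x, y}"
    using j(2) unfolding img_j periodic_def basis_chord[OF xy] f_def by blast
  have fx: "f (m * 2) x = x" "f (m * 2) y = y"
    using periodic_pair_fixed[OF m(2)] by (simp_all add: f_mult)
  obtain n where n: "n > 0" "f n ` basis H = basis H" using H(2) unfolding periodic_def f_def by blast
  have bH: "basis H = f k ` basis G" unfolding H_def f_def by (rule basis_sigma_img)
  \<comment> \<open>The times \<open>j\<close> and \<open>k\<close> are unrelated. Adding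
    \<open>j\<close> rounds of the period \<open>n\<close> of \<open>H\<close> makes
    \<open>K \<ge> j\<close> while the image of \<open>G\<close> is still \<open>H\<close>, so at
    time \<open>K\<close> the image of the leaf is already periodic.\<close>
  define K where "K = n * j + k"
  have "f K ` basis G = f (n * j) ` basis H" unfolding bH K_def by (auto simp: f_add image_image)
  also have "\<dots> = basis H" using funpow_image_fixed[OF n(2), of j] by (simp add: f_mult[abs_def])
  finally have "sigma_img d K G = H"
    unfolding sigma_img_def f_def using gap_hull_basis[OF L H(1)] by simp
  have "K \<ge> j" using n(1) by (simp add: K_def trans_le_add1)
  define i where "i = K - j"
  have K: "K = i + j" using \<open>K \<ge> j\<close> by (simp add: i_def)
  define A B where "A = f K a" and "B = f K b"
  have AB: "A = f i x" "B = f i y" by (simp_all add: A_def B_def x_def y_def K f_add)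
  \<comment> \<open>An iterate that returns \<open>x\<close> and \<open>y\<close> to themselves
    factors through \<open>f i\<close>, so \<open>f i\<close> cannot identify them.\<close>
  have "A \<noteq> B"
  proof
    assume "A = B"
    have "m * 2 * i \<ge> i" using m(1) by simp
    hence e: "m * 2 * i = (m * 2 * i - i) + i" by simp
    have "f (m * 2 * i) x = x" "f (m * 2 * i) y = y" using fx by (simp_all add: f_mult[of "m * 2"] funpow_fixed)
    hence "x = f (m * 2 * i - i) A" "y = f (m * 2 * i - i) B" using e f_add AB by metis+
    thus False using \<open>A = B\<close> \<open>x \<noteq> y\<close> by simp
  qed
  have "f (m * 2) (f i z) = f i (f (m * 2) z)" for z using f_add by (metis add.commute)
  hence "f (m * 2) A = A" "f (m * 2) B = B" using fx AB by simp_all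
  have ABc: "A \<in> circle" "B \<in> circle" using fc ab by (simp_all add: A_def B_def)
  have "periodic d (closed_segment A B)"
    unfolding periodic_def basis_chord[OF ABc]
    using \<open>f (m * 2) A = A\<close> \<open>f (m * 2) B = B\<close> m(1) by (intro exI[of _ "m * 2"]) (simp add: f_def)
  have img_K: "sigma_img d K l = closed_segment A B"
    using sigma_img_chord[OF ab(1,2)] by (simp add: ab(4) A_def B_def f_def)
  have "a \<in> basis G" "b \<in> basis G" using edge_ends_basis[OF L G l[unfolded ab(4)] ab(1,2)] .
  hence "A \<in> basis H" "B \<in> basis H"
    using \<open>f K ` basis G = f (n * j) ` basis H\<close> \<open>f (n * j) ` basis H = basis H\<close> unfolding A_def B_def by blast+
  \<comment> \<open>\<open>preperiodic_edge\<close> speaks about the leaf at time \<open>j\<close>;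
    at time \<open>K\<close> the image is only known to lie in the solid, which for a chord with
    ends in \<open>basis H\<close> is enough to be an edge.\<close>
  moreover have "closed_segment A B \<subseteq> solid L"
    using edge_image_solid[OF LC L G ab(1-3) l[unfolded ab(4)], of K] by (simp add: A_def B_def f_def)
  ultimately have e: "closed_segment A B \<in> edges H"
    using chord_in_gap_edge[OF L H(1)] \<open>A \<noteq> B\<close> by blast
  have "persistent_edge d L H (closed_segment A B)"
    using persistent_periodic_edge[OF d L H(1) e H(2)] \<open>periodic d (closed_segment A B)\<close> by blast
  hence "persistent_edge d L G l"
    using persistent_edge_preimage[OF _ L G H(1) e l _ img_K] \<open>sigma_img d K G = H\<close> d by auto
  thus ?thesis by (rule persistent_edge_rigid[OF L G l])
qed

section \<open>Finite gaps\<close>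

lemma finite_surj_period:
  assumes "finite S" "f ` S = S" "x \<in> S"
  shows "\<exists>p>0. (f ^^ p) x = x"
proof -
  have S: "(f ^^ i) ` S = S" for i by (rule funpow_image_fixed[OF assms(2)])
  have "range (\<lambda>i. (f ^^ i) x) \<subseteq> S" using S assms(3) by blast
  hence "finite (range (\<lambda>i. (f ^^ i) x))" using assms(1) finite_subset by blast
  hence "\<not> inj (\<lambda>i. (f ^^ i) x)" using finite_imageD infinite_UNIV_nat by blast
  then obtain i j where ij: "i < j" "(f ^^ i) x = (f ^^ j) x"
    unfolding inj_def by (metis linorder_neqE_nat)
  have "inj_on (f ^^ i) S" using S assms(1) by (intro eq_card_imp_inj_on) simp_all
  moreover have "(f ^^ j) x = (f ^^ i) ((f ^^ (j - i)) x)"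
    using funpow_add[of i "j - i" f] ij(1) by simp
  moreover have "(f ^^ (j - i)) x \<in> S" using S assms(3) by blast
  ultimately have "x = (f ^^ (j - i)) x" using ij(2) assms(3) by (metis inj_onD)
  thus ?thesis using ij(1) by (intro exI[of _ "j - i"]) simp
qed

text \<open>A return map of \<open>H\<close> permutes its finite basis, so each end of the edge is
  periodic under it; the product of the periods fixes both.\<close>

lemma finite_gap_edge_periodic:
  assumes L: "geolamination L" and H: "H \<in> gaps L" "finite (basis H)" "periodic d H" and l: "l \<in> edges H"
  shows "periodic d l"
proof -
  obtain A B where AB: "A \<in> circle" "B \<in> circle" "A \<noteq> B" "l = closed_segment A B"
    using edgesE[OF l] by metis
  have bas: "A \<in> basis H" "B \<in> basis H" using edge_ends_basis[OF L H(1) l[unfolded AB(4)] AB(1,2)] .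
  obtain n where n: "n > 0" "(sigma d ^^ n) ` basis H = basis H" using H(3) unfolding periodic_def by blast
  obtain p q where p: "p > 0" "((sigma d ^^ n) ^^ p) A = A" and q: "q > 0" "((sigma d ^^ n) ^^ q) B = B"
    using finite_surj_period[OF H(2) n(2)] bas by blast
  define k where "k = n * p * q"
  have "sigma d ^^ k = ((sigma d ^^ n) ^^ p) ^^ q" "sigma d ^^ k = ((sigma d ^^ n) ^^ q) ^^ p"
    by (simp_all add: k_def funpow_mult mult.commute mult.left_commute)
  hence "(sigma d ^^ k) A = A" "(sigma d ^^ k) B = B" using p q funpow_fixed by metis+
  moreover have "k > 0" using n p q by (simp add: k_def)
  ultimately show ?thesis
    unfolding periodic_def AB(4) basis_chord[OF AB(1,2)] by (intro exI[of _ k]) simp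
qed

lemma finite_uniform_delta:
  fixes P :: "'a \<Rightarrow> real \<Rightarrow> bool"
  assumes "finite S" "\<And>x. x \<in> S \<Longrightarrow> \<exists>\<delta>>0. P x \<delta>" "\<And>x \<delta> \<delta>'. P x \<delta> \<Longrightarrow> \<delta>' \<le> \<delta> \<Longrightarrow> P x \<delta>'"
  shows "\<exists>\<delta>>0. \<forall>x\<in>S. P x \<delta>"
  using assms(1,2)
proof (induction S rule: finite_induct)
  case empty
  show ?case by (intro exI[of _ 1]) simp
next
  case (insert x S)
  obtain \<delta>1 where 1: "\<delta>1 > 0" "\<forall>x\<in>S. P x \<delta>1" using insert.IH insert.prems by blast
  obtain \<delta>2 where 2: "\<delta>2 > 0" "P x \<delta>2" using insert.prems by blast
  have "\<forall>y\<in>insert x S. P y (min \<delta>1 \<delta>2)" using 1(2) 2(2) assms(3) by (metis insert_iff min.cobounded1 min.cobounded2)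
  thus ?case using 1(1) 2(1) by (intro exI[of _ "min \<delta>1 \<delta>2"]) simp
qed

text \<open>One half of the pinning argument: the persistent edge is a leaf of \<open>M\<close>, and
  a point of \<open>U\<close> near a preimage of \<open>C\<close> shows on which side of this leaf
  the image of \<open>U\<close> lies.\<close>

lemma gap_image_beyond_edge:
  assumes d: "d \<ge> 1" and L: "geolamination L" and G: "G \<in> gaps L" and H: "H \<in> gaps L"
    and img: "basis H = (sigma d ^^ k) ` basis G"
    and AB: "A \<in> circle" "B \<in> circle" "A \<noteq> B" "closed_segment A B \<in> edges H" "\<forall>z\<in>H. side A B z \<ge> 0"
    and pers: "persistent_edge d L H (closed_segment A B)"
  shows "\<exists>\<delta>>0. \<forall>M\<in>q_geolaminations d. \<forall>U\<in>gaps M. hausdorff_dist (solid M) (solid L) < \<delta> \<longrightarrow>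
     hausdorff_dist U G < \<delta> \<longrightarrow> (\<forall>c\<in>basis U. side A B ((sigma d ^^ k) c) \<ge> 0)"
proof -
  define f where "f = sigma d ^^ k"
  obtain \<delta>0 where \<delta>0: "\<delta>0 > 0" "\<And>M U. M \<in> q_geolaminations d \<Longrightarrow> U \<in> gaps M \<Longrightarrow>
       hausdorff_dist (solid M) (solid L) < \<delta>0 \<Longrightarrow> hausdorff_dist U H < \<delta>0 \<Longrightarrow> closed_segment A B \<in> edges U"
    using pers unfolding persistent_edge_iff[OF L H] by blast
  obtain \<delta>2 where \<delta>2: "\<delta>2 > 0" "\<And>M. geolamination M \<Longrightarrow> hausdorff_dist (solid M) (solid L) < \<delta>2 \<Longrightarrow>
      \<exists>V\<in>gaps M. hausdorff_dist V H < \<delta>0"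
    using exists_close_gap[OF L H \<delta>0(1)] by blast
  obtain C where C: "C \<in> basis H" "side A B C > 0"
    using gap_basis_strict[OF L H AB] .
  have "C \<in> f ` basis G" using C(1) img by (simp add: f_def)
  then obtain c where c: "c \<in> basis G" "f c = C" by blast
  obtain \<epsilon>1 where \<epsilon>1: "\<epsilon>1 > 0"
    "\<And>x y z. dist A x < \<epsilon>1 \<Longrightarrow> dist B y < \<epsilon>1 \<Longrightarrow> dist C z < \<epsilon>1 \<Longrightarrow> side x y z > 0"
    using side_near[OF C(2)] by blast
  obtain \<epsilon>2 where \<epsilon>2': "\<epsilon>2 > 0"
    "\<forall>z\<in>circle. \<forall>z'\<in>circle. dist z' z < \<epsilon>2 \<longrightarrow> dist (f z') (f z) < \<epsilon>1"
    using sigma_pow_uniform[OF \<epsilon>1(1), where d = d and k = k, folded f_def] by (elim exE conjE)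
  note \<epsilon>2 = \<epsilon>2'(1) \<epsilon>2'(2)[rule_format]
  define \<delta> where "\<delta> = min (min \<delta>0 \<delta>2) (\<epsilon>2\<^sup>2 / 2)"
  show ?thesis
  proof (intro exI conjI ballI impI)
    show "\<delta> > 0" using \<delta>0(1) \<delta>2(1) \<epsilon>2(1) by (simp add: \<delta>_def)
    fix M U u assume M: "M \<in> q_geolaminations d" and U: "U \<in> gaps M"
      and near: "hausdorff_dist (solid M) (solid L) < \<delta>" "hausdorff_dist U G < \<delta>" and u: "u \<in> basis U"
    obtain R where R: "invariant_lamination d R" "M = geolam_of R" "geolamination M"
      using q_geolaminationE[OF M] .
    have "hausdorff_dist (solid M) (solid L) < \<delta>2" using near(1) by (simp add: \<delta>_def)
    then obtain V where V: "V \<in> gaps M" "hausdorff_dist V H < \<delta>0" using \<delta>2(2) R(3) by blast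
    have "closed_segment A B \<in> edges V" using \<delta>0(2)[OF M V(1)] near(1) V(2) by (simp add: \<delta>_def)
    hence leaf: "closed_segment A B \<in> geolam_of R" using gap_edge_leaf[OF R(3) V(1)] R(2) by simp
    have "hausdorff_dist U G < \<epsilon>2\<^sup>2 / 2" using near(2) by (simp add: \<delta>_def)
    then obtain c' where c': "c' \<in> basis U" "dist c' c < \<epsilon>2"
      using basis_close(1)[OF L G R(3) U \<epsilon>2(1) _ c(1)] by blast
    have cc: "c \<in> circle" "c' \<in> circle" using c(1) c'(1) by (auto simp: basis_def)
    have "dist C (f c') < \<epsilon>1" using \<epsilon>2(2)[OF cc c'(2)] c(2) by (simp add: dist_commute)
    hence "side A B (f c') > 0" using \<epsilon>1 by simp
    thus "side A B ((sigma d ^^ k) u) \<ge> 0"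
      using gap_image_one_side[OF R(1) d U[unfolded R(2)] AB(1,2) leaf c'(1) u] by (simp add: f_def)
  qed
qed

lemma rigid_finite_gap:
  assumes d: "d \<ge> 2" and L: "geolamination L" and G: "G \<in> gaps L" "finite (basis G)"
    and H: "sigma_img d k G \<in> gaps L" "periodic d (sigma_img d k G)"
  shows "rigid_gap d L G"
proof -
  define H where "H = sigma_img d k G"
  note H = H[folded H_def]
  define f where "f = sigma d ^^ k"
  have d1: "d \<ge> 1" using d by simp
  have img: "basis H = (sigma d ^^ k) ` basis G" unfolding H_def by (rule basis_sigma_img)
  have finH: "finite (basis H)" using img G(2) by simp
  \<comment> \<open>Each circle point outside \<open>H\<close> violates the half-plane of one of
    these oriented edges. There are finitely many, so one threshold serves them all and confines the
    image of \<open>basis U\<close> to \<open>basis H\<close>.\<close>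
  define S where "S = {(A, B). A \<in> basis H \<and> B \<in> basis H \<and> A \<noteq> B \<and> closed_segment A B \<in> edges H \<and> (\<forall>z\<in>H. side A B z \<ge> 0)}"
  have "finite S" by (rule finite_subset[of _ "basis H \<times> basis H"]) (auto simp: S_def finH)
  define P where "P = (\<lambda>(A, B) \<delta>. \<forall>M\<in>q_geolaminations d. \<forall>U\<in>gaps M. hausdorff_dist (solid M) (solid L) < \<delta> \<longrightarrow>
     hausdorff_dist U G < \<delta> \<longrightarrow> (\<forall>c\<in>basis U. side A B (f c) \<ge> 0))"
  have "\<exists>\<delta>>0. \<forall>x\<in>S. P x \<delta>"
  proof (rule finite_uniform_delta[OF \<open>finite S\<close>])
    fix x assume "x \<in> S"
    then obtain A B where AB: "x = (A, B)" "A \<in> basis H" "B \<in> basis H" "A \<noteq> B" "closed_segment A B \<in> edges H" "\<forall>z\<in>H. side A B z \<ge> 0"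
      by (auto simp: S_def)
    have ABc: "A \<in> circle" "B \<in> circle" using AB basis_subset_circle by blast+
    have "persistent_edge d L H (closed_segment A B)"
      by (intro persistent_periodic_edge[OF d L H(1) AB(5) H(2)] finite_gap_edge_periodic[OF L H(1) finH H(2) AB(5)])
    thus "\<exists>\<delta>>0. P x \<delta>"
      using gap_image_beyond_edge[OF d1 L G(1) H(1) img ABc AB(4-6)] by (simp add: P_def AB(1) f_def)
  next
    fix x \<delta> \<delta>' assume "P x \<delta>" "\<delta>' \<le> \<delta>"
    thus "P x \<delta>'" unfolding P_def by (cases x) (use less_le_trans in fastforce)
  qed
  then obtain \<delta>1 where \<delta>1: "\<delta>1 > 0" "\<forall>x\<in>S. P x \<delta>1" by blast
  define E where "E = (\<Union>c\<in>basis H. {w. w ^ (d ^ k) = c})"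
  have finE: "finite E" unfolding E_def using finH d by (intro finite_UN_I finite_nth_roots) auto
  have E: "w \<in> E \<longleftrightarrow> f w \<in> basis H" for w by (simp add: E_def f_def sigma_pow)
  \<comment> \<open>Distinct points of \<open>E\<close> are at least \<open>s\<close> apart, so two
    bases inside \<open>E\<close> that are within \<open>s\<close> of each other coincide.\<close>
  have "\<exists>s>0. \<forall>z\<in>E. \<forall>w\<in>E. dist w z < s \<longrightarrow> w = z"
    using finE by (intro finite_uniform_delta finite_isolated) auto
  then obtain s where s: "s > 0" "\<And>w z. w \<in> E \<Longrightarrow> z \<in> E \<Longrightarrow> dist w z < s \<Longrightarrow> w = z" by blast
  have "min \<delta>1 (s\<^sup>2 / 2) > 0" using \<delta>1(1) s(1) by simp
  then obtain \<delta>2 where \<delta>2: "\<delta>2 > 0" "\<And>M. geolamination M \<Longrightarrow> hausdorff_dist (solid M) (solid L) < \<delta>2 \<Longrightarrow>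
      \<exists>U\<in>gaps M. hausdorff_dist U G < min \<delta>1 (s\<^sup>2 / 2)"
    using exists_close_gap[OF L G(1)] by blast
  have "G \<in> gaps M" if M: "M \<in> q_geolaminations d" "hausdorff_dist (solid M) (solid L) < min \<delta>1 \<delta>2" for M
  proof -
    note gM = q_geolamination[OF M(1)]
    obtain U where U: "U \<in> gaps M" "hausdorff_dist U G < min \<delta>1 (s\<^sup>2 / 2)" using \<delta>2(2)[OF gM] M(2) by auto
    have EG: "basis G \<subseteq> E" using E img by (auto simp: f_def)
    have EU: "basis U \<subseteq> E"
    proof
      fix c assume c: "c \<in> basis U"
      show "c \<in> E"
      proof (rule ccontr)
        assume "c \<notin> E"
        have fc: "f c \<in> circle" unfolding f_def by (intro sigma_pow_circle subsetD[OF basis_subset_circle c])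
        hence "f c \<notin> H" using \<open>c \<notin> E\<close> E by (simp add: basis_def)
        then obtain A B where AB: "A \<in> basis H" "B \<in> basis H" "A \<noteq> B" "closed_segment A B \<in> edges H"
          "\<forall>z\<in>H. side A B z \<ge> 0" "side A B (f c) < 0"
          using outside_edge[OF L H(1) fc] by metis
        hence "(A, B) \<in> S" by (simp add: S_def)
        hence "P (A, B) \<delta>1" using \<delta>1(2) by blast
        hence "side A B (f c) \<ge> 0" using M U c by (simp add: P_def)
        thus False using AB(6) by simp
      qed
    qed
    have cl: "hausdorff_dist U G < s\<^sup>2 / 2" using U(2) by simp
    have "basis U = basis G"
    proof
      show "basis G \<subseteq> basis U"
      proof
        fix g assume g: "g \<in> basis G"
        then obtain u where "u \<in> basis U" "dist u g < s" using basis_close(1)[OF L G(1) gM U(1) s(1) cl] by blast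
        thus "g \<in> basis U" using s(2) EG EU g by blast
      qed
      show "basis U \<subseteq> basis G"
      proof
        fix u assume u: "u \<in> basis U"
        then obtain g where "g \<in> basis G" "dist g u < s" using basis_close(2)[OF L G(1) gM U(1) s(1) cl] by blast
        thus "u \<in> basis G" using s(2) EG EU u by blast
      qed
    qed
    hence "U = G" using gap_hull_basis[OF L G(1)] gap_hull_basis[OF gM U(1)] by simp
    thus ?thesis using U(1) by simp
  qed
  moreover have "min \<delta>1 \<delta>2 > 0" using \<delta>1(1) \<delta>2(1) by simp
  ultimately show ?thesis unfolding rigid_gap_def using G(1) by blast
qed

theorem lemma2p7:
  fixes d :: nat and L :: "complex set set"
  assumes "d \<ge> 2" and "L \<in> q_closure d"
  shows
    "(\<forall>G \<in> gaps L. \<forall>k. \<forall>H \<in> gaps L. \<forall>lhat \<in> edges H. \<forall>l \<in> edges G.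
        H = sigma_img d k G \<longrightarrow> persistent_edge d L H lhat \<longrightarrow> sigma_img d k l = lhat \<longrightarrow>
        persistent_edge d L G l)
     \<and> (\<forall>H \<in> gaps L. \<forall>lhat \<in> edges H.
        periodic d H \<longrightarrow> periodic d lhat \<longrightarrow> persistent_edge d L H lhat)
     \<and> (\<forall>G \<in> gaps L. \<forall>l \<in> edges G.
        (\<exists>k. sigma_img d k G \<in> gaps L \<and> periodic d (sigma_img d k G)) \<longrightarrow>
        preperiodic_edge d L l \<longrightarrow> rigid_leaf d L l)
     \<and> (\<forall>G \<in> gaps L. finite (basis G) \<longrightarrow>
        (\<exists>k. sigma_img d k G \<in> gaps L \<and> periodic d (sigma_img d k G)) \<longrightarrow>
        rigid_gap d L G)"
proof -
  have L: "geolamination L" using assms(2) by (simp add: q_closure_def)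
  have d1: "d \<ge> 1" using assms(1) by simp
  show ?thesis
  proof (intro conjI ballI allI impI)
    fix G k H lhat l
    assume "G \<in> gaps L" "H \<in> gaps L" "lhat \<in> edges H" "l \<in> edges G" "H = sigma_img d k G"
      "persistent_edge d L H lhat" "sigma_img d k l = lhat"
    thus "persistent_edge d L G l" using persistent_edge_preimage[OF d1 L] by blast
  next
    fix H lhat
    assume "H \<in> gaps L" "lhat \<in> edges H" "periodic d H" "periodic d lhat"
    thus "persistent_edge d L H lhat" by (rule persistent_periodic_edge[OF assms(1) L])
  next
    fix G l
    assume "G \<in> gaps L" "l \<in> edges G" "\<exists>k. sigma_img d k G \<in> gaps L \<and> periodic d (sigma_img d k G)"
      "preperiodic_edge d L l"
    thus "rigid_leaf d L l" using rigid_preperiodic_edge[OF assms L] by blast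
  next
    fix G
    assume "G \<in> gaps L" "finite (basis G)" "\<exists>k. sigma_img d k G \<in> gaps L \<and> periodic d (sigma_img d k G)"
    thus "rigid_gap d L G" using rigid_finite_gap[OF assms(1) L] by blast
  qed
qed

end
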